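(* Let $X$ be an Asplund space, let $\{\Omega_i\}_{i\in T}$ be a system of closed subsets of $X$ indexed by an arbitrary set $T$, and let $\bar{x}\in\bigcap_{i\in T}\Omega_i$ be a rated extremal point of this system (i.e., an $R$-rated extremal point for some rate function $R$). Then the rated extremal principle holds for $\{\Omega_i\}_{i\in T}$ at $\bar{x}$: for any $\varepsilon>0$ there exist a number $r\in(0,\varepsilon)$, a finite index subset $I\subset T$ with cardinality satisfying $|I|r<\varepsilon$, points $x_i\in\Omega_i\cap B(\bar{x},\varepsilon)$, and dual elements $x_i^*\in\widehat{N}(x_i;\Omega_i)+r\mathbb{B}^*$ for $i\in I$ such that $$\sum_{i\in I}x_i^*=0\quad\text{and}\quad\sum_{i\in I}\|x_i^*\|^2=1.$$
   Context: A Banach space is Asplund if each of its separable subspaces has a separable dual. $\mathbb{B}^*$ is the closed unit ball of the dual $X^*$; $B(\bar{x},\rho)$ is the closed ball centered at $\bar{x}$ with radius $\rho$; $|I|$ is the number of elements of a finite set $I$. Fréchet normal cone: $\widehat{N}(x;\Omega):=\{x^*\in X^*\mid\limsup_{u\to x,\,u\in\Omega}\frac{\langle x^*,u-x\rangle}{\|u-x\|}\le0\}$ for $x\in\Omega$. A function $R(\cdot):\mathbb{R}_+\to\mathbb{R}_+$ is a rate function if there is a real number $M$ such that $rR(r)\le M$ for all $r$ and $\lim_{r\downarrow0}R(r)=\infty$. Rated extremality for infinite systems: given a rate function $R$, a point $\bar{x}\in\bigcap_{i\in T}\Omega_i$ is an $R$-rated extremal point of $\{\Omega_i\}_{i\in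 T}$ if there exist sequences $\{a_{ik}\}_{k\in\mathbb{N}}\subset X$, $i\in T$, with $r_k:=\sup_{i\in T}\|a_{ik}\|\to0$ as $k\to\infty$, such that for each $k\in\mathbb{N}$ there is a finite index subset $I_k\subset T$, with $|I_k|^{3/2}=o(R_k)$ as $k\to\infty$ where $R_k:=R(r_k)$, satisfying $$\bigcap_{i\in I_k}(\Omega_i-a_{ik})\cap B(\bar{x},r_kR_k)=\emptyset\quad\text{for all large } k.$$ *)

theory Defs
  imports "HOL-Analysis.Analysis" "HOL-Library.Landau_Symbols"
begin

text \<open>The dual of a linear subspace \<open>Y\<close> consists of the bounded linear functionals on \<open>Y\<close> itself;
  extensionality makes their representation as total functions unique.\<close>

definition subspace_dual :: "'a::real_normed_vector set \<Rightarrow> ('a \<Rightarrow> real) set" where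
  "subspace_dual Y = {f \<in> extensional Y.
     (\<forall>x\<in>Y. \<forall>y\<in>Y. f (x + y) = f x + f y) \<and>
     (\<forall>c. \<forall>x\<in>Y. f (c *\<^sub>R x) = c * f x) \<and>
     (\<exists>K. \<forall>x\<in>Y. \<bar>f x\<bar> \<le> K * norm x)}"

text \<open>The distance induced by the dual norm. The value 0 outside the dual is only there because
  the locale \<open>Metric_space\<close> asks for a distance that is nonnegative on the whole type.\<close>

definition subspace_dual_dist ::
    "'a::real_normed_vector set \<Rightarrow> ('a \<Rightarrow> real) \<Rightarrow> ('a \<Rightarrow> real) \<Rightarrow> real" where
  "subspace_dual_dist Y f g =
     (if f \<in> subspace_dual Y \<and> g \<in> subspace_dual Y
      then SUP y\<in>{y \<in> Y. norm y \<le> 1}. \<bar>f y - g y\<bar> else 0)"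

lemma subspace_dual_dist_upper:
  assumes f: "f \<in> subspace_dual Y" and g: "g \<in> subspace_dual Y" and "y \<in> Y" "norm y \<le> 1"
  shows "\<bar>f y - g y\<bar> \<le> subspace_dual_dist Y f g"
proof -
  obtain K where K: "\<And>x. x \<in> Y \<Longrightarrow> \<bar>f x\<bar> \<le> K * norm x"
    using f unfolding subspace_dual_def by blast
  obtain L where L: "\<And>x. x \<in> Y \<Longrightarrow> \<bar>g x\<bar> \<le> L * norm x"
    using g unfolding subspace_dual_def by blast
  have "\<bar>f x - g x\<bar> \<le> \<bar>K\<bar> + \<bar>L\<bar>" if "x \<in> Y" "norm x \<le> 1" for x
  proof -
    have "K * norm x \<le> \<bar>K\<bar> * 1" "L * norm x \<le> \<bar>L\<bar> * 1"
      using that by (intro mult_mono; simp)+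
    then show ?thesis using K[OF that(1)] L[OF that(1)] by linarith
  qed
  then have "bdd_above ((\<lambda>x. \<bar>f x - g x\<bar>) ` {x \<in> Y. norm x \<le> 1})"
    by (intro bdd_aboveI2[of _ _ "\<bar>K\<bar> + \<bar>L\<bar>"]) auto
  then have "\<bar>f y - g y\<bar> \<le> (SUP x\<in>{x \<in> Y. norm x \<le> 1}. \<bar>f x - g x\<bar>)"
    using assms by (intro cSUP_upper) auto
  then show ?thesis
    using f g by (simp add: subspace_dual_dist_def)
qed

lemma subspace_dual_dist_least:
  assumes "subspace Y" "f \<in> subspace_dual Y" "g \<in> subspace_dual Y"
    and "\<And>y. y \<in> Y \<Longrightarrow> norm y \<le> 1 \<Longrightarrow> \<bar>f y - g y\<bar> \<le> b"
  shows "subspace_dual_dist Y f g \<le> b"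
proof -
  have "{y \<in> Y. norm y \<le> 1} \<noteq> {}"
    using subspace_0[OF assms(1)] by force
  then show ?thesis
    using assms by (auto simp: subspace_dual_dist_def intro!: cSUP_least)
qed

lemma subspace_dual_dist_eq_0:
  assumes Y: "subspace Y" and f: "f \<in> subspace_dual Y" and g: "g \<in> subspace_dual Y"
    and 0: "subspace_dual_dist Y f g = 0"
  shows "f = g"
proof (rule extensionalityI[of f Y g])
  show "f \<in> extensional Y" "g \<in> extensional Y"
    using f g by (auto simp: subspace_dual_def)
next
  fix y assume y: "y \<in> Y"
  define c where "c = inverse (norm y + 1)"
  have n: "norm y + 1 > 0" by (simp add: add_nonneg_pos)
  have c: "c > 0" using n by (simp add: c_def)
  have "c *\<^sub>R y \<in> Y" using Y y by (simp add: subspace_scale)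
  moreover have "norm (c *\<^sub>R y) \<le> 1"
    using n by (simp add: c_def field_simps)
  ultimately have "f (c *\<^sub>R y) = g (c *\<^sub>R y)"
    using subspace_dual_dist_upper[OF f g, of "c *\<^sub>R y"] 0 by simp
  moreover have "f (c *\<^sub>R y) = c * f y" "g (c *\<^sub>R y) = c * g y"
    using f g y by (auto simp: subspace_dual_def)
  ultimately show "f y = g y" using c by simp
qed

lemma Metric_space_subspace_dual:
  assumes Y: "subspace Y"
  shows "Metric_space (subspace_dual Y) (subspace_dual_dist Y)"
proof
  fix f g
  show "0 \<le> subspace_dual_dist Y f g"
  proof (cases "f \<in> subspace_dual Y \<and> g \<in> subspace_dual Y")
    case True
    then show ?thesis
      using subspace_dual_dist_upper[of f Y g 0] subspace_0[OF Y] by auto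
  qed (auto simp: subspace_dual_dist_def)
  show "subspace_dual_dist Y f g = subspace_dual_dist Y g f"
    by (simp add: subspace_dual_dist_def abs_minus_commute conj_commute)
next
  fix f g assume fg: "f \<in> subspace_dual Y" "g \<in> subspace_dual Y"
  have "subspace_dual_dist Y f f \<le> 0"
    by (rule subspace_dual_dist_least[OF Y fg(1) fg(1)]) simp
  moreover have "0 \<le> subspace_dual_dist Y f f"
    using subspace_dual_dist_upper[OF fg(1) fg(1), of 0] subspace_0[OF Y] by simp
  ultimately show "subspace_dual_dist Y f g = 0 \<longleftrightarrow> f = g"
    using subspace_dual_dist_eq_0[OF Y fg] by auto
next
  fix f g h assume fgh: "f \<in> subspace_dual Y" "g \<in> subspace_dual Y" "h \<in> subspace_dual Y"
  show "subspace_dual_dist Y f h \<le> subspace_dual_dist Y f g + subspace_dual_dist Y g h"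
  proof (rule subspace_dual_dist_least[OF Y fgh(1,3)])
    fix y assume "y \<in> Y" "norm y \<le> 1"
    then show "\<bar>f y - h y\<bar> \<le> subspace_dual_dist Y f g + subspace_dual_dist Y g h"
      using subspace_dual_dist_upper[OF fgh(1,2), of y]
        subspace_dual_dist_upper[OF fgh(2,3), of y] by linarith
  qed
qed

text \<open>Whether subspaces are required to be closed is immaterial: a subspace and its closure are
  separable together and have the same dual.\<close>

definition asplund :: "'a::banach itself \<Rightarrow> bool" where
  "asplund _ \<longleftrightarrow> (\<forall>Y :: 'a set. subspace Y \<and> separable_space (top_of_set Y) \<longrightarrow>
     separable_space (Metric_space.mtopology (subspace_dual Y) (subspace_dual_dist Y)))"

text \<open>At an isolated point \<open>x\<close> of \<open>\<Omega>\<close> the filter is trivial, the upper limit is \<open>-\<infinity>\<close>, and every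
  functional is normal.\<close>

definition frechet_normal_cone ::
    "'a::real_normed_vector set \<Rightarrow> 'a \<Rightarrow> ('a \<Rightarrow>\<^sub>L real) set" where
  "frechet_normal_cone \<Omega> x = {x'. x \<in> \<Omega> \<and>
     Limsup (at x within \<Omega>) (\<lambda>u. ereal (blinfun_apply x' (u - x) / norm (u - x))) \<le> 0}"

text \<open>Functions on the nonnegative reals are total functions on \<open>real\<close> whose values at negative
  arguments are never used.\<close>

definition rate_function :: "(real \<Rightarrow> real) \<Rightarrow> bool" where
  "rate_function R \<longleftrightarrow> (\<forall>r\<ge>0. R r \<ge> 0) \<and> (\<exists>M. \<forall>r\<ge>0. r * R r \<le> M) \<and>
     filterlim R at_top (at_right 0)"

text \<open>The boundedness condition says that the suprema \<open>r k\<close> are real numbers; without it, \<open>SUP\<close>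
  on \<open>real\<close> has no meaning. If \<open>I k\<close> is empty, the intersection of the translates is the whole
  space.\<close>

definition rated_extremal_point ::
    "(real \<Rightarrow> real) \<Rightarrow> 'i set \<Rightarrow> ('i \<Rightarrow> 'a::real_normed_vector set) \<Rightarrow> 'a \<Rightarrow> bool" where
  "rated_extremal_point R T \<Omega> x \<longleftrightarrow> x \<in> (\<Inter>i\<in>T. \<Omega> i) \<and>
     (\<exists>(a :: 'i \<Rightarrow> nat \<Rightarrow> 'a) (r :: nat \<Rightarrow> real) (I :: nat \<Rightarrow> 'i set).
        (\<forall>k. bdd_above ((\<lambda>i. norm (a i k)) ` T)) \<and>
        (\<forall>k. r k = (SUP i\<in>T. norm (a i k))) \<and>
        r \<longlonglongrightarrow> 0 \<and>
        (\<forall>k. finite (I k) \<and> I k \<subseteq> T) \<and>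
        (\<lambda>k. real (card (I k)) powr (3/2)) \<in> o(\<lambda>k. R (r k)) \<and>
        (\<forall>\<^sub>F k in sequentially.
           (\<Inter>i\<in>I k. (\<lambda>w. w - a i k) ` \<Omega> i) \<inter> cball x (r k * R (r k)) = {}))"

end

theory Submission
  imports Defs
begin

text \<open>
  Let \<open>m = |I|\<close>. Extremality makes the function \<open>f(x, z) = (\<Sum>i\<in>I. \<parallel>x i - a i - z\<parallel>\<^sup>2)\<^sup>1\<^sup>/\<^sup>2\<close> positive on
  \<open>(\<Prod>i\<in>I. \<Omega> i) \<times> B(xbar, r R(r))\<close>, while its value at \<open>(xbar, \<dots>, xbar)\<close> is at most \<open>m\<^sup>1\<^sup>/\<^sup>2 r\<close>. If the
  norm is Frechet smooth, the Borwein-Preiss principle yields a minimizer of a smooth perturbation of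
  \<open>f\<close> of slope \<open>O(m\<^sup>1\<^sup>/\<^sup>2 / R(r))\<close>. Its stationarity condition in \<open>x i\<close> gives a Frechet normal to
  \<open>\<Omega> i\<close>, and its stationarity condition in \<open>z\<close> says that the normals almost add up to 0; since \<open>f\<close> has
  a gradient of norm about 1 wherever it is positive, they can be normalized. The factor \<open>m\<close> in
  \<open>m r < \<epsilon>\<close> accounts for the exponent 3/2.

  The smooth case is enough: every separable subspace lies in a separable subspace \<open>Y\<close> into which the
  finite subsets of \<open>X\<close> can be moved almost linearly, almost isometrically and respecting every
  \<open>\<Omega> i\<close>. Limits along these moves extend functionals from \<open>Y\<close> to \<open>X\<close> linearly, with the same norm
  bounds, and turn Frechet normals to \<open>\<Omega> i \<inter> Y\<close> into Frechet normals to \<open>\<Omega> i\<close>. As \<open>Y\<close> has a separable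
  dual, it carries an equivalent Frechet smooth norm.
\<close>

text \<open>Three choices shape the details. The partial gradients at the minimizer satisfy a linear
  relation, their sum being the small functional \<open>tz\<close>, and this relation must survive
  the passage from \<open>Y\<close> to X. Extending each functional separately by Hahn-Banach could
  destroy both the relation and the normality to \<Omega> i, which is tested at points outside
  \<open>Y\<close>. Hence one operator \<open>E\<close> extends all functionals at once, as a limit
  along moves that keep points inside \<Omega> i. At a minimum, an upper first-order estimate of the
  increment already yields stationarity, so derivatives are one-sided throughout, and the concave
  square root enters only through its tangent. The norm enters through its square, which has
  gradient 0 at the origin: some of the differences x i - a i - z may vanish, only not all of them.
  The reduction is made for one fixed large k, so that I and the a i are finite data inside a single
  separable \<open>Y\<close>. On the radius l the slope is
  \<open>s = 16 * sqrt (card I) * r / l\<close>; normalization turns it into the error radius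
  \<open>4 * s\<close>, and for l = r R(r) the product of m and \<open>4 * s\<close> is a multiple
  of m^(3/2) / R(r).\<close>

section \<open>Convergent subfilters and norming functionals\<close>

text \<open>Tychonoff: the functions \<open>\<phi> p\<close> lie in a compact product of intervals,
  so the image of \<open>F\<close> has a cluster point, and intersecting \<open>F\<close> with the
  pulled-back neighbourhoods of that point keeps it proper. This plays the part of an ultrafilter,
  as all coordinates converge along the same filter.\<close>

lemma bounded_family_convergent_subfilter:
  fixes \<phi> :: "'p \<Rightarrow> 'j \<Rightarrow> real"
  assumes "F \<noteq> bot" and bound: "\<And>p j. \<bar>\<phi> p j\<bar> \<le> B j"
  obtains F' z where "F' \<le> F" "F' \<noteq> bot" "\<And>j. ((\<lambda>p. \<phi> p j) \<longlongrightarrow> z j) F'"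
proof -
  define U where "U = PiE UNIV (\<lambda>j. {- B j..B j})"
  have "compactin (product_topology (\<lambda>i. euclidean) UNIV) U"
    unfolding U_def compactin_PiE by (auto simp: compactin_euclidean_iff)
  then have "compact U"
    by (simp add: euclidean_product_topology compactin_euclidean_iff)
  have "\<phi> p \<in> U" for p
    using bound[of p] by (auto simp: U_def abs_le_iff minus_le_iff)
  then have "eventually (\<lambda>x. x \<in> U) (filtermap \<phi> F)"
    by (simp add: eventually_filtermap)
  then obtain z where z: "inf (nhds z) (filtermap \<phi> F) \<noteq> bot"
    using \<open>compact U\<close> \<open>F \<noteq> bot\<close> unfolding compact_filter by (metis filtermap_bot_iff)
  define F' where "F' = inf F (filtercomap \<phi> (nhds z))"
  have "F' \<noteq> bot"
  proof
    assume "F' = bot"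
    then have "eventually (\<lambda>_. False) F'" by simp
    then obtain P Q where P: "eventually P F" and Q: "eventually Q (nhds z)"
      and PQ: "\<And>p. P p \<Longrightarrow> Q (\<phi> p) \<Longrightarrow> False"
      unfolding F'_def eventually_inf eventually_filtercomap by metis
    have "eventually (\<lambda>y. \<not> Q y) (filtermap \<phi> F)"
      unfolding eventually_filtermap using P by eventually_elim (use PQ in blast)
    then have "eventually (\<lambda>_. False) (inf (nhds z) (filtermap \<phi> F))"
      unfolding eventually_inf using Q by blast
    then show False using z by (simp add: trivial_limit_def)
  qed
  moreover have "((\<lambda>p. \<phi> p j) \<longlongrightarrow> z j) F'" for j
  proof -
    have "filterlim \<phi> (nhds z) F'"
      unfolding F'_def filterlim_iff_le_filtercomap by simp
    moreover have "((\<lambda>y. y j) \<longlongrightarrow> z j) (nhds z)"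
    proof (rule topological_tendstoI)
      fix S :: "real set" assume S: "open S" "z j \<in> S"
      have "open ((\<lambda>y :: 'j \<Rightarrow> real. y j) -` S)"
        using S by (intro open_vimage) auto
      then show "eventually (\<lambda>y. y j \<in> S) (nhds z)"
        using S by (auto simp: eventually_nhds)
    qed
    ultimately show ?thesis
      using filterlim_compose by blast
  qed
  moreover have "F' \<le> F" by (simp add: F'_def)
  ultimately show ?thesis using that by blast
qed

section \<open>Hahn-Banach through minimal sublinear functionals\<close>

definition sublinear :: "('a::real_vector \<Rightarrow> real) \<Rightarrow> bool" where
  "sublinear q \<longleftrightarrow> (\<forall>x y. q (x + y) \<le> q x + q y) \<and> (\<forall>c>0. \<forall>x. q (c *\<^sub>R x) = c * q x)"

lemma sublinear_add: "sublinear q \<Longrightarrow> q (x + y) \<le> q x + q y"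
  by (simp add: sublinear_def)

lemma sublinear_scale: "sublinear q \<Longrightarrow> c > 0 \<Longrightarrow> q (c *\<^sub>R x) = c * q x"
  by (simp add: sublinear_def)

lemma sublinear_zero: "sublinear q \<Longrightarrow> q 0 = 0"
  using sublinear_scale[of q 2 0] by simp

lemma sublinear_neg: "sublinear q \<Longrightarrow> - q (- x) \<le> q x"
  using sublinear_zero[of q] sublinear_add[of q x "- x"] by simp

text \<open>\<open>tilt q y\<close> is again sublinear and below \<open>q\<close>. So a minimal sublinear functional equals all of its
  tilts, and \<open>q x = tilt q y x \<le> q (x + y) - q y\<close> makes it additive.\<close>

definition tilt :: "('a::real_vector \<Rightarrow> real) \<Rightarrow> 'a \<Rightarrow> 'a \<Rightarrow> real" where
  "tilt q y u = (INF t\<in>{0..}. q (u + t *\<^sub>R y) - t * q y)"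

lemma tilt_upper:
  assumes q: "sublinear q" and "t \<ge> 0"
  shows "tilt q y u \<le> q (u + t *\<^sub>R y) - t * q y"
proof -
  \<comment> \<open>Subadditivity bounds the family from below, so that \<open>INF\<close> is a
    genuine infimum.\<close>
  have "- q (- u) \<le> q (u + t *\<^sub>R y) - t * q y" if "t \<ge> 0" for t
  proof -
    have "q (t *\<^sub>R y) = t * q y"
      using q that sublinear_zero[OF q] by (cases "t = 0") (auto simp: sublinear_def)
    moreover have "q (t *\<^sub>R y) \<le> q (u + t *\<^sub>R y) + q (- u)"
      using q[unfolded sublinear_def, THEN conjunct1, rule_format, of "u + t *\<^sub>R y" "- u"] by simp
    ultimately show ?thesis by linarith
  qed
  then have "bdd_below ((\<lambda>t. q (u + t *\<^sub>R y) - t * q y) ` {0..})"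
    by (intro bdd_belowI2[of _ "- q (- u)"]) auto
  then show ?thesis
    unfolding tilt_def using \<open>t \<ge> 0\<close> by (intro cINF_lower) auto
qed

lemma tilt_greatest: "(\<And>t. t \<ge> 0 \<Longrightarrow> m \<le> q (u + t *\<^sub>R y) - t * q y) \<Longrightarrow> m \<le> tilt q y u"
  unfolding tilt_def by (intro cINF_greatest) auto

lemma sublinear_tilt:
  assumes q: "sublinear q"
  shows "sublinear (tilt q y)"
  unfolding sublinear_def
proof (intro conjI allI impI)
  fix u v
  \<comment> \<open>The two infima are taken one after the other; their parameters combine to
    \<open>s + t\<close> on the side of \<open>u + v\<close>.\<close>
  have "tilt q y (u + v) - (q (v + t *\<^sub>R y) - t * q y) \<le> q (u + s *\<^sub>R y) - s * q y"
    if "s \<ge> 0" "t \<ge> 0" for s t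
  proof -
    have "tilt q y (u + v) \<le> q ((u + v) + (s + t) *\<^sub>R y) - (s + t) * q y"
      using that by (intro tilt_upper[OF q]) auto
    also have "(u + v) + (s + t) *\<^sub>R y = (u + s *\<^sub>R y) + (v + t *\<^sub>R y)"
      by (simp add: algebra_simps)
    also have "q \<dots> \<le> q (u + s *\<^sub>R y) + q (v + t *\<^sub>R y)"
      using q by (simp add: sublinear_def)
    finally show ?thesis by (simp add: algebra_simps)
  qed
  then have "tilt q y (u + v) - (q (v + t *\<^sub>R y) - t * q y) \<le> tilt q y u" if "t \<ge> 0" for t
    using that by (intro tilt_greatest) auto
  then have "tilt q y (u + v) - tilt q y u \<le> q (v + t *\<^sub>R y) - t * q y" if "t \<ge> 0" for t
    using that by (simp add: algebra_simps)
  then have "tilt q y (u + v) - tilt q y u \<le> tilt q y v"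
    by (intro tilt_greatest) auto
  then show "tilt q y (u + v) \<le> tilt q y u + tilt q y v" by simp
next
  have le: "tilt q y (c *\<^sub>R u) \<le> c * tilt q y u" if c: "c > 0" for c u
  proof -
    have "tilt q y (c *\<^sub>R u) / c \<le> q (u + t *\<^sub>R y) - t * q y" if "t \<ge> 0" for t
    proof -
      have "tilt q y (c *\<^sub>R u) \<le> q (c *\<^sub>R u + (c * t) *\<^sub>R y) - (c * t) * q y"
        using that c by (intro tilt_upper[OF q]) auto
      also have "c *\<^sub>R u + (c * t) *\<^sub>R y = c *\<^sub>R (u + t *\<^sub>R y)" by (simp add: algebra_simps)
      also have "q \<dots> = c * q (u + t *\<^sub>R y)" using q c by (simp add: sublinear_def)
      finally show ?thesis using c by (simp add: field_simps)
    qed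
    then have "tilt q y (c *\<^sub>R u) / c \<le> tilt q y u" by (intro tilt_greatest)
    then show ?thesis using c by (simp add: field_simps)
  qed
  fix c :: real and u assume c: "0 < c"
  have "tilt q y (inverse c *\<^sub>R (c *\<^sub>R u)) \<le> inverse c * tilt q y (c *\<^sub>R u)"
    using c by (intro le) auto
  then have "c * tilt q y u \<le> tilt q y (c *\<^sub>R u)" using c by (simp add: field_simps)
  then show "tilt q y (c *\<^sub>R u) = c * tilt q y u" using le[OF c, of u] by simp
qed

text \<open>Zorn for the sublinear functionals below \<open>p\<close>, ordered downwards. Each of
  them satisfies \<open>- p (- x) \<le> - q (- x) \<le> q x\<close>, so infima over chains are
  finite. A minimal one coincides with its tilts, which makes it additive, hence odd, hence
  linear.\<close>

lemma sublinear_linear_minorant: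
  assumes p: "sublinear p"
  obtains f where "linear f" "\<And>x. f x \<le> p x"
proof -
  define A where "A = {q. sublinear q \<and> (\<forall>x. q x \<le> p x)}"
  have "\<exists>m\<in>A. \<forall>a\<in>A. (\<lambda>f g. g \<le> f) m a \<longrightarrow> a = m"
  proof (rule predicate_Zorn)
    show "partial_order_on A (relation_of (\<lambda>f g. g \<le> f) A)"
      by (rule partial_order_on_relation_ofI) auto
  next
    fix C assume C: "C \<in> Chains (relation_of (\<lambda>f g. g \<le> f) A)"
    have CA: "C \<subseteq> A" and Ctot: "\<And>f g. f \<in> C \<Longrightarrow> g \<in> C \<Longrightarrow> f \<le> g \<or> g \<le> f"
      using C unfolding Chains_def relation_of_def by auto
    show "\<exists>u\<in>A. \<forall>a\<in>C. u \<le> a"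
    proof (cases "C = {}")
      case True
      then show ?thesis using p by (auto simp: A_def intro!: bexI[of _ p])
    next
      case False
      define u where "u x = (INF q\<in>C. q x)" for x
      have bdd: "bdd_below ((\<lambda>q. q x) ` C)" for x
      proof (rule bdd_belowI2[of _ "- p (- x)"])
        fix q assume "q \<in> C"
        then have "sublinear q" "q (- x) \<le> p (- x)" using CA by (auto simp: A_def)
        then show "- p (- x) \<le> q x" using sublinear_neg[of q x] by linarith
      qed
      have le: "u x \<le> q x" if "q \<in> C" for q x
        unfolding u_def using bdd that by (intro cINF_lower) auto
      have ge: "m \<le> u x" if "\<And>q. q \<in> C \<Longrightarrow> m \<le> q x" for m x
        unfolding u_def using False that by (intro cINF_greatest) auto
      have "sublinear u"
        unfolding sublinear_def
      proof (intro conjI allI impI)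
        fix x y
        \<comment> \<open>The infima for \<open>u x\<close> and \<open>u y\<close> range over
          separate members of the chain; totality supplies one member below both, to which
          subadditivity applies.\<close>
        have "u (x + y) - q' y \<le> q x" if "q \<in> C" "q' \<in> C" for q q'
        proof -
          have "q \<le> q' \<or> q' \<le> q" using Ctot that by blast
          then obtain r where r: "r \<in> C" "r \<le> q" "r \<le> q'" using \<open>q \<in> C\<close> \<open>q' \<in> C\<close> by blast
          have "u (x + y) \<le> r (x + y)" using le r by auto
          also have "\<dots> \<le> r x + r y" using r CA by (auto simp: A_def sublinear_def)
          also have "\<dots> \<le> q x + q' y" using r by (intro add_mono) (auto simp: le_fun_def)
          finally show ?thesis by simp
        qed
        then have "u (x + y) - q' y \<le> u x" if "q' \<in> C" for q' using that ge by auto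
        then have "u (x + y) - u x \<le> q' y" if "q' \<in> C" for q' using that by (simp add: algebra_simps)
        then have "u (x + y) - u x \<le> u y" using ge by auto
        then show "u (x + y) \<le> u x + u y" by simp
      next
        fix c :: real and x assume c: "c > 0"
        have *: "q (c *\<^sub>R x) = c * q x" if "q \<in> C" for q
          using that CA c by (auto simp: A_def sublinear_def)
        have "u (c *\<^sub>R x) / c \<le> u x"
          using le[of _ "c *\<^sub>R x"] * c by (intro ge) (auto simp: field_simps)
        moreover have "c * u x \<le> u (c *\<^sub>R x)"
          using le[of _ x] * c by (intro ge) (metis mult_left_mono less_imp_le)
        ultimately show "u (c *\<^sub>R x) = c * u x" using c by (simp add: field_simps)
      qed
      moreover obtain q where "q \<in> C" using False by auto
      then have "u x \<le> p x" for x using le[of q x] CA by (force simp: A_def intro: order_trans)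
      ultimately have "u \<in> A" by (simp add: A_def)
      then show ?thesis using le by (auto simp: le_fun_def)
    qed
  qed
  then obtain m where m: "m \<in> A" and min: "\<And>a. a \<in> A \<Longrightarrow> a \<le> m \<Longrightarrow> a = m" by auto
  have sm: "sublinear m" and mp: "\<And>x. m x \<le> p x" using m by (auto simp: A_def)
  have add: "m (x + y) = m x + m y" for x y
  proof -
    have "tilt m y u \<le> m u" for u using tilt_upper[OF sm, of 0 y u] by simp
    moreover from this have "tilt m y \<in> A"
      using sublinear_tilt[OF sm] mp by (force simp: A_def intro: order_trans)
    ultimately have "tilt m y = m" using min by (simp add: le_fun_def)
    then have "m x \<le> m (x + y) - m y" using tilt_upper[OF sm, of 1 y x] by simp
    then show ?thesis using sm unfolding sublinear_def by (smt (verit))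
  qed
  have neg: "m (- x) = - m x" for x
    using add[of x "- x"] sublinear_zero[OF sm] by simp
  have "m (c *\<^sub>R x) = c * m x" for c x
  proof (cases c "0::real" rule: linorder_cases)
    case less
    then have "m ((- c) *\<^sub>R x) = (- c) * m x" by (intro sublinear_scale[OF sm]) simp
    then have "m (- (c *\<^sub>R x)) = - (c * m x)" by simp
    then show ?thesis using neg[of "c *\<^sub>R x"] by linarith
  next
    case equal then show ?thesis using sublinear_zero[OF sm] by simp
  next
    case greater then show ?thesis using sm by (auto simp: sublinear_def)
  qed
  then have "linear m" using add by (intro linearI) auto
  then show ?thesis using that mp by blast
qed

text \<open>A minorant of \<open>tilt norm x\<close> is taken instead of one of \<open>norm\<close>:
  parameter 0 gives the norm bound, and parameter 1 at the point \<open>- x\<close> gives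
  \<open>f (- x) \<le> - norm x\<close>. So no functional has to be extended from the line through
  \<open>x\<close>.\<close>

lemma norming_functional:
  fixes x :: "'a::real_normed_vector"
  obtains f where "linear f" "\<And>u. \<bar>f u\<bar> \<le> norm u" "f x = norm x"
proof -
  have sn: "sublinear (norm :: 'a \<Rightarrow> real)"
    by (auto simp: sublinear_def norm_triangle_ineq)
  obtain f where f: "linear f" "\<And>u. f u \<le> tilt norm x u"
    using sublinear_linear_minorant[OF sublinear_tilt[OF sn]] by metis
  have le: "f u \<le> norm u" for u
    using f(2)[of u] tilt_upper[OF sn, of 0 x u] by simp
  have "f (- x) \<le> - norm x"
    using f(2)[of "- x"] tilt_upper[OF sn, of 1 x "- x"] by simp
  then have "f x = norm x" using le[of x] by (simp add: linear_neg[OF f(1)])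
  moreover have "\<bar>f u\<bar> \<le> norm u" for u
    using le[of u] le[of "- u"] by (simp add: linear_neg[OF f(1)] abs_le_iff)
  ultimately show ?thesis using that f(1) by blast
qed

section \<open>Bounded linear functionals and upper gradients on a subspace\<close>

text \<open>Unlike in \<open>subspace_dual\<close> there is no extensionality: sums, multiples and
  series can be formed pointwise, while the values outside \<open>Y\<close> stay arbitrary.\<close>

definition bounded_linear_on :: "'a::real_normed_vector set \<Rightarrow> ('a \<Rightarrow> real) \<Rightarrow> bool" where
  "bounded_linear_on Y g \<longleftrightarrow> (\<forall>x\<in>Y. \<forall>y\<in>Y. g (x + y) = g x + g y) \<and>
     (\<forall>c. \<forall>x\<in>Y. g (c *\<^sub>R x) = c * g x) \<and> (\<exists>K\<ge>0. \<forall>x\<in>Y. \<bar>g x\<bar> \<le> K * norm x)"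

lemma bounded_linear_on_add: "bounded_linear_on Y g \<Longrightarrow> x \<in> Y \<Longrightarrow> y \<in> Y \<Longrightarrow> g (x + y) = g x + g y"
  by (simp add: bounded_linear_on_def)

lemma bounded_linear_on_scale: "bounded_linear_on Y g \<Longrightarrow> x \<in> Y \<Longrightarrow> g (c *\<^sub>R x) = c * g x"
  by (simp add: bounded_linear_on_def)

lemma bounded_linear_on_diff:
  assumes "subspace Y" "bounded_linear_on Y g" "x \<in> Y" "y \<in> Y"
  shows "g (x - y) = g x - g y"
  using bounded_linear_on_add[OF assms(2), of "x - y" y] subspace_diff[OF assms(1,3,4)] assms(4) by simp

lemma bounded_linear_on_plus:
  assumes "bounded_linear_on Y f" "bounded_linear_on Y g"
  shows "bounded_linear_on Y (\<lambda>y. f y + g y)"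
proof -
  obtain K L where K: "K \<ge> 0" "\<And>x. x \<in> Y \<Longrightarrow> \<bar>f x\<bar> \<le> K * norm x"
    and L: "L \<ge> 0" "\<And>x. x \<in> Y \<Longrightarrow> \<bar>g x\<bar> \<le> L * norm x"
    using assms by (auto simp: bounded_linear_on_def)
  have "\<bar>f x + g x\<bar> \<le> (K + L) * norm x" if "x \<in> Y" for x
    using K(2)[OF that] L(2)[OF that] by (simp add: algebra_simps)
  then show ?thesis
    using assms K(1) L(1) by (auto simp: bounded_linear_on_def algebra_simps intro!: exI[of _ "K + L"])
qed

lemma bounded_linear_on_cmult:
  assumes "bounded_linear_on Y g"
  shows "bounded_linear_on Y (\<lambda>y. c * g y)"
proof -
  obtain K where K: "K \<ge> 0" "\<And>x. x \<in> Y \<Longrightarrow> \<bar>g x\<bar> \<le> K * norm x"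
    using assms by (auto simp: bounded_linear_on_def)
  have "\<bar>c * g x\<bar> \<le> (\<bar>c\<bar> * K) * norm x" if "x \<in> Y" for x
    using mult_left_mono[OF K(2)[OF that], of "\<bar>c\<bar>"] by (simp add: abs_mult algebra_simps)
  then show ?thesis
    using assms K(1) by (auto simp: bounded_linear_on_def algebra_simps intro!: exI[of _ "\<bar>c\<bar> * K"])
qed

lemma bounded_linear_on_sum:
  assumes "finite I" "\<And>i. i \<in> I \<Longrightarrow> bounded_linear_on Y (p i)"
  shows "bounded_linear_on Y (\<lambda>y. \<Sum>i\<in>I. p i y)"
  using assms
proof (induction I)
  case empty then show ?case by (auto simp: bounded_linear_on_def)
next
  case (insert i I)
  then show ?case using bounded_linear_on_plus[of Y "p i"] by simp
qed

text \<open>Meant for the gradient of the infinite perturbation from \<open>borwein_preiss\<close>: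
  \<open>A\<close> bounds the gradients of the single terms, \<open>S\<close> is the total
  weight.\<close>

lemma bounded_linear_on_series:
  fixes c :: "nat \<Rightarrow> real"
  assumes L: "\<And>k. bounded_linear_on Y (L k)" "\<And>k h. h \<in> Y \<Longrightarrow> \<bar>L k h\<bar> \<le> A * norm h"
    and c: "\<And>k. c k \<ge> 0" "c sums S" and A: "A \<ge> 0"
  shows "bounded_linear_on Y (\<lambda>h. \<Sum>k. c k * L k h)"
    and "\<And>h. h \<in> Y \<Longrightarrow> \<bar>\<Sum>k. c k * L k h\<bar> \<le> S * A * norm h"
    and "\<And>h. h \<in> Y \<Longrightarrow> summable (\<lambda>k. c k * L k h)"
proof -
  have cA: "(\<lambda>k. c k * (A * norm h)) sums (S * (A * norm h))" for h by (rule sums_mult2[OF c(2)])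
  have le: "\<bar>c k * L k h\<bar> \<le> c k * (A * norm h)" if "h \<in> Y" for k h
    using L(2)[OF that] c(1)[of k] by (simp add: abs_mult mult_left_mono)
  show sm: "summable (\<lambda>k. c k * L k h)" if "h \<in> Y" for h
    by (rule summable_comparison_test'[OF sums_summable[OF cA]]) (use le[OF that] in simp)
  show b: "\<bar>\<Sum>k. c k * L k h\<bar> \<le> S * A * norm h" if "h \<in> Y" for h
  proof -
    have "norm (\<Sum>k. c k * L k h) \<le> (\<Sum>k. c k * (A * norm h))"
      using le[OF that] by (intro norm_suminf_le sums_summable[OF cA]) auto
    then show ?thesis using sums_unique[OF cA, of h] by (simp add: algebra_simps)
  qed
  have "S \<ge> 0" using sums_le[OF c(1) sums_zero c(2)] .
  moreover have "(\<Sum>k. c k * L k (x + y)) = (\<Sum>k. c k * L k x) + (\<Sum>k. c k * L k y)"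
    if "x \<in> Y" "y \<in> Y" for x y
    using suminf_add[OF sm[OF that(1)] sm[OF that(2)]]
    by (simp add: bounded_linear_on_add[OF L(1) that] algebra_simps)
  moreover have "(\<Sum>k. c k * L k (r *\<^sub>R x)) = r * (\<Sum>k. c k * L k x)" if "x \<in> Y" for r x
    using suminf_mult[OF sm[OF that], of r]
    by (simp add: bounded_linear_on_scale[OF L(1) that] algebra_simps)
  ultimately show "bounded_linear_on Y (\<lambda>h. \<Sum>k. c k * L k h)"
    unfolding bounded_linear_on_def using b A by (auto intro!: exI[of _ "S * A"])
qed

lemma bounded_linear_on_cong:
  assumes Y: "subspace Y" and f: "bounded_linear_on Y f" and eq: "\<And>y. y \<in> Y \<Longrightarrow> f y = g y"
  shows "bounded_linear_on Y g"
  using f unfolding bounded_linear_on_def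
  by (simp add: eq subspace_add[OF Y] subspace_scale[OF Y])

text \<open>The upper half of Frechet differentiability at 0, where \<open>\<psi> h\<close> is read
  as the increment of a function from a fixed base point. Where that increment is nonnegative, this
  half alone bounds \<open>L\<close> from below up to o(norm h).\<close>

definition upper_gradient :: "'a::real_normed_vector set \<Rightarrow> ('a \<Rightarrow> real) \<Rightarrow> ('a \<Rightarrow> real) \<Rightarrow> bool" where
  "upper_gradient Y \<psi> L \<longleftrightarrow> (\<forall>e>0. \<exists>\<delta>>0. \<forall>h\<in>Y. norm h < \<delta> \<longrightarrow> \<psi> h \<le> L h + e * norm h)"

lemma upper_gradient_add:
  assumes "upper_gradient Y \<psi> L" "upper_gradient Y \<psi>' L'"
  shows "upper_gradient Y (\<lambda>h. \<psi> h + \<psi>' h) (\<lambda>h. L h + L' h)"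
  unfolding upper_gradient_def
proof (intro allI impI)
  fix e :: real assume "e > 0"
  then have "e / 2 > 0" by simp
  obtain \<delta> where "\<delta> > 0" and *: "\<And>h. h \<in> Y \<Longrightarrow> norm h < \<delta> \<Longrightarrow> \<psi> h \<le> L h + e / 2 * norm h"
    using assms(1) \<open>e / 2 > 0\<close> unfolding upper_gradient_def by meson
  obtain \<delta>' where "\<delta>' > 0" and **: "\<And>h. h \<in> Y \<Longrightarrow> norm h < \<delta>' \<Longrightarrow> \<psi>' h \<le> L' h + e / 2 * norm h"
    using assms(2) \<open>e / 2 > 0\<close> unfolding upper_gradient_def by meson
  have "\<psi> h + \<psi>' h \<le> L h + L' h + e * norm h" if "h \<in> Y" "norm h < min \<delta> \<delta>'" for h
  proof -
    have "\<psi> h + \<psi>' h \<le> (L h + e / 2 * norm h) + (L' h + e / 2 * norm h)"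
      using that by (intro add_mono * **) auto
    then show ?thesis by simp
  qed
  then show "\<exists>\<delta>>0. \<forall>h\<in>Y. norm h < \<delta> \<longrightarrow> \<psi> h + \<psi>' h \<le> L h + L' h + e * norm h"
    using \<open>\<delta> > 0\<close> \<open>\<delta>' > 0\<close> by (intro exI[of _ "min \<delta> \<delta>'"]) auto
qed

lemma upper_gradient_cmult:
  assumes "upper_gradient Y \<psi> L" "c > 0"
  shows "upper_gradient Y (\<lambda>h. c * \<psi> h) (\<lambda>h. c * L h)"
  unfolding upper_gradient_def
proof (intro allI impI)
  fix e :: real assume "e > 0"
  then have "e / c > 0" using \<open>c > 0\<close> by simp
  with assms(1) obtain \<delta> where "\<delta> > 0"
    and *: "\<And>h. h \<in> Y \<Longrightarrow> norm h < \<delta> \<Longrightarrow> \<psi> h \<le> L h + e / c * norm h"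
    unfolding upper_gradient_def by meson
  moreover have "c * \<psi> h \<le> c * L h + e * norm h" if "h \<in> Y" "norm h < \<delta>" for h
    using mult_left_mono[OF *[OF that], of c] \<open>c > 0\<close> by (simp add: algebra_simps)
  ultimately show "\<exists>\<delta>>0. \<forall>h\<in>Y. norm h < \<delta> \<longrightarrow> c * \<psi> h \<le> c * L h + e * norm h" by blast
qed

lemma upper_gradient_sum:
  assumes "finite I" "\<And>i. i \<in> I \<Longrightarrow> upper_gradient Y (\<psi> i) (L i)"
  shows "upper_gradient Y (\<lambda>h. \<Sum>i\<in>I. \<psi> i h) (\<lambda>h. \<Sum>i\<in>I. L i h)"
  using assms
proof (induction I)
  case empty
  then show ?case by (auto simp: upper_gradient_def intro!: exI[of _ 1])
next
  case (insert i I)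
  then show ?case using upper_gradient_add[of Y "\<psi> i" "L i"] by simp
qed

lemma upper_gradient_uminus:
  assumes "subspace Y" "upper_gradient Y \<psi> L"
  shows "upper_gradient Y (\<lambda>h. \<psi> (- h)) (\<lambda>h. L (- h))"
  unfolding upper_gradient_def
proof (intro allI impI)
  fix e :: real assume "e > 0"
  then obtain \<delta> where \<delta>: "\<delta> > 0" "\<And>h. h \<in> Y \<Longrightarrow> norm h < \<delta> \<Longrightarrow> \<psi> h \<le> L h + e * norm h"
    using assms(2) unfolding upper_gradient_def by meson
  have "\<psi> (- h) \<le> L (- h) + e * norm h" if "h \<in> Y" "norm h < \<delta>" for h
    using \<delta>(2)[of "- h"] subspace_neg[OF assms(1) that(1)] that(2) by simp
  then show "\<exists>\<delta>>0. \<forall>h\<in>Y. norm h < \<delta> \<longrightarrow> \<psi> (- h) \<le> L (- h) + e * norm h"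
    using \<delta>(1) by blast
qed

text \<open>A finite initial sum has an upper gradient; the tail from \<open>M\<close> on exceeds
  its linear part by at most \<open>(A + B) * tail M * norm h\<close>, because the linear bounds on
  \<open>L k\<close> and \<open>\<psi> k\<close> are uniform in \<open>k\<close>.\<close>

lemma upper_gradient_series:
  fixes c :: "nat \<Rightarrow> real"
  assumes up: "\<And>k. upper_gradient Y (\<psi> k) (L k)"
    and c: "\<And>k. c k \<ge> 0" "summable c"
    and L: "\<And>k h. h \<in> Y \<Longrightarrow> \<bar>L k h\<bar> \<le> A * norm h"
    and \<psi>: "\<And>k h. h \<in> Y \<Longrightarrow> norm h \<le> 1 \<Longrightarrow> \<psi> k h \<le> B * norm h"
    and sum: "\<And>h. h \<in> Y \<Longrightarrow> summable (\<lambda>k. c k * \<psi> k h)" "\<And>h. h \<in> Y \<Longrightarrow> summable (\<lambda>k. c k * L k h)"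
    and AB: "A \<ge> 0" "B \<ge> 0"
  shows "upper_gradient Y (\<lambda>h. \<Sum>k. c k * \<psi> k h) (\<lambda>h. \<Sum>k. c k * L k h)"
  unfolding upper_gradient_def
proof (intro allI impI)
  fix e :: real assume e: "e > 0"
  define tail where "tail M = (\<Sum>k. c (k + M))" for M
  have "(\<lambda>M. (A + B) * tail M) \<longlonglongrightarrow> (A + B) * 0"
    unfolding tail_def by (intro tendsto_intros suminf_exist_split2 c)
  then have "\<forall>\<^sub>F M in sequentially. (A + B) * tail M < e / 2"
    using e by (intro order_tendstoD(2)) auto
  then obtain M where M: "(A + B) * tail M < e / 2" by (auto simp: eventually_sequentially)
  have "upper_gradient Y (\<lambda>h. \<Sum>k<M. c k * \<psi> k h) (\<lambda>h. \<Sum>k<M. c k * L k h)"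
  proof (rule upper_gradient_sum)
    fix k
    show "upper_gradient Y (\<lambda>h. c k * \<psi> k h) (\<lambda>h. c k * L k h)"
    \<comment> \<open>Zero weights are treated apart because \<open>upper_gradient_cmult\<close>
      divides by the factor.\<close>
    proof (cases "c k = 0")
      case True
      then show ?thesis by (auto simp: upper_gradient_def intro!: exI[of _ 1])
    next
      case False
      then show ?thesis using c(1)[of k] by (intro upper_gradient_cmult up) auto
    qed
  qed simp
  then obtain \<delta> where \<delta>: "\<delta> > 0"
    "\<And>h. h \<in> Y \<Longrightarrow> norm h < \<delta> \<Longrightarrow> (\<Sum>k<M. c k * \<psi> k h) \<le> (\<Sum>k<M. c k * L k h) + e / 2 * norm h"
    using e unfolding upper_gradient_def by (meson half_gt_zero)
  have "(\<Sum>k. c k * \<psi> k h) \<le> (\<Sum>k. c k * L k h) + e * norm h" if h: "h \<in> Y" "norm h < min \<delta> 1" for h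
  proof -
    have sc: "summable (\<lambda>k. c (k + M))" using c(2) by (rule summable_ignore_initial_segment)
    have s1: "summable (\<lambda>k. c (k + M) * \<psi> (k + M) h)" "summable (\<lambda>k. c (k + M) * L (k + M) h)"
      using summable_ignore_initial_segment[OF sum(1)[OF h(1)], of M]
        summable_ignore_initial_segment[OF sum(2)[OF h(1)], of M] by auto
    have "(\<Sum>k. c (k + M) * \<psi> (k + M) h) \<le> (\<Sum>k. c (k + M) * L (k + M) h + c (k + M) * ((A + B) * norm h))"
    proof (rule suminf_le)
      fix k
      have "\<psi> (k + M) h \<le> L (k + M) h + (A + B) * norm h"
        using L[OF h(1), of "k + M"] \<psi>[OF h(1), of "k + M"] h(2) by (simp add: algebra_simps abs_le_iff)
      then show "c (k + M) * \<psi> (k + M) h \<le> c (k + M) * L (k + M) h + c (k + M) * ((A + B) * norm h)"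
        unfolding distrib_left[symmetric] by (intro mult_left_mono c)
    qed (intro summable_add summable_mult2 s1 sc)+
    also have "\<dots> = (\<Sum>k. c (k + M) * L (k + M) h) + tail M * ((A + B) * norm h)"
      unfolding tail_def
      using suminf_add[OF s1(2) summable_mult2[OF sc, of "(A + B) * norm h"]] suminf_mult2[OF sc, of "(A + B) * norm h"]
      by simp
    also have "tail M * ((A + B) * norm h) = ((A + B) * tail M) * norm h" by (simp add: algebra_simps)
    also have "\<dots> \<le> e / 2 * norm h" using M by (intro mult_right_mono) auto
    finally have "(\<Sum>k. c (k + M) * \<psi> (k + M) h) \<le> (\<Sum>k. c (k + M) * L (k + M) h) + e / 2 * norm h" by simp
    moreover have "(\<Sum>k<M. c k * \<psi> k h) \<le> (\<Sum>k<M. c k * L k h) + e / 2 * norm h" using \<delta>(2) h by simp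
    ultimately show ?thesis
      using suminf_split_initial_segment[OF sum(1)[OF h(1)], of M]
        suminf_split_initial_segment[OF sum(2)[OF h(1)], of M] by linarith
  qed
  then show "\<exists>\<delta>>0. \<forall>h\<in>Y. norm h < \<delta> \<longrightarrow> (\<Sum>k. c k * \<psi> k h) \<le> (\<Sum>k. c k * L k h) + e * norm h"
    using \<delta>(1) by (intro exI[of _ "min \<delta> 1"]) auto
qed

text \<open>The minimum is over a whole subspace: \<open>h\<close> may be shrunk into the
  \<delta>-ball, the estimate divided by the scale, and the outcome applied to both \<open>h\<close>
  and \<open>- h\<close>.\<close>

lemma upper_gradient_minimum:
  assumes Y: "subspace Y" and L: "bounded_linear_on Y L" and up: "upper_gradient Y \<psi> L"
    and min: "\<And>h. h \<in> Y \<Longrightarrow> 0 \<le> \<psi> h" and h: "h \<in> Y"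
  shows "L h = 0"
proof -
  have "0 \<le> L h" if h: "h \<in> Y" for h
  proof (rule field_le_epsilon)
    fix e :: real assume e: "e > 0"
    \<comment> \<open>With the denominator \<open>norm h + 1\<close> the vector 0 needs no separate
      case.\<close>
    define e' where "e' = e / (norm h + 1)"
    have np: "norm h + 1 > 0" by (simp add: add_nonneg_pos)
    then have "e' > 0" using e by (simp add: e'_def)
    then obtain \<delta> where \<delta>: "\<delta> > 0" "\<And>h. h \<in> Y \<Longrightarrow> norm h < \<delta> \<Longrightarrow> \<psi> h \<le> L h + e' * norm h"
      using up unfolding upper_gradient_def by meson
    define c where "c = \<delta> / (norm h + 1)"
    have c: "c > 0" using \<delta>(1) np by (simp add: c_def)
    have ch: "c *\<^sub>R h \<in> Y" using Y h by (simp add: subspace_scale)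
    have "norm (c *\<^sub>R h) < \<delta>"
      using \<delta>(1) np c by (simp add: c_def field_simps)
    then have "0 \<le> L (c *\<^sub>R h) + e' * norm (c *\<^sub>R h)" using \<delta>(2)[OF ch] min[OF ch] by linarith
    then have "0 \<le> c * (L h + e' * norm h)"
      using c by (simp add: bounded_linear_on_scale[OF L h] algebra_simps)
    then have "0 \<le> L h + e' * norm h" using c by (simp add: zero_le_mult_iff)
    moreover have "e' * norm h \<le> e" using np e by (simp add: e'_def field_simps)
    ultimately show "0 \<le> L h + e" by linarith
  qed
  from this[OF h] this[OF subspace_neg[OF Y h]] show ?thesis
    using bounded_linear_on_scale[OF L h, of "-1"] by simp
qed

text \<open>Smoothness is asked of the square of \<open>N\<close>, since a norm has a kink at 0
  while its square has gradient 0 there. By \<open>g_self\<close>, pairing the gradient at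
  \<open>x\<close> with \<open>x\<close> itself recovers the value of \<open>N\<close>.\<close>

locale smooth_norm_on =
  fixes Y :: "'a::banach set" and N :: "'a \<Rightarrow> real" and g :: "'a \<Rightarrow> 'a \<Rightarrow> real"
  assumes subspace_Y: "subspace Y"
    and norm_le_N: "x \<in> Y \<Longrightarrow> norm x \<le> N x" and N_le: "x \<in> Y \<Longrightarrow> N x \<le> 2 * norm x"
    and N_triangle: "x \<in> Y \<Longrightarrow> y \<in> Y \<Longrightarrow> N (x + y) \<le> N x + N y"
    and g_linear: "x \<in> Y \<Longrightarrow> bounded_linear_on Y (g x)"
    and g_bound: "x \<in> Y \<Longrightarrow> h \<in> Y \<Longrightarrow> \<bar>g x h\<bar> \<le> 2 * norm h"
    and g_self: "x \<in> Y \<Longrightarrow> g x x = N x"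
    and N_square_up: "x \<in> Y \<Longrightarrow> upper_gradient Y (\<lambda>h. (N (x + h))\<^sup>2 - (N x)\<^sup>2) (\<lambda>h. 2 * N x * g x h)"
begin

lemma N_nonneg: "x \<in> Y \<Longrightarrow> 0 \<le> N x"
  using norm_le_N[of x] norm_ge_zero[of x] by linarith

lemma N_zero: "N 0 = 0"
  using N_nonneg[of 0] N_le[of 0] subspace_0[OF subspace_Y] by simp

lemma N_eq_0: "x \<in> Y \<Longrightarrow> N x = 0 \<Longrightarrow> x = 0"
  using norm_le_N[of x] by simp

lemma N_lipschitz:
  assumes "x \<in> Y" "y \<in> Y"
  shows "\<bar>N x - N y\<bar> \<le> 2 * norm (x - y)"
proof -
  have xy: "x - y \<in> Y" and yx: "y - x \<in> Y" using assms by (auto intro: subspace_diff subspace_Y)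
  have "N x \<le> N y + 2 * norm (x - y)" using N_triangle[OF assms(2) xy] N_le[OF xy] by simp
  moreover have "N y \<le> N x + 2 * norm (x - y)"
    using N_triangle[OF assms(1) yx] N_le[OF yx] by (simp add: norm_minus_commute)
  ultimately show ?thesis by (simp add: abs_le_iff)
qed

lemma N_tendsto:
  assumes "s \<longlonglongrightarrow> v" "\<And>n. s n \<in> Y" "v \<in> Y"
  shows "(\<lambda>n. N (s n)) \<longlonglongrightarrow> N v"
proof -
  have "(\<lambda>n. N (s n) - N v) \<longlonglongrightarrow> 0"
  proof (rule Lim_null_comparison)
    have "(\<lambda>n. 2 * norm (s n - v)) \<longlonglongrightarrow> 2 * norm (v - v)" by (intro tendsto_intros assms)
    then show "(\<lambda>n. 2 * norm (s n - v)) \<longlonglongrightarrow> 0" by simp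
    show "\<forall>\<^sub>F n in sequentially. norm (N (s n) - N v) \<le> 2 * norm (s n - v)"
      using N_lipschitz[OF assms(2,3)] by simp
  qed
  then show ?thesis by (rule LIM_zero_cancel)
qed

text \<open>The bound is uniform over all \<open>x\<close> with \<open>N x \<le> l\<close>, as
  \<open>upper_gradient_series\<close> demands for the terms of the perturbation.\<close>

lemma N_square_increment:
  assumes "x \<in> Y" "h \<in> Y" "N x \<le> l" "norm h \<le> 1"
  shows "(N (x + h))\<^sup>2 - (N x)\<^sup>2 \<le> (4 * l + 4) * norm h"
proof -
  have "(N (x + h))\<^sup>2 \<le> (N x + 2 * norm h)\<^sup>2"
    by (rule power_mono[OF order_trans[OF N_triangle[OF assms(1,2)] add_left_mono[OF N_le[OF assms(2)]]]
      N_nonneg[OF subspace_add[OF subspace_Y assms(1,2)]]])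
  also have "\<dots> = (N x)\<^sup>2 + (4 * N x + 4 * norm h) * norm h" by (simp add: power2_eq_square algebra_simps)
  also have "(4 * N x + 4 * norm h) * norm h \<le> (4 * l + 4) * norm h"
    using assms by (intro mult_right_mono) auto
  finally show ?thesis by simp
qed

end

section \<open>Smooth norms on spaces with separable dual\<close>

lemma subspace_dual_add: "f \<in> subspace_dual Y \<Longrightarrow> x \<in> Y \<Longrightarrow> y \<in> Y \<Longrightarrow> f (x + y) = f x + f y"
  by (simp add: subspace_dual_def)

lemma subspace_dual_scale: "f \<in> subspace_dual Y \<Longrightarrow> x \<in> Y \<Longrightarrow> f (c *\<^sub>R x) = c * f x"
  by (simp add: subspace_dual_def)

lemma restrict_in_subspace_dual:
  assumes "subspace Y" "\<And>x y. x \<in> Y \<Longrightarrow> y \<in> Y \<Longrightarrow> f (x + y) = f x + f y"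
    "\<And>c x. x \<in> Y \<Longrightarrow> f (c *\<^sub>R x) = c * f x" "\<And>x. x \<in> Y \<Longrightarrow> \<bar>f x\<bar> \<le> K * norm x"
  shows "restrict f Y \<in> subspace_dual Y"
  using assms by (auto simp: subspace_dual_def subspace_add subspace_scale intro!: exI[of _ K])

text \<open>The dense sequence starts with the zero functional: this makes \<open>D f (d 0)\<close>
  the dual norm, and the summand of \<Psi> with \<open>n = 0\<close> controls it.\<close>

locale separable_dual =
  fixes Y :: "'a::real_normed_vector set" and d :: "nat \<Rightarrow> 'a \<Rightarrow> real"
  assumes subspace_Y: "subspace Y"
    and d_dual: "d n \<in> subspace_dual Y"
    and d_0: "d 0 = restrict (\<lambda>_. 0) Y"
    and d_dense: "f \<in> subspace_dual Y \<Longrightarrow> e > 0 \<Longrightarrow> \<exists>n. subspace_dual_dist Y f (d n) < e"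
begin

abbreviation "dual \<equiv> subspace_dual Y"
abbreviation "D \<equiv> subspace_dual_dist Y"
abbreviation "dual_norm f \<equiv> D f (d 0)"

sublocale Metric_space dual D
  by (rule Metric_space_subspace_dual[OF subspace_Y])

lemma dual_apply:
  assumes f: "f \<in> dual" and g: "g \<in> dual" and y: "y \<in> Y"
  shows "\<bar>f y - g y\<bar> \<le> D f g * norm y"
proof (cases "y = 0")
  case True
  then show ?thesis
    using subspace_dual_scale[OF f y, of 0] subspace_dual_scale[OF g y, of 0] by simp
next
  case False
  have "\<bar>f (inverse (norm y) *\<^sub>R y) - g (inverse (norm y) *\<^sub>R y)\<bar> \<le> D f g"
    using y False by (intro subspace_dual_dist_upper[OF f g]) (auto simp: subspace_scale[OF subspace_Y])
  also have "f (inverse (norm y) *\<^sub>R y) - g (inverse (norm y) *\<^sub>R y) = inverse (norm y) * (f y - g y)"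
    using subspace_dual_scale[OF f y] subspace_dual_scale[OF g y] by (simp add: algebra_simps)
  finally show ?thesis using False by (simp add: abs_mult field_simps)
qed

lemma dual_apply_norm:
  assumes "f \<in> dual" "y \<in> Y"
  shows "\<bar>f y\<bar> \<le> dual_norm f * norm y"
  using dual_apply[OF assms(1) d_dual assms(2), of 0] assms(2) by (simp add: d_0)

lemma dual_norm_least:
  assumes "f \<in> dual" "\<And>y. y \<in> Y \<Longrightarrow> \<bar>f y\<bar> \<le> b * norm y" "0 \<le> b"
  shows "dual_norm f \<le> b"
proof (rule subspace_dual_dist_least[OF subspace_Y assms(1) d_dual])
  fix y assume y: "y \<in> Y" "norm y \<le> 1"
  then have "\<bar>f y\<bar> \<le> b * 1"
    using assms(2)[of y] mult_left_mono[OF y(2) assms(3)] by simp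
  then show "\<bar>f y - d 0 y\<bar> \<le> b" using y by (simp add: d_0)
qed

text \<open>The norm below is the support function of \<open>K\<close>. If \<open>f k\<close> is a maximizing sequence and \<open>f\<close> a maximizer
  over \<open>K\<close>, then the parallelogram identity applied to each term of \<open>\<Psi>\<close> forces \<open>D (f k) (d n)\<close> to tend
  to \<open>D f (d n)\<close> for every \<open>n\<close>. As the \<open>d n\<close> are dense, \<open>f k\<close> tends to \<open>f\<close> in norm, which is Smulian's
  criterion for Frechet differentiability. The weights are such that \<open>K\<close> lies between the balls
  of radius 1 and 2 (recall \<open>d 0 = 0\<close>).\<close>

definition wt :: "nat \<Rightarrow> real" where
  "wt n = (1/2) ^ Suc n / (1 + dual_norm (d n))\<^sup>2"

definition \<Psi> :: "('a \<Rightarrow> real) \<Rightarrow> real" where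
  "\<Psi> f = (\<Sum>n. wt n * (D f (d n))\<^sup>2)"

definition K :: "('a \<Rightarrow> real) set" where
  "K = {f \<in> dual. \<Psi> f \<le> 1}"

definition N :: "'a \<Rightarrow> real" where
  "N x = (SUP f\<in>K. f x)"

section \<open>The set \<open>K\<close> and the equivalence of \<open>N\<close> with the
  norm\<close>

lemma wt_pos: "wt n > 0"
  using nonneg[of "d n" "d 0"] unfolding wt_def
  by (intro divide_pos_pos zero_less_power) (auto intro: add_pos_nonneg)

text \<open>In \<open>K_smulian\<close>, enlarging a functional by a factor
  \<open>1 + \<tau>\<close> produces terms of first order in the distances; this makes them
  summable.\<close>

lemma wt_dist: "wt n * (1 + dual_norm (d n)) \<le> (1/2) ^ Suc n"
proof -
  define c where "c = 1 + dual_norm (d n)"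
  have "c \<ge> 1" by (simp add: c_def)
  then have "(1/2) ^ Suc n / c\<^sup>2 * c = (1/2::real) ^ Suc n / c" by (simp add: power2_eq_square)
  also have "\<dots> \<le> (1/2) ^ Suc n / 1" using \<open>c \<ge> 1\<close> by (intro divide_left_mono) auto
  finally show ?thesis by (simp add: wt_def c_def)
qed

lemma D_d_le:
  assumes "f \<in> dual"
  shows "D f (d n) \<le> (1 + dual_norm f) * (1 + dual_norm (d n))"
proof -
  have "D f (d n) \<le> dual_norm f + dual_norm (d n)"
    using triangle[OF assms d_dual[of 0] d_dual[of n]] commute[of "d 0" "d n"] by simp
  also have "\<dots> \<le> (1 + dual_norm f) * (1 + dual_norm (d n))"
    using mult_nonneg_nonneg[OF nonneg[of f "d 0"] nonneg[of "d n" "d 0"]] by (simp add: algebra_simps)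
  finally show ?thesis .
qed

lemma wt_sq_le:
  assumes "f \<in> dual" "D f (d n) \<le> C * (1 + dual_norm (d n))" "C \<ge> 0"
  shows "wt n * (D f (d n))\<^sup>2 \<le> C\<^sup>2 * (1/2) ^ Suc n"
proof -
  define c where "c = 1 + dual_norm (d n)"
  have c: "c \<ge> 1" by (simp add: c_def)
  have "(D f (d n))\<^sup>2 \<le> (C * c)\<^sup>2" using assms by (intro power_mono) (auto simp: c_def)
  then have "wt n * (D f (d n))\<^sup>2 \<le> wt n * (C * c)\<^sup>2"
    using wt_pos[of n] by (intro mult_left_mono) auto
  also have "\<dots> = C\<^sup>2 * (1/2) ^ Suc n"
    using c unfolding wt_def c_def[symmetric] by (simp add: power_mult_distrib)
  finally show ?thesis .
qed

lemma summable_half: "summable (\<lambda>n. C * (1/2::real) ^ Suc n)"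
  using power_half_series by (intro summable_mult) (rule sums_summable)

lemma suminf_half: "(\<Sum>n. C * (1/2::real) ^ Suc n) = C"
  using sums_unique[OF sums_mult[OF power_half_series, of C]] by simp

lemma summable_\<Psi>:
  assumes "f \<in> dual"
  shows "summable (\<lambda>n. wt n * (D f (d n))\<^sup>2)"
proof (rule summable_comparison_test'[OF summable_half])
  fix n
  show "norm (wt n * (D f (d n))\<^sup>2) \<le> (1 + dual_norm f)\<^sup>2 * (1/2) ^ Suc n"
    using wt_sq_le[OF assms D_d_le[OF assms]] wt_pos[of n] by simp
qed

lemma unit_ball_subset_K:
  assumes f: "f \<in> dual" and le: "dual_norm f \<le> 1"
  shows "f \<in> K"
proof -
  have "wt n * (D f (d n))\<^sup>2 \<le> 1 * (1/2) ^ Suc n" for n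
  proof -
    have "D f (d n) \<le> 1 * (1 + dual_norm (d n))"
      using triangle[OF f d_dual[of 0] d_dual[of n]] commute[of "d 0" "d n"] le by simp
    from wt_sq_le[OF f this] show ?thesis by simp
  qed
  then have "\<Psi> f \<le> (\<Sum>n. 1 * (1/2) ^ Suc n)"
    unfolding \<Psi>_def by (intro suminf_le summable_\<Psi>[OF f] summable_half)
  also have "\<dots> = 1" by (rule suminf_half)
  finally show ?thesis using f by (simp add: K_def)
qed

lemma K_dual_norm:
  assumes "f \<in> K"
  shows "dual_norm f \<le> 2"
proof -
  have f: "f \<in> dual" "\<Psi> f \<le> 1" using assms by (auto simp: K_def)
  have "(\<Sum>n<1. wt n * (D f (d n))\<^sup>2) \<le> \<Psi> f"
    unfolding \<Psi>_def using wt_pos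
    by (intro sum_le_suminf summable_\<Psi>[OF f(1)]) (auto simp: less_imp_le)
  \<comment> \<open>As \<open>d 0\<close> is zero, \<open>wt 0\<close> equals 1/2, and the squared
    dual norm is at most 2.\<close>
  then have "(dual_norm f)\<^sup>2 \<le> 2\<^sup>2" using f(2) d_dual[of 0] by (simp add: wt_def)
  then show ?thesis by (rule power2_le_imp_le) simp
qed

lemma K_dual: "f \<in> K \<Longrightarrow> f \<in> dual"
  by (simp add: K_def)

lemma K_apply:
  assumes "f \<in> K" "y \<in> Y"
  shows "\<bar>f y\<bar> \<le> 2 * norm y"
  using dual_apply_norm[OF K_dual[OF assms(1)] assms(2)] K_dual_norm[OF assms(1)]
  by (meson mult_right_mono norm_ge_zero order_trans)

lemma le_N:
  assumes "f \<in> K" "y \<in> Y"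
  shows "f y \<le> N y"
  unfolding N_def using assms K_apply by (intro cSUP_upper bdd_aboveI2[of _ _ "2 * norm y"]) (auto simp: abs_le_iff)

lemma zero_in_K: "d 0 \<in> K"
  using d_dual by (intro unit_ball_subset_K) auto

lemma N_least:
  assumes "\<And>f. f \<in> K \<Longrightarrow> f y \<le> b"
  shows "N y \<le> b"
  unfolding N_def using assms zero_in_K by (intro cSUP_least) auto

lemma N_le:
  assumes "y \<in> Y" shows "N y \<le> 2 * norm y"
  using K_apply[OF _ assms] by (intro N_least) (auto simp: abs_le_iff)

lemma norm_le_N:
  assumes x: "x \<in> Y" shows "norm x \<le> N x"
proof -
  obtain f where f: "linear f" "\<And>u. \<bar>f u\<bar> \<le> norm u" "f x = norm x"
    using norming_functional[of x] by metis
  have "restrict f Y \<in> dual"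
    using f by (intro restrict_in_subspace_dual[OF subspace_Y, of _ 1]) (auto simp: linear_add linear_scale)
  moreover from this have "dual_norm (restrict f Y) \<le> 1"
    using f by (intro dual_norm_least) auto
  ultimately have "restrict f Y x \<le> N x" by (intro le_N unit_ball_subset_K x)
  then show ?thesis using f(3) x by simp
qed

lemma N_triangle:
  assumes "x \<in> Y" "y \<in> Y" shows "N (x + y) \<le> N x + N y"
proof (rule N_least)
  fix f assume f: "f \<in> K"
  show "f (x + y) \<le> N x + N y"
    using le_N[OF f assms(1)] le_N[OF f assms(2)] subspace_dual_add[OF K_dual[OF f] assms] by simp
qed

section \<open>Weak-star compactness of \<open>K\<close> and attained suprema\<close>

lemma dual_dist_approx:
  assumes f: "f \<in> dual" and g: "g \<in> dual" and b: "b < D f g"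
  obtains y where "y \<in> Y" "norm y \<le> 1" "b < \<bar>f y - g y\<bar>"
proof -
  have "\<not> (\<forall>y\<in>Y. norm y \<le> 1 \<longrightarrow> \<bar>f y - g y\<bar> \<le> b)"
    using subspace_dual_dist_least[OF subspace_Y f g, of b] b by auto
  then show ?thesis using that by (auto simp: not_le)
qed

text \<open>\<open>D\<close> is a supremum of evaluations, hence only lower semicontinuous for
  pointwise limits. Each distance is therefore replaced by evaluations at nearly optimal points of
  the unit ball: the limit along \<open>F\<close> is taken in a finite partial sum, and only then
  the accuracy \<open>j\<close> tends to infinity.\<close>

lemma K_pointwise_closed:
  assumes F: "F \<noteq> bot" and lim: "\<And>y. ((\<lambda>p. \<phi> p y) \<longlongrightarrow> g y) F" and K: "\<And>p. \<phi> p \<in> K"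
  shows "g \<in> K"
proof -
  have \<phi>: "\<phi> p \<in> dual" for p using K K_dual by blast
  have add: "g (x + y) = g x + g y" if "x \<in> Y" "y \<in> Y" for x y
  proof (rule tendsto_unique[OF F lim])
    show "((\<lambda>p. \<phi> p (x + y)) \<longlongrightarrow> g x + g y) F"
      using tendsto_add[OF lim[of x] lim[of y]] by (simp add: subspace_dual_add[OF \<phi> that])
  qed
  have scale: "g (c *\<^sub>R x) = c * g x" if "x \<in> Y" for c x
  proof (rule tendsto_unique[OF F lim])
    show "((\<lambda>p. \<phi> p (c *\<^sub>R x)) \<longlongrightarrow> c * g x) F"
      using tendsto_mult_left[OF lim[of x], of c] by (simp add: subspace_dual_scale[OF \<phi> that])
  qed
  have bound: "\<bar>g x\<bar> \<le> 2 * norm x" if "x \<in> Y" for x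
    using K_apply[OF K that] by (intro tendsto_upperbound[OF tendsto_rabs[OF lim] _ F]) auto
  have "g = restrict g Y"
  proof
    fix x
    \<comment> \<open>Off \<open>Y\<close> every \<open>\<phi> p\<close> has the value
      \<open>undefined\<close>, hence so has the limit; this makes \<open>g\<close>
      extensional.\<close>
    have "g x = undefined" if "x \<notin> Y"
    proof (rule tendsto_unique[OF F lim])
      show "((\<lambda>p. \<phi> p x) \<longlongrightarrow> undefined) F"
        using \<phi> that by (simp add: subspace_dual_def extensional_def)
    qed
    then show "g x = restrict g Y x" by simp
  qed
  then have g: "g \<in> dual"
    using restrict_in_subspace_dual[OF subspace_Y, of g 2] add scale bound by simp
  have fin: "(\<Sum>n<M. wt n * (D g (d n))\<^sup>2) \<le> 1" for M
  proof -
    have "\<exists>y\<in>Y. norm y \<le> 1 \<and> D g (d n) - 1 / real (Suc j) < \<bar>g y - d n y\<bar>" for n j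
      using dual_dist_approx[OF g d_dual, of "D g (d n) - 1 / real (Suc j)" n] by auto
    then obtain y where y: "\<And>n j. y n j \<in> Y" "\<And>n j. norm (y n j) \<le> 1"
      "\<And>n j. D g (d n) - 1 / real (Suc j) < \<bar>g (y n j) - d n (y n j)\<bar>"
      by metis
    have "(\<Sum>n<M. wt n * (\<bar>g (y n j) - d n (y n j)\<bar>)\<^sup>2) \<le> 1" for j
    proof (rule tendsto_upperbound[OF _ _ F])
      show "((\<lambda>p. \<Sum>n<M. wt n * (\<bar>\<phi> p (y n j) - d n (y n j)\<bar>)\<^sup>2) \<longlongrightarrow>
        (\<Sum>n<M. wt n * (\<bar>g (y n j) - d n (y n j)\<bar>)\<^sup>2)) F"
        by (intro tendsto_intros lim)
      have "(\<Sum>n<M. wt n * (\<bar>\<phi> p (y n j) - d n (y n j)\<bar>)\<^sup>2) \<le> 1" for p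
      proof -
        have "(\<Sum>n<M. wt n * (\<bar>\<phi> p (y n j) - d n (y n j)\<bar>)\<^sup>2) \<le> (\<Sum>n<M. wt n * (D (\<phi> p) (d n))\<^sup>2)"
          using subspace_dual_dist_upper[OF \<phi> d_dual y(1) y(2)] wt_pos
          by (intro sum_mono mult_left_mono power_mono) (auto simp: less_imp_le)
        also have "\<dots> \<le> \<Psi> (\<phi> p)"
          unfolding \<Psi>_def using wt_pos by (intro sum_le_suminf summable_\<Psi>[OF \<phi>]) (auto simp: less_imp_le)
        finally show ?thesis using K[of p] by (simp add: K_def)
      qed
      then show "\<forall>\<^sub>F p in F. (\<Sum>n<M. wt n * (\<bar>\<phi> p (y n j) - d n (y n j)\<bar>)\<^sup>2) \<le> 1" by simp
    qed
    moreover have "(\<lambda>j. \<bar>g (y n j) - d n (y n j)\<bar>) \<longlonglongrightarrow> D g (d n)" for n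
    proof (rule tendsto_sandwich)
      show "\<forall>\<^sub>F j in sequentially. D g (d n) - 1 / real (Suc j) \<le> \<bar>g (y n j) - d n (y n j)\<bar>"
        using y(3) by (auto simp: less_imp_le)
      show "\<forall>\<^sub>F j in sequentially. \<bar>g (y n j) - d n (y n j)\<bar> \<le> D g (d n)"
        using subspace_dual_dist_upper[OF g d_dual y(1) y(2)] by simp
      show "(\<lambda>j. D g (d n) - 1 / real (Suc j)) \<longlonglongrightarrow> D g (d n)"
        using tendsto_diff[OF tendsto_const[of "D g (d n)"] lim_inverse_n'[THEN LIMSEQ_Suc]] by simp
    qed auto
    then have "(\<lambda>j. \<Sum>n<M. wt n * (\<bar>g (y n j) - d n (y n j)\<bar>)\<^sup>2) \<longlonglongrightarrow> (\<Sum>n<M. wt n * (D g (d n))\<^sup>2)"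
      by (intro tendsto_intros)
    ultimately show ?thesis by (intro LIMSEQ_le_const2) auto
  qed
  have "\<Psi> g \<le> 1"
    unfolding \<Psi>_def using fin by (intro suminf_le_const summable_\<Psi>[OF g])
  then show ?thesis using g by (simp add: K_def)
qed

lemma N_attained:
  assumes x: "x \<in> Y"
  obtains f where "f \<in> K" "f x = N x"
proof -
  have "\<exists>f\<in>K. N x - 1 / real (Suc k) < f x" for k
  proof (rule ccontr)
    assume "\<not> ?thesis"
    then have "N x \<le> N x - 1 / real (Suc k)" by (intro N_least) (auto simp: not_less)
    then show False by simp
  qed
  then obtain \<phi> where \<phi>: "\<And>k. \<phi> k \<in> K" "\<And>k. N x - 1 / real (Suc k) < \<phi> k x" by metis
  \<comment> \<open>The second summand covers the arguments outside \<open>Y\<close>: the subfilter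
    lemma wants a bound in every coordinate.\<close>
  have "\<bar>\<phi> k y\<bar> \<le> 2 * norm y + \<bar>undefined\<bar>" for k y
  proof (cases "y \<in> Y")
    case True then show ?thesis using K_apply[OF \<phi>(1)[of k] True] by linarith
  next
    case False
    then have "\<phi> k y = undefined"
      using K_dual[OF \<phi>(1)[of k]] by (simp add: subspace_dual_def extensional_def)
    then show ?thesis by simp
  qed
  then obtain F' g where F': "F' \<le> sequentially" "F' \<noteq> bot" "\<And>y. ((\<lambda>k. \<phi> k y) \<longlongrightarrow> g y) F'"
    using bounded_family_convergent_subfilter[of sequentially \<phi> "\<lambda>y. 2 * norm y + \<bar>undefined\<bar>"]
      trivial_limit_sequentially by metis
  have g: "g \<in> K" by (rule K_pointwise_closed[OF F'(2,3) \<phi>(1)])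
  have "(\<lambda>k. N x - 1 / real (Suc k)) \<longlonglongrightarrow> N x"
    using tendsto_diff[OF tendsto_const[of "N x"] lim_inverse_n'[THEN LIMSEQ_Suc]] by simp
  then have "((\<lambda>k. N x - 1 / real (Suc k)) \<longlongrightarrow> N x) F'"
    using F'(1) tendsto_mono by blast
  then have "N x \<le> g x"
    using \<phi>(2) by (intro tendsto_le[OF F'(2) F'(3)]) (auto simp: less_imp_le)
  then show ?thesis using that[OF g] le_N[OF g x] by simp
qed

text \<open>If \<open>g\<close> is far from \<open>f\<close>, some \<open>d n\<close> close to
  \<open>f\<close> is at clearly different distances from the two, and strict convexity pushes
  \<Psi> of their midpoint below 1 by \<theta>. This slack lets the midpoint be multiplied by
  \<open>1 + \<tau>\<close> without leaving \<open>K\<close>; if \<open>g\<close> also nearly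
  maximizes at \<open>x\<close>, the result exceeds \<open>N x\<close> there, which is
  impossible.\<close>

lemma K_smulian:
  assumes x: "x \<in> Y" "x \<noteq> 0" and f: "f \<in> K" "f x = N x" and e: "e > 0"
  obtains \<delta> where "\<delta> > 0" "\<And>g. g \<in> K \<Longrightarrow> N x - \<delta> < g x \<Longrightarrow> D g f \<le> e"
proof -
  have Npos: "N x > 0" using norm_le_N[OF x(1)] x(2) by (metis less_le_trans zero_less_norm_iff)
  obtain n where n: "D f (d n) < e / 4" using d_dense[OF K_dual[OF f(1)], of "e / 4"] e by auto
  \<comment> \<open>The distances of \<open>f\<close> and \<open>g\<close> to \<open>d n\<close>
    will differ by more than \<open>e / 2\<close>, so half their difference, squared, exceeds the
    square of \<open>e / 4\<close>.\<close>
  define \<theta> where "\<theta> = wt n * (e / 4)\<^sup>2"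
  \<comment> \<open>Enlarging by \<open>1 + \<tau>\<close> costs at most \<open>16 * \<tau>\<close>
    in \<Psi>: twice \<open>2 * \<tau> * 3\<close> from the terms linear in the distances of
    \<open>f\<close> and \<open>g\<close>, and \<open>4 * \<tau>\<close> from the square of
    \<open>2 * \<tau>\<close>.\<close>
  define \<tau> where "\<tau> = min 1 (\<theta> / 16)"
  have "\<theta> > 0" using wt_pos[of n] e by (simp add: \<theta>_def)
  then have \<tau>: "0 < \<tau>" "\<tau> \<le> 1" "16 * \<tau> \<le> \<theta>" by (auto simp: \<tau>_def)
  have "D g f \<le> e" if g: "g \<in> K" "N x - \<tau> * N x / 2 < g x" for g
  proof (rule ccontr)
    assume far: "\<not> D g f \<le> e"
    have fg: "f \<in> dual" "g \<in> dual" "\<Psi> f \<le> 1" "\<Psi> g \<le> 1" using f g by (auto simp: K_def)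
    define h where "h = restrict (\<lambda>y. (1 + \<tau>) * (f y + g y) / 2) Y"
    have h: "h \<in> dual"
      unfolding h_def
    proof (rule restrict_in_subspace_dual[OF subspace_Y, where K = "(1 + \<tau>) * 2"])
      fix y assume y: "y \<in> Y"
      have "\<bar>f y + g y\<bar> \<le> 4 * norm y"
        using K_apply[OF f(1) y] K_apply[OF g(1) y] by linarith
      then have "(1 + \<tau>) * \<bar>f y + g y\<bar> \<le> (1 + \<tau>) * (4 * norm y)"
        using \<tau> by (intro mult_left_mono) auto
      then show "\<bar>(1 + \<tau>) * (f y + g y) / 2\<bar> \<le> (1 + \<tau>) * 2 * norm y"
        using \<tau> by (simp only: abs_mult abs_divide)
    qed (use fg in \<open>auto simp: subspace_dual_add subspace_dual_scale algebra_simps add_divide_distrib\<close>)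
    have Dh: "D h (d k) \<le> (D f (d k) + D g (d k)) / 2 + 2 * \<tau>" for k
    proof (rule subspace_dual_dist_least[OF subspace_Y h d_dual])
      fix y assume y: "y \<in> Y" "norm y \<le> 1"
      have "\<bar>f y\<bar> \<le> 2" "\<bar>g y\<bar> \<le> 2"
        using K_apply[OF f(1) y(1)] K_apply[OF g(1) y(1)] y(2) by linarith+
      define r where "r = \<tau> * (f y + g y) / 2"
      have "\<bar>f y + g y\<bar> \<le> 4" using \<open>\<bar>f y\<bar> \<le> 2\<close> \<open>\<bar>g y\<bar> \<le> 2\<close> by linarith
      then have "\<bar>r\<bar> \<le> 2 * \<tau>"
        using \<tau> mult_left_mono[of "\<bar>f y + g y\<bar>" 4 \<tau>] by (simp add: r_def abs_mult)
      moreover have "h y - d k y = (f y - d k y) / 2 + (g y - d k y) / 2 + r"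
        using y by (simp add: h_def r_def field_simps)
      ultimately show "\<bar>h y - d k y\<bar> \<le> (D f (d k) + D g (d k)) / 2 + 2 * \<tau>"
        using subspace_dual_dist_upper[OF fg(1) d_dual[of k] y]
          subspace_dual_dist_upper[OF fg(2) d_dual[of k] y] unfolding abs_le_iff by argo
    qed
    have gap: "D g (d n) - D f (d n) > e / 2"
      using triangle[OF fg(2) d_dual[of n] fg(1)] commute[of "d n" f] n far by linarith
    have term_le: "wt k * (D h (d k))\<^sup>2 \<le> 1/2 * (wt k * (D f (d k))\<^sup>2) + 1/2 * (wt k * (D g (d k))\<^sup>2)
        - (if k = n then \<theta> else 0) + 16 * \<tau> * (1/2) ^ Suc k" for k
    proof -
      define a b w where "a = D f (d k)" and "b = D g (d k)" and "w = wt k"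
      have w: "w > 0" using wt_pos by (simp add: w_def)
      have ab: "0 \<le> a" "0 \<le> b" by (auto simp: a_def b_def)
      have bound: "w * D u (d k) \<le> 3 * (1/2) ^ Suc k" if "u \<in> K" for u
      proof -
        have "D u (d k) \<le> (1 + dual_norm u) * (1 + dual_norm (d k))" by (rule D_d_le[OF K_dual[OF that]])
        also have "\<dots> \<le> 3 * (1 + dual_norm (d k))"
          using K_dual_norm[OF that] by (intro mult_right_mono) auto
        finally have "w * D u (d k) \<le> w * (3 * (1 + dual_norm (d k)))"
          using w by (intro mult_left_mono) auto
        also have "\<dots> = 3 * (w * (1 + dual_norm (d k)))" by simp
        also have "\<dots> \<le> 3 * (1/2) ^ Suc k"
          using wt_dist[of k] unfolding w_def by (intro mult_left_mono) auto
        finally show ?thesis .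
      qed
      have "w \<le> w * (1 + dual_norm (d k))" using w by (simp add: algebra_simps)
      then have w1: "w \<le> (1/2) ^ Suc k" using wt_dist[of k] by (simp add: w_def)
      have "(D h (d k))\<^sup>2 \<le> ((a + b) / 2 + 2 * \<tau>)\<^sup>2"
        using Dh[of k] by (intro power_mono) (auto simp: a_def b_def)
      \<comment> \<open>The parallelogram identity for the mean of \<open>a\<close> and
        \<open>b\<close>; the negative square is the gain.\<close>
      also have "\<dots> = a\<^sup>2 / 2 + b\<^sup>2 / 2 - ((b - a) / 2)\<^sup>2 + 2 * \<tau> * (a + b) + 4 * \<tau>\<^sup>2"
        by (simp add: power2_eq_square field_simps)
      also have "4 * \<tau>\<^sup>2 \<le> 4 * \<tau>" using \<tau> by (simp add: power2_eq_square mult_left_le)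
      finally have "w * (D h (d k))\<^sup>2 \<le> w * (a\<^sup>2 / 2 + b\<^sup>2 / 2 - ((b - a) / 2)\<^sup>2 + 2 * \<tau> * (a + b) + 4 * \<tau>)"
        using w by (intro mult_left_mono) auto
      also have "\<dots> = 1/2 * (w * a\<^sup>2) + 1/2 * (w * b\<^sup>2) - w * ((b - a) / 2)\<^sup>2
          + 2 * \<tau> * (w * a) + 2 * \<tau> * (w * b) + 4 * \<tau> * w"
        by (simp add: algebra_simps)
      also have "\<dots> \<le> 1/2 * (w * a\<^sup>2) + 1/2 * (w * b\<^sup>2) - w * ((b - a) / 2)\<^sup>2
          + 2 * \<tau> * (3 * (1/2) ^ Suc k) + 2 * \<tau> * (3 * (1/2) ^ Suc k) + 4 * \<tau> * (1/2) ^ Suc k"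
        using bound[OF f(1)] bound[OF g(1)] w1 \<tau>
        by (intro add_mono mult_left_mono) (auto simp: a_def b_def)
      finally have *: "w * (D h (d k))\<^sup>2 \<le> 1/2 * (w * a\<^sup>2) + 1/2 * (w * b\<^sup>2) - w * ((b - a) / 2)\<^sup>2
          + 16 * \<tau> * (1/2) ^ Suc k" by (simp add: algebra_simps)
      have "(if k = n then \<theta> else 0) \<le> w * ((b - a) / 2)\<^sup>2"
      proof (cases "k = n")
        case True
        have "(e / 4)\<^sup>2 \<le> ((b - a) / 2)\<^sup>2"
          using gap e True by (intro power_mono) (auto simp: a_def b_def)
        then show ?thesis using True w by (simp add: \<theta>_def w_def)
      qed (use w in auto)
      then show ?thesis using * unfolding a_def b_def w_def by linarith
    qed
    have "(\<lambda>k. 1/2 * (wt k * (D f (d k))\<^sup>2) + 1/2 * (wt k * (D g (d k))\<^sup>2)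
        - (if k = n then \<theta> else 0) + 16 * \<tau> * (1/2) ^ Suc k) sums
        (1/2 * \<Psi> f + 1/2 * \<Psi> g - \<theta> + 16 * \<tau> * 1)"
      unfolding \<Psi>_def
      by (intro sums_add sums_diff sums_mult summable_sums summable_\<Psi> fg power_half_series sums_single)
    then have "\<Psi> h \<le> 1/2 * \<Psi> f + 1/2 * \<Psi> g - \<theta> + 16 * \<tau> * 1"
      unfolding \<Psi>_def by (intro sums_le[OF term_le summable_sums[OF summable_\<Psi>[OF h]]])
    then have "h \<in> K" using fg \<tau> h by (simp add: K_def)
    then have "h x \<le> N x" using le_N x(1) by blast
    then have "(1 + \<tau>) * (N x + g x) / 2 \<le> N x" using x(1) f(2) by (simp add: h_def)
    \<comment> \<open>Relative to \<open>N x\<close>, the left side is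
      \<open>(1 + \<tau>) * (1 - \<tau> / 4)\<close>, which is larger than 1 for \<tau> below
      3.\<close>
    moreover have "(1 + \<tau>) * (N x + (N x - \<tau> * N x / 2)) / 2 \<le> (1 + \<tau>) * (N x + g x) / 2"
      using \<tau> g(2) by (intro divide_right_mono mult_left_mono) auto
    ultimately have "(1 + \<tau>) * (N x + (N x - \<tau> * N x / 2)) / 2 \<le> N x" by linarith
    then have "\<tau> * N x * (3 - \<tau>) \<le> 0" by (simp add: algebra_simps)
    moreover have "\<tau> * N x * (3 - \<tau>) > 0" using \<tau> Npos by (intro mult_pos_pos) auto
    ultimately show False by simp
  qed
  moreover have "\<tau> * N x / 2 > 0" using \<tau> Npos by simp
  ultimately show ?thesis using that by blast
qed

text \<open>A functional of \<open>K\<close> that attains \<open>N (x + h)\<close> loses at most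
  \<open>4 * norm h\<close> when used at \<open>x\<close> instead, hence the radius
  \<open>\<delta> / 4\<close>. It is then close to \<open>f\<close> by \<open>K_smulian\<close>, and
  its increment along \<open>h\<close> is that of \<open>f\<close> up to
  \<open>e * norm h\<close>.\<close>

lemma N_upper_differentiable:
  assumes x: "x \<in> Y" "x \<noteq> 0" and f: "f \<in> K" "f x = N x" and e: "e > 0"
  obtains \<delta> where "\<delta> > 0" "\<And>h. h \<in> Y \<Longrightarrow> norm h < \<delta> \<Longrightarrow> N (x + h) \<le> N x + f h + e * norm h"
proof -
  obtain \<delta> where \<delta>: "\<delta> > 0" "\<And>g. g \<in> K \<Longrightarrow> N x - \<delta> < g x \<Longrightarrow> D g f \<le> e"
    using K_smulian[OF assms] by metis
  have "N (x + h) \<le> N x + f h + e * norm h" if h: "h \<in> Y" "norm h < \<delta> / 4" for h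
  proof -
    have xh: "x + h \<in> Y" by (rule subspace_add[OF subspace_Y x(1) h(1)])
    obtain g where g: "g \<in> K" "g (x + h) = N (x + h)" using N_attained[OF xh] .
    have gx: "g x = N (x + h) - g h" using subspace_dual_add[OF K_dual[OF g(1)] x(1) h(1)] g(2) by simp
    have "N x + f h \<le> N (x + h)"
      using le_N[OF f(1) xh] subspace_dual_add[OF K_dual[OF f(1)] x(1) h(1)] f(2) by simp
    then have "N x - \<delta> < g x"
      using K_apply[OF f(1) h(1)] K_apply[OF g(1) h(1)] h(2) gx by linarith
    then have "D g f \<le> e" by (rule \<delta>(2)[OF g(1)])
    then have "\<bar>g h - f h\<bar> \<le> e * norm h"
      using dual_apply[OF K_dual[OF g(1)] K_dual[OF f(1)] h(1)]
      by (meson mult_right_mono norm_ge_zero order_trans)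
    then show ?thesis using le_N[OF g(1) x(1)] gx by linarith
  qed
  then show ?thesis using that[of "\<delta> / 4"] \<delta>(1) by auto
qed

lemma N_square_upper_differentiable:
  assumes x: "x \<in> Y" and f: "f \<in> K" "f x = N x" and e: "e > 0"
  shows "\<exists>\<delta>>0. \<forall>h\<in>Y. norm h < \<delta> \<longrightarrow> (N (x + h))\<^sup>2 \<le> (N x)\<^sup>2 + 2 * N x * f h + e * norm h"
proof (cases "x = 0")
  case True
  have "(N h)\<^sup>2 \<le> e * norm h" if h: "h \<in> Y" "norm h < e / 4" for h
  proof -
    have "0 \<le> N h" using norm_le_N[OF h(1)] norm_ge_zero[of h] by linarith
    then have "(N h)\<^sup>2 \<le> (2 * norm h)\<^sup>2" using N_le[OF h(1)] by (intro power_mono) auto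
    also have "\<dots> = 4 * norm h * norm h" by (simp add: power2_eq_square)
    also have "\<dots> \<le> e * norm h" using h(2) by (intro mult_right_mono) auto
    finally show ?thesis .
  qed
  moreover have "N 0 = 0" using N_le[OF x] norm_le_N[OF x] True by simp
  ultimately show ?thesis using True e by (intro exI[of _ "e / 4"]) auto
next
  case False
  have Npos: "N x > 0" using norm_le_N[OF x] False by (metis less_le_trans zero_less_norm_iff)
  then have "e / (4 * N x) > 0" using e by simp
  then obtain \<delta> where \<delta>: "\<delta> > 0"
    "\<And>h. h \<in> Y \<Longrightarrow> norm h < \<delta> \<Longrightarrow> N (x + h) \<le> N x + f h + e / (4 * N x) * norm h"
    using N_upper_differentiable[OF x False f] by metis
  have "(N (x + h))\<^sup>2 \<le> (N x)\<^sup>2 + 2 * N x * f h + e * norm h"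
    \<comment> \<open>Half of \<open>e\<close> goes to the linear term. The radius
      \<open>e / 8\<close> keeps the quadratic remainder, at most 4 times the square of
      \<open>norm h\<close>, within the other half.\<close>
    if h: "h \<in> Y" "norm h < min \<delta> (e / 8)" for h
  proof -
    define u where "u = N (x + h) - N x"
    have xh: "x + h \<in> Y" by (rule subspace_add[OF subspace_Y x h(1)])
    have mh: "- h \<in> Y" by (rule subspace_neg[OF subspace_Y h(1)])
    have "u \<le> 2 * norm h" using N_triangle[OF x h(1)] N_le[OF h(1)] by (simp add: u_def)
    moreover have "- u \<le> 2 * norm h" using N_triangle[OF xh mh] N_le[OF mh] by (simp add: u_def)
    ultimately have "\<bar>u\<bar>\<^sup>2 \<le> (2 * norm h)\<^sup>2" by (intro power_mono) auto
    then have "u\<^sup>2 \<le> 4 * norm h * norm h" by (simp add: power2_eq_square)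
    also have "\<dots> \<le> e / 2 * norm h" using h(2) by (intro mult_right_mono) auto
    finally have u2: "u\<^sup>2 \<le> e / 2 * norm h" .
    have "u \<le> f h + e / (4 * N x) * norm h" using \<delta>(2)[of h] h unfolding u_def by linarith
    then have "2 * N x * u \<le> 2 * N x * (f h + e / (4 * N x) * norm h)"
      using Npos by (intro mult_left_mono) auto
    also have "\<dots> = 2 * N x * f h + e / 2 * norm h" using Npos by (simp add: field_simps)
    finally have "2 * N x * u \<le> 2 * N x * f h + e / 2 * norm h" .
    moreover have "(N (x + h))\<^sup>2 = (N x)\<^sup>2 + 2 * N x * u + u\<^sup>2"
      by (simp add: u_def power2_eq_square algebra_simps)
    ultimately show ?thesis using u2 by linarith
  qed
  then show ?thesis using \<delta>(1) e by (intro exI[of _ "min \<delta> (e / 8)"]) auto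
qed

end

lemma separable_dual_smooth_norm:
  fixes Y :: "'a::banach set"
  assumes Y: "subspace Y"
    and sep: "separable_space (Metric_space.mtopology (subspace_dual Y) (subspace_dual_dist Y))"
  obtains N g where "smooth_norm_on Y N g"
proof -
  interpret M: Metric_space "subspace_dual Y" "subspace_dual_dist Y"
    by (rule Metric_space_subspace_dual[OF Y])
  have zero: "restrict (\<lambda>_. 0) Y \<in> subspace_dual Y"
    by (intro restrict_in_subspace_dual[OF Y, of _ 0]) auto
  obtain C where C: "countable C" "C \<subseteq> subspace_dual Y" "M.mtopology closure_of C = subspace_dual Y"
    using sep unfolding separable_space_def by auto
  have "C \<noteq> {}" using C(3) zero by (metis closure_of_empty empty_iff)
  define d where "d n = (case n of 0 \<Rightarrow> restrict (\<lambda>_. 0) Y | Suc m \<Rightarrow> from_nat_into C m)" for n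
  interpret separable_dual Y d
  proof
    show "subspace Y" by fact
    show "d n \<in> subspace_dual Y" for n
      using zero C(2) from_nat_into[OF \<open>C \<noteq> {}\<close>] by (auto simp: d_def split: nat.split)
    show "d 0 = restrict (\<lambda>_. 0) Y" by (simp add: d_def)
    fix f and e :: real assume "f \<in> subspace_dual Y" "e > 0"
    then obtain c where c: "c \<in> C" "subspace_dual_dist Y f c < e"
      using C(3) by (auto simp: M.metric_closure_of)
    then obtain m where "from_nat_into C m = c"
      using C(1) by (metis from_nat_into_surj)
    then show "\<exists>n. subspace_dual_dist Y f (d n) < e"
      using c(2) by (intro exI[of _ "Suc m"]) (simp add: d_def)
  qed
  have "\<exists>f. x \<in> Y \<longrightarrow> f \<in> K \<and> f x = N x" for x using N_attained[of x] by metis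
  then obtain g where g: "\<And>x. x \<in> Y \<Longrightarrow> g x \<in> K" "\<And>x. x \<in> Y \<Longrightarrow> g x x = N x" by metis
  have "smooth_norm_on Y N g"
  proof
    fix x assume x: "x \<in> Y"
    show "norm x \<le> N x" "N x \<le> 2 * norm x" using x by (fact norm_le_N N_le)+
    show "N (x + y) \<le> N x + N y" if "y \<in> Y" for y using x that by (rule N_triangle)
    show "g x x = N x" using x by (rule g(2))
    show bound: "\<bar>g x h\<bar> \<le> 2 * norm h" if "h \<in> Y" for h using K_apply[OF g(1)[OF x] that] .
    show "bounded_linear_on Y (g x)"
      using K_dual[OF g(1)[OF x]] bound unfolding bounded_linear_on_def subspace_dual_def
      by (auto intro!: exI[of _ 2])
    show "upper_gradient Y (\<lambda>h. (N (x + h))\<^sup>2 - (N x)\<^sup>2) (\<lambda>h. 2 * N x * g x h)"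
      unfolding upper_gradient_def
    proof (intro allI impI)
      fix e :: real assume "e > 0"
      from N_square_upper_differentiable[OF x g(1)[OF x] g(2)[OF x] this]
      show "\<exists>\<delta>>0. \<forall>h\<in>Y. norm h < \<delta> \<longrightarrow> (N (x + h))\<^sup>2 - (N x)\<^sup>2 \<le> 2 * N x * g x h + e * norm h"
        by (simp add: algebra_simps)
    qed
  qed (rule Y)
  then show ?thesis by (rule that)
qed

section \<open>The Borwein-Preiss variational principle\<close>

lemma approx_minimizer:
  fixes A :: "'b \<Rightarrow> real"
  assumes "S \<noteq> {}" "\<And>v. v \<in> S \<Longrightarrow> 0 \<le> A v" "e > 0"
  obtains x where "x \<in> S" "\<And>v. v \<in> S \<Longrightarrow> A x \<le> A v + e"
proof -
  have bdd: "bdd_below (A ` S)" using assms(2) by (intro bdd_belowI2[of _ 0])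
  have "Inf (A ` S) < Inf (A ` S) + e" using \<open>e > 0\<close> by simp
  then obtain y where "y \<in> A ` S" "y < Inf (A ` S) + e"
    using cInf_lessD[of "A ` S"] \<open>S \<noteq> {}\<close> by blast
  then obtain x where x: "x \<in> S" "A x < Inf (A ` S) + e" by blast
  show ?thesis
  proof (rule that[OF x(1)])
    fix v assume "v \<in> S"
    then show "A x \<le> A v + e" using cINF_lower[OF bdd, of v] x(2) by linarith
  qed
qed

text \<open>Points are families of which only the coordinates in \<open>J\<close> matter, so no topology on the function
  type is involved.\<close>

lemma borwein_preiss:
  fixes J :: "'j set" and C :: "'j \<Rightarrow> 'a::banach set" and f :: "('j \<Rightarrow> 'a) \<Rightarrow> real"
    and \<rho> :: "('j \<Rightarrow> 'a) \<Rightarrow> ('j \<Rightarrow> 'a) \<Rightarrow> real"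
  defines "conv \<equiv> \<lambda>s v. (\<forall>n. s n \<in> Pi J C) \<and> v \<in> Pi J C \<and> (\<forall>j\<in>J. (\<lambda>n. s n j) \<longlonglongrightarrow> v j)"
  assumes C: "\<And>j. j \<in> J \<Longrightarrow> closed (C j)"
    and f_nonneg: "\<And>v. v \<in> Pi J C \<Longrightarrow> 0 \<le> f v"
    and f_cont: "\<And>s v. conv s v \<Longrightarrow> (\<lambda>n. f (s n)) \<longlonglongrightarrow> f v"
    and \<rho>_cont: "\<And>s v w. conv s v \<Longrightarrow> w \<in> Pi J C \<Longrightarrow> (\<lambda>n. \<rho> (s n) w) \<longlonglongrightarrow> \<rho> v w"
    and \<rho>_refl: "\<And>v. v \<in> Pi J C \<Longrightarrow> \<rho> v v = 0"
    and \<rho>_norm: "\<And>v w j. v \<in> Pi J C \<Longrightarrow> w \<in> Pi J C \<Longrightarrow> j \<in> J \<Longrightarrow> (norm (v j - w j))\<^sup>2 \<le> \<rho> v w"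
    and \<rho>_nonneg: "\<And>v w. v \<in> Pi J C \<Longrightarrow> w \<in> Pi J C \<Longrightarrow> 0 \<le> \<rho> v w"
    and x0: "x0 \<in> Pi J C" "f x0 \<le> \<epsilon>" and pos: "\<epsilon> > 0" "\<delta> > 0"
  obtains v xs where "v \<in> Pi J C" "\<And>k. xs k \<in> Pi J C" "xs 0 = x0"
    "\<And>k. \<rho> v (xs k) \<le> \<epsilon> / \<delta>"
    "\<And>u. u \<in> Pi J C \<Longrightarrow> summable (\<lambda>k. \<delta> * (1/2)^k * \<rho> u (xs k)) \<Longrightarrow>
       f v + (\<Sum>k. \<delta> * (1/2)^k * \<rho> v (xs k)) \<le> f u + (\<Sum>k. \<delta> * (1/2)^k * \<rho> u (xs k))"
proof -
  let ?S = "Pi J C"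
  define \<delta>' where "\<delta>' n = \<delta> * (1/2)^n" for n :: nat
  have \<delta>': "\<delta>' n > 0" for n using pos by (simp add: \<delta>'_def)
  \<comment> \<open>State of the iteration: \<open>A\<close> is \<open>f\<close> with the penalties
    added so far, \<open>S\<close> a set shrinking towards the limit, \<open>x\<close> the centre of
    the next penalty. Since completeness is used only coordinatewise, closedness of \<open>S\<close>
    and continuity of \<open>A\<close> are stated through \<open>conv\<close>.\<close>
  define P where "P = (\<lambda>(n::nat) (A :: ('j \<Rightarrow> 'a) \<Rightarrow> real, S, x). x \<in> S \<and> S \<subseteq> ?S \<and> (\<forall>v\<in>?S. 0 \<le> A v) \<and>
    (\<forall>v\<in>S. \<rho> v x \<le> \<epsilon> / \<delta> * (1/2)^n) \<and>
    (\<forall>s v. conv s v \<longrightarrow> (\<forall>n. s n \<in> S) \<longrightarrow> v \<in> S) \<and>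
    (\<forall>s v. conv s v \<longrightarrow> (\<lambda>n. A (s n)) \<longlonglongrightarrow> A v))"
  define Q where "Q = (\<lambda>(n::nat) (A, S, x) (A', S', x').
     A' = (\<lambda>v. A v + \<delta>' n * \<rho> v x) \<and> x' \<in> S \<and> S' = {v \<in> S. A' v + \<delta>' (Suc n) * \<rho> v x' \<le> A' x'})"
  have lim_closed: "v \<in> {v \<in> S. A v + c * \<rho> v x \<le> A x}"
    if "conv s v" "\<forall>n. s n \<in> {v \<in> S. A v + c * \<rho> v x \<le> A x}" "x \<in> ?S"
      and "\<forall>s v. conv s v \<longrightarrow> (\<forall>n. s n \<in> S) \<longrightarrow> v \<in> S"
      and "\<forall>s v. conv s v \<longrightarrow> (\<lambda>n. A (s n)) \<longlonglongrightarrow> A v" for A S c x s v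
  proof -
    have "(\<lambda>n. A (s n) + c * \<rho> (s n) x) \<longlonglongrightarrow> A v + c * \<rho> v x"
      using that by (intro tendsto_intros \<rho>_cont) auto
    then have "A v + c * \<rho> v x \<le> A x" using that(2) by (intro LIMSEQ_le_const2) auto
    then show ?thesis using that by blast
  qed
  have base: "P 0 (f, {v \<in> ?S. f v + \<delta>' 0 * \<rho> v x0 \<le> f x0}, x0)"
    unfolding P_def prod.case
  proof (intro conjI ballI allI impI)
    fix v assume v: "v \<in> {v \<in> ?S. f v + \<delta>' 0 * \<rho> v x0 \<le> f x0}"
    then have "\<delta> * \<rho> v x0 \<le> \<epsilon>" using f_nonneg[of v] x0(2) by (simp add: \<delta>'_def)
    then show "\<rho> v x0 \<le> \<epsilon> / \<delta> * (1/2) ^ 0" using pos by (simp add: field_simps)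
  next
    fix s v assume "conv s v" "\<forall>n. s n \<in> {v \<in> ?S. f v + \<delta>' 0 * \<rho> v x0 \<le> f x0}"
    then show "v \<in> {v \<in> ?S. f v + \<delta>' 0 * \<rho> v x0 \<le> f x0}"
      using x0(1)
    proof (rule lim_closed)
      show "\<forall>s v. conv s v \<longrightarrow> (\<forall>n. s n \<in> ?S) \<longrightarrow> v \<in> ?S" by (simp add: conv_def)
      show "\<forall>s v. conv s v \<longrightarrow> (\<lambda>n. f (s n)) \<longlonglongrightarrow> f v" using f_cont by blast
    qed
  qed (use x0 \<rho>_refl f_nonneg f_cont in auto)
  have step: "\<exists>y. P (Suc n) y \<and> Q n t y" if t: "P n t" for n t
  proof -
    obtain A S x where [simp]: "t = (A, S, x)" by (cases t)
    have tt: "x \<in> S" "S \<subseteq> ?S" "\<And>v. v \<in> ?S \<Longrightarrow> 0 \<le> A v"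
      "\<forall>s v. conv s v \<longrightarrow> (\<forall>n. s n \<in> S) \<longrightarrow> v \<in> S"
      "\<And>s v. conv s v \<Longrightarrow> (\<lambda>n. A (s n)) \<longlonglongrightarrow> A v"
      using t by (auto simp: P_def)
    define A' where "A' v = A v + \<delta>' n * \<rho> v x" for v
    have xS: "x \<in> ?S" using tt by blast
    have A'0: "0 \<le> A' v" if "v \<in> ?S" for v
      using tt(3)[OF that] \<rho>_nonneg[OF that xS] \<delta>'[of n] by (simp add: A'_def)
    have A'c: "(\<lambda>n. A' (s n)) \<longlonglongrightarrow> A' v" if "conv s v" for s v
      unfolding A'_def using that xS by (intro tendsto_intros tt(5) \<rho>_cont) auto
    \<comment> \<open>The tolerance falls like \<open>(1/4) ^ n\<close> while the weights fall like
      \<open>(1/2) ^ n\<close>; their quotient bounds \<rho> on the next set and still tends to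
      0.\<close>
    obtain x' where x': "x' \<in> S" "\<And>v. v \<in> S \<Longrightarrow> A' x' \<le> A' v + \<epsilon> * (1/4) ^ Suc n"
    proof (rule approx_minimizer[of S A' "\<epsilon> * (1/4) ^ Suc n"])
      show "S \<noteq> {}" "0 < \<epsilon> * (1/4) ^ Suc n" using tt(1) pos(1) by auto
      show "0 \<le> A' v" if "v \<in> S" for v using A'0 tt(2) that by blast
    qed blast
    have x'S: "x' \<in> ?S" using x' tt by blast
    define S' where "S' = {v \<in> S. A' v + \<delta>' (Suc n) * \<rho> v x' \<le> A' x'}"
    have "P (Suc n) (A', S', x')"
      unfolding P_def prod.case
    proof (intro conjI ballI allI impI)
      show "x' \<in> S'" using x'(1) \<rho>_refl[OF x'S] by (simp add: S'_def)
      show "S' \<subseteq> ?S" using tt(2) by (auto simp: S'_def)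
      fix v assume "v \<in> S'"
      then have "\<delta>' (Suc n) * \<rho> v x' \<le> \<epsilon> * (1/4) ^ Suc n" using x'(2)[of v] by (simp add: S'_def)
      then have "\<rho> v x' \<le> \<epsilon> * (1/4) ^ Suc n / \<delta>' (Suc n)"
        using \<delta>'[of "Suc n"] by (simp add: field_simps)
      also have "\<dots> = \<epsilon> / \<delta> * (1/2) ^ Suc n"
        using pos by (simp add: \<delta>'_def field_simps power_mult_distrib[symmetric])
      finally show "\<rho> v x' \<le> \<epsilon> / \<delta> * (1/2) ^ Suc n" .
    next
      fix s v assume "conv s v" "\<forall>n. s n \<in> S'"
      then show "v \<in> S'"
        unfolding S'_def using x'S tt(4) A'c by (intro lim_closed) auto
    qed (use A'0 A'c in auto)
    moreover have "Q n t (A', S', x')" using x' by (auto simp: Q_def A'_def S'_def)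
    ultimately show ?thesis by blast
  qed
  obtain t where t0: "t 0 = (f, {v \<in> ?S. f v + \<delta>' 0 * \<rho> v x0 \<le> f x0}, x0)"
    and tP: "\<And>n. P n (t n)" and tQ: "\<And>n. Q n (t n) (t (Suc n))"
  proof -
    have "\<exists>g. \<forall>n. (P n (g n) \<and> (n = 0 \<longrightarrow> g n = (f, {v \<in> ?S. f v + \<delta>' 0 * \<rho> v x0 \<le> f x0}, x0))) \<and> Q n (g n) (g (Suc n))"
      by (rule dependent_nat_choice) (use base step in auto)
    then show ?thesis using that by blast
  qed
  define A where "A n = fst (t n)" for n
  define S where "S n = fst (snd (t n))" for n
  define xs where "xs n = snd (snd (t n))" for n
  have t_eq: "t n = (A n, S n, xs n)" for n by (simp add: A_def S_def xs_def)
  have xsS: "xs n \<in> S n" and SS: "S n \<subseteq> ?S" and rad: "\<And>v. v \<in> S n \<Longrightarrow> \<rho> v (xs n) \<le> \<epsilon> / \<delta> * (1/2)^n"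
    and Scl: "\<And>s v. conv s v \<Longrightarrow> (\<And>n'. s n' \<in> S n) \<Longrightarrow> v \<in> S n" for n
    using tP[of n] unfolding t_eq P_def by auto
  have xs_in: "xs n \<in> ?S" for n using xsS SS by blast
  have A_Suc: "A (Suc n) = (\<lambda>v. A n v + \<delta>' n * \<rho> v (xs n))"
    and S_Suc: "S (Suc n) = {v \<in> S n. A (Suc n) v + \<delta>' (Suc n) * \<rho> v (xs (Suc n)) \<le> A (Suc n) (xs (Suc n))}" for n
    using tQ[of n] unfolding t_eq Q_def by auto
  have A_0: "A 0 = f" and xs_0: "xs 0 = x0" and S_0: "S 0 = {v \<in> ?S. f v + \<delta>' 0 * \<rho> v x0 \<le> f x0}"
    using t0 by (auto simp: t_eq)
  have A_eq: "A n v = f v + (\<Sum>k<n. \<delta>' k * \<rho> v (xs k))" for n v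
    by (induction n) (auto simp: A_0 A_Suc)
  \<comment> \<open>The inequality defining \<open>S n\<close>, with its penalty absorbed into
    \<open>A (Suc n)\<close>.\<close>
  have S_iff: "v \<in> S n \<Longrightarrow> A (Suc n) v \<le> A n (xs n)" for n v
    by (cases n) (auto simp: S_0 S_Suc A_Suc A_0 xs_0)
  have S_anti: "S m \<subseteq> S n" if "n \<le> m" for m n
    using that by (rule lift_Suc_antimono_le[rotated]) (auto simp: S_Suc)
  have close: "norm (v j - xs n j) \<le> sqrt (\<epsilon> / \<delta> * (1/2)^n)" if "v \<in> S n" "j \<in> J" for v j n
  proof -
    have "(norm (v j - xs n j))\<^sup>2 \<le> \<epsilon> / \<delta> * (1/2)^n"
      using \<rho>_norm[OF _ xs_in that(2), of v n] rad[OF that(1)] SS that(1) by fastforce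
    then show ?thesis by (simp add: real_le_rsqrt)
  qed
  have rad0: "(\<lambda>n. sqrt (\<epsilon> / \<delta> * (1/2)^n)) \<longlonglongrightarrow> 0"
  proof -
    have "(\<lambda>n. sqrt (\<epsilon> / \<delta> * (1/2)^n)) \<longlonglongrightarrow> sqrt (\<epsilon> / \<delta> * 0)"
      by (intro tendsto_intros LIMSEQ_power_zero) auto
    then show ?thesis by simp
  qed
  have "Cauchy (\<lambda>n. xs n j)" if j: "j \<in> J" for j
  proof (rule metric_CauchyI)
    fix e :: real assume "e > 0"
    then obtain n where n: "sqrt (\<epsilon> / \<delta> * (1/2)^n) < e / 2"
      using order_tendstoD(2)[OF rad0, of "e / 2"] by (auto simp: eventually_sequentially)
    have "dist (xs m j) (xs n j) < e / 2" if "m \<ge> n" for m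
      using close[of "xs m" n j] j xsS S_anti[OF that] n by (force simp: dist_norm)
    then show "\<exists>M. \<forall>m\<ge>M. \<forall>n\<ge>M. dist (xs m j) (xs n j) < e"
      by (intro exI[of _ n]) (metis dist_triangle_half_l)
  qed
  then have "\<exists>l. j \<in> J \<longrightarrow> (\<lambda>n. xs n j) \<longlonglongrightarrow> l" for j
    by (metis Cauchy_convergent_iff convergent_def)
  then obtain v where v: "\<And>j. j \<in> J \<Longrightarrow> (\<lambda>n. xs n j) \<longlonglongrightarrow> v j" by metis
  have vS: "v \<in> ?S"
    using closed_sequentially[OF C _ v] xs_in by (auto simp: Pi_iff)
  have v_in: "v \<in> S n" for n
  proof (rule Scl[of "\<lambda>m. xs (m + n)"])
    show "conv (\<lambda>m. xs (m + n)) v"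
      using vS xs_in LIMSEQ_ignore_initial_segment[OF v] by (auto simp: conv_def)
    show "xs (m + n) \<in> S n" for m using xsS S_anti[of n "m + n"] by auto
  qed
  have rad_v: "\<rho> v (xs k) \<le> \<epsilon> / \<delta>" for k
  proof -
    have "\<epsilon> / \<delta> * (1/2)^k \<le> \<epsilon> / \<delta> * 1"
      using pos by (intro mult_left_mono power_le_one) auto
    then show ?thesis using rad[OF v_in[of k]] by simp
  qed
  have sum_v: "summable (\<lambda>k. \<delta>' k * \<rho> v (xs k))"
  proof (rule summable_comparison_test')
    show "summable (\<lambda>k. \<epsilon> * (1/2::real)^k)" by (intro summable_mult summable_geometric) auto
    fix k
    have "\<delta>' k * \<rho> v (xs k) \<le> \<delta>' k * (\<epsilon> / \<delta>)" using rad_v \<delta>'[of k] by (intro mult_left_mono) auto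
    then show "norm (\<delta>' k * \<rho> v (xs k)) \<le> \<epsilon> * (1/2)^k"
      using \<delta>'[of k] \<rho>_nonneg[OF vS xs_in[of k]] pos by (simp add: \<delta>'_def field_simps)
  qed
  have min: "f v + (\<Sum>k. \<delta>' k * \<rho> v (xs k)) \<le> f u + (\<Sum>k. \<delta>' k * \<rho> u (xs k))"
    if u: "u \<in> ?S" and su: "summable (\<lambda>k. \<delta>' k * \<rho> u (xs k))" for u
  proof (cases "\<forall>n. u \<in> S n")
    case True
    have "u j = v j" if j: "j \<in> J" for j
    proof -
      have "(\<lambda>n. u j - xs n j) \<longlonglongrightarrow> 0"
        using close True j by (intro Lim_null_comparison[OF _ rad0]) auto
      then have "(\<lambda>n. u j - (u j - xs n j)) \<longlonglongrightarrow> u j - 0" by (intro tendsto_intros)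
      then show ?thesis using v[OF j] LIMSEQ_unique by fastforce
    qed
    \<comment> \<open>For the constant sequence, continuity says that \<open>f\<close> and \<rho> do
      not see coordinates outside \<open>J\<close>.\<close>
    then have "conv (\<lambda>_. u) v" using u vS by (simp add: conv_def)
    from f_cont[OF this] \<rho>_cont[OF this xs_in] have "f u = f v" "\<And>k. \<rho> u (xs k) = \<rho> v (xs k)"
      by (simp_all add: LIMSEQ_const_iff)
    then show ?thesis by simp
  next
    case False
    \<comment> \<open>At the first level that excludes \<open>u\<close>, membership in the previous
      set still holds, so it is the defining inequality that fails; reversed, it bounds
      \<open>A (Suc n) u\<close> from below.\<close>
    define n where "n = (LEAST n. u \<notin> S n)"
    have n: "u \<notin> S n" using False unfolding n_def by (metis LeastI_ex)
    have before: "u \<in> S k" if "k < n" for k using that not_less_Least unfolding n_def by blast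
    have less: "A n (xs n) < A (Suc n) u"
    proof (cases n)
      case 0 then show ?thesis using n u by (simp add: S_0 A_0 A_Suc xs_0)
    next
      case (Suc m) then show ?thesis using n before[of m] by (simp add: S_Suc A_Suc)
    qed
    \<comment> \<open>The values at the centres decrease, so the bound for \<open>u\<close> persists
      at later levels, where \<open>S_iff\<close> puts \<open>v\<close> below them.\<close>
    have dec: "A m (xs m) \<le> A n (xs n)" if "n \<le> m" for m
      using that
    proof (rule lift_Suc_antimono_le[rotated])
      fix k
      have "xs (Suc k) \<in> S k" using xsS[of "Suc k"] by (simp add: S_Suc)
      then show "A (Suc k) (xs (Suc k)) \<le> A k (xs k)" by (rule S_iff)
    qed
    have nn: "0 \<le> \<delta>' k * \<rho> u (xs k)" for k using \<delta>'[of k] \<rho>_nonneg[OF u xs_in] by simp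
    have Au: "A k u \<le> f u + (\<Sum>k. \<delta>' k * \<rho> u (xs k))" for k
      unfolding A_eq using nn by (intro add_left_mono sum_le_suminf su) auto
    have "f v + (\<Sum>k<m. \<delta>' k * \<rho> v (xs k)) \<le> f u + (\<Sum>k. \<delta>' k * \<rho> u (xs k))" if "Suc n \<le> m" for m
    proof -
      have "m = Suc (m - 1)" "n \<le> m - 1" using that by auto
      then obtain k where k: "m = Suc k" "n \<le> k" by blast
      have "A m v \<le> A n (xs n)" using S_iff[OF v_in[of k]] dec[OF k(2)] k(1) by simp
      then show ?thesis using less Au[of "Suc n"] by (simp add: A_eq)
    qed
    moreover have "(\<lambda>m. f v + (\<Sum>k<m. \<delta>' k * \<rho> v (xs k))) \<longlonglongrightarrow> f v + (\<Sum>k. \<delta>' k * \<rho> v (xs k))"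
      by (intro tendsto_intros summable_LIMSEQ sum_v)
    ultimately show ?thesis by (intro LIMSEQ_le_const2) blast+
  qed
  show ?thesis
    using that[of v xs] vS xs_in xs_0 rad_v min by (simp add: \<delta>'_def)
qed

section \<open>Frechet normals at an approximate minimizer\<close>

text \<open>The Frechet normal condition for \<Omega> \<inter> Y inside \<open>Y\<close>, in
  epsilon-delta form and for plain real functions, so that it makes sense for functionals given only
  on \<open>Y\<close>.\<close>

definition normal_on :: "'a::real_normed_vector set \<Rightarrow> 'a set \<Rightarrow> 'a \<Rightarrow> ('a \<Rightarrow> real) \<Rightarrow> bool" where
  "normal_on Y \<Omega> x g \<longleftrightarrow>
     (\<forall>e>0. \<exists>\<delta>>0. \<forall>u\<in>\<Omega> \<inter> Y. norm (u - x) < \<delta> \<longrightarrow> g (u - x) \<le> e * norm (u - x))"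

text \<open>A constrained minimum admits only directions that stay in \<Omega>, so it yields a
  normal instead of an equation. The factor \<open>- 1 *\<close> gives the functional the shape of
  \<open>bounded_linear_on_cmult\<close> and of the homogeneity rule for the extension
  operator.\<close>

lemma upper_gradient_normal:
  assumes up: "upper_gradient Y \<psi> L" and Y: "subspace Y" "x \<in> Y"
    and min: "\<And>h. h \<in> Y \<Longrightarrow> x + h \<in> \<Omega> \<Longrightarrow> 0 \<le> \<psi> h"
  shows "normal_on Y \<Omega> x (\<lambda>h. - 1 * L h)"
  unfolding normal_on_def
proof (intro allI impI)
  fix e :: real assume "e > 0"
  then obtain \<delta> where \<delta>: "\<delta> > 0" "\<And>h. h \<in> Y \<Longrightarrow> norm h < \<delta> \<Longrightarrow> \<psi> h \<le> L h + e * norm h"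
    using up unfolding upper_gradient_def by meson
  have "- 1 * L (u - x) \<le> e * norm (u - x)" if "u \<in> \<Omega> \<inter> Y" "norm (u - x) < \<delta>" for u
  proof -
    have "u - x \<in> Y" using that Y by (auto intro: subspace_diff)
    then show ?thesis using \<delta>(2)[of "u - x"] min[of "u - x"] that by simp
  qed
  then show "\<exists>\<delta>>0. \<forall>u\<in>\<Omega> \<inter> Y. norm (u - x) < \<delta> \<longrightarrow> - 1 * L (u - x) \<le> e * norm (u - x)"
    using \<delta>(1) by blast
qed

lemma normal_on_scale:
  assumes "normal_on Y \<Omega> x g" "c > 0"
  shows "normal_on Y \<Omega> x (\<lambda>h. c * g h)"
  unfolding normal_on_def
proof (intro allI impI)
  fix e :: real assume "e > 0"
  then have "e / c > 0" using \<open>c > 0\<close> by simp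
  then obtain \<delta> where \<delta>: "\<delta> > 0"
    "\<And>u. u \<in> \<Omega> \<inter> Y \<Longrightarrow> norm (u - x) < \<delta> \<Longrightarrow> g (u - x) \<le> e / c * norm (u - x)"
    using assms(1) unfolding normal_on_def by meson
  have "c * g (u - x) \<le> e * norm (u - x)" if "u \<in> \<Omega> \<inter> Y" "norm (u - x) < \<delta>" for u
    using mult_left_mono[OF \<delta>(2)[OF that], of c] \<open>c > 0\<close> by simp
  then show "\<exists>\<delta>>0. \<forall>u\<in>\<Omega> \<inter> Y. norm (u - x) < \<delta> \<longrightarrow> c * g (u - x) \<le> e * norm (u - x)"
    using \<delta>(1) by blast
qed

lemma normal_on_imp_frechet_normal:
  assumes "normal_on UNIV \<Omega> x (blinfun_apply f)" "x \<in> \<Omega>"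
  shows "f \<in> frechet_normal_cone \<Omega> x"
proof -
  have "Limsup (at x within \<Omega>) (\<lambda>u. ereal (f (u - x) / norm (u - x))) \<le> 0 + ereal e" if e: "e > 0" for e
  proof (rule Limsup_bounded)
    obtain \<delta> where \<delta>: "\<delta> > 0" "\<And>u. u \<in> \<Omega> \<Longrightarrow> norm (u - x) < \<delta> \<Longrightarrow> f (u - x) \<le> e * norm (u - x)"
      using assms(1) e unfolding normal_on_def by auto
    show "\<forall>\<^sub>F u in at x within \<Omega>. ereal (f (u - x) / norm (u - x)) \<le> 0 + ereal e"
      unfolding eventually_at
    proof (intro exI[of _ \<delta>] conjI ballI impI)
      fix u assume "u \<in> \<Omega>" "u \<noteq> x \<and> dist u x < \<delta>"
      then have "f (u - x) \<le> e * norm (u - x)" "norm (u - x) > 0" using \<delta>(2)[of u] by (auto simp: dist_norm)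
      then show "ereal (f (u - x) / norm (u - x)) \<le> 0 + ereal e" by (simp add: divide_le_eq)
    qed (rule \<delta>(1))
  qed
  then have "Limsup (at x within \<Omega>) (\<lambda>u. ereal (f (u - x) / norm (u - x))) \<le> 0"
    by (simp add: ereal_le_epsilon2)
  then show ?thesis using assms(2) by (simp add: frechet_normal_cone_def)
qed

text \<open>A concave function lies below its tangent; this replaces a chain rule for the root in
  \<open>extremal_functionals\<close>.\<close>

lemma sqrt_increment:
  fixes Q Q0 :: real
  assumes "Q0 > 0" "Q \<ge> 0"
  shows "sqrt Q - sqrt Q0 \<le> 1 / (2 * sqrt Q0) * (Q - Q0)"
proof -
  define x y where "x = sqrt Q" and "y = sqrt Q0"
  have xy: "Q = x * x" "Q0 = y * y" "y > 0" using assms by (auto simp: x_def y_def)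
  have "0 \<le> (x - y) * (x - y)" by simp
  then have "2 * y * (x - y) \<le> x * x - y * y" by (simp add: algebra_simps)
  then have "x - y \<le> 1 / (2 * y) * (x * x - y * y)" using xy(3) by (simp add: field_simps)
  then show ?thesis unfolding xy(1,2)[symmetric] by (simp add: x_def y_def)
qed

text \<open>The family index \<open>None\<close> carries the common translate \<open>z\<close>, the index \<open>Some i\<close> the point \<open>x i\<close>. The
  functionals \<open>p i\<close> are the partial gradients of \<open>f\<close>, and \<open>t i\<close>, \<open>tz\<close> those of the perturbation.\<close>

lemma (in smooth_norm_on) extremal_functionals:
  fixes \<Omega> :: "'i \<Rightarrow> 'a set" and a :: "'i \<Rightarrow> 'a"
  assumes I: "finite I" "I \<noteq> {}" and clY: "closed Y" and cl: "\<And>i. i \<in> I \<Longrightarrow> closed (\<Omega> i)"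
    and xbar: "xbar \<in> Y" "\<And>i. i \<in> I \<Longrightarrow> xbar \<in> \<Omega> i"
    and a: "\<And>i. i \<in> I \<Longrightarrow> a i \<in> Y" "\<And>i. i \<in> I \<Longrightarrow> norm (a i) \<le> r"
    and pos: "r > 0" "l > 0"
    and empty: "\<And>z. z \<in> cball xbar l \<Longrightarrow> \<exists>i\<in>I. z + a i \<notin> \<Omega> i"
  defines "s \<equiv> 16 * sqrt (card I) * r / l"
  obtains x w :: "'i \<Rightarrow> 'a" and p t :: "'i \<Rightarrow> 'a \<Rightarrow> real" and tz :: "'a \<Rightarrow> real" and F :: real
  where "\<And>i. i \<in> I \<Longrightarrow> x i \<in> \<Omega> i \<inter> Y" "\<And>i. i \<in> I \<Longrightarrow> norm (x i - xbar) \<le> l"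
    and "\<And>i. i \<in> I \<Longrightarrow> bounded_linear_on Y (p i)" "\<And>i. i \<in> I \<Longrightarrow> bounded_linear_on Y (t i)"
    and "bounded_linear_on Y tz"
    and "\<And>i h. i \<in> I \<Longrightarrow> h \<in> Y \<Longrightarrow> \<bar>t i h\<bar> \<le> s * norm h" "\<And>h. h \<in> Y \<Longrightarrow> \<bar>tz h\<bar> \<le> s * norm h"
    and "\<And>i. i \<in> I \<Longrightarrow> normal_on Y (\<Omega> i) (x i) (\<lambda>h. - 1 * (p i h + t i h))"
    and "\<And>h. h \<in> Y \<Longrightarrow> (\<Sum>i\<in>I. p i h) = tz h"
    and "F > 0" "\<And>i. i \<in> I \<Longrightarrow> w i \<in> Y" "(\<Sum>i\<in>I. p i (w i)) = F" "(\<Sum>i\<in>I. (norm (w i))\<^sup>2) \<le> F\<^sup>2"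
proof -
  define J where "J = insert None (Some ` I)"
  define C where "C j = (case j of None \<Rightarrow> Y | Some i \<Rightarrow> \<Omega> i \<inter> Y)" for j
  define Q where "Q v = (\<Sum>i\<in>I. (N (v (Some i) - a i - v None))\<^sup>2)" for v :: "'i option \<Rightarrow> 'a"
  define f where "f v = sqrt (Q v)" for v
  define \<rho> where "\<rho> u v = (\<Sum>j\<in>J. (N (u j - v j))\<^sup>2)" for u v :: "'i option \<Rightarrow> 'a"
  \<comment> \<open>Bounds \<open>f\<close> at the constant family: each of its terms is
    \<open>N (- a i)\<close>, at most \<open>2 * r\<close>.\<close>
  define \<epsilon> where "\<epsilon> = 2 * r * sqrt (card I)"
  \<comment> \<open>Chosen to make \<open>\<epsilon> / \<delta>\<close> the square of the admissible
    radius \<open>l\<close>.\<close>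
  define \<delta> where "\<delta> = \<epsilon> / l\<^sup>2"
  have J: "finite J" using I by (simp add: J_def)
  have C_closed: "closed (C j)" if "j \<in> J" for j
    using that by (auto simp: J_def C_def intro!: closed_Int cl clY)
  have CY: "v j \<in> Y" if "v \<in> Pi J C" "j \<in> J" for v j
    using that by (auto simp: J_def C_def Pi_iff)
  have jN: "None \<in> J" and jS: "\<And>i. i \<in> I \<Longrightarrow> Some i \<in> J" by (auto simp: J_def)
  have wY: "v (Some i) - a i - v None \<in> Y" if "v \<in> Pi J C" "i \<in> I" for v i
    using that CY jN jS a by (intro subspace_diff subspace_Y) auto
  have dY: "u j - v j \<in> Y" if "u \<in> Pi J C" "v \<in> Pi J C" "j \<in> J" for u v j
    using that CY by (intro subspace_diff subspace_Y) auto
  have cI: "card I > 0" using I by (simp add: card_gt_0_iff)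
  have \<epsilon>: "\<epsilon> > 0" using pos cI by (simp add: \<epsilon>_def)
  have \<delta>: "\<delta> > 0" using \<epsilon> pos by (simp add: \<delta>_def)
  have \<epsilon>\<delta>: "\<epsilon> / \<delta> = l\<^sup>2" using \<epsilon> pos by (simp add: \<delta>_def)
  have Q0: "0 \<le> Q v" for v unfolding Q_def by (intro sum_nonneg) auto
  let ?x0 = "\<lambda>_ :: 'i option. xbar"
  have x0: "?x0 \<in> Pi J C" using xbar by (auto simp: J_def C_def)
  have "Q ?x0 \<le> (\<Sum>i\<in>I. (2 * r)\<^sup>2)"
    unfolding Q_def
  proof (intro sum_mono power_mono)
    fix i assume i: "i \<in> I"
    have "- a i \<in> Y" using a(1)[OF i] by (intro subspace_neg subspace_Y)
    then show "N (xbar - a i - xbar) \<le> 2 * r" "0 \<le> N (xbar - a i - xbar)"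
      using N_le[of "- a i"] a(2)[OF i] N_nonneg by auto
  qed
  also have "\<dots> = \<epsilon>\<^sup>2" by (simp add: \<epsilon>_def power_mult_distrib)
  finally have fx0: "f ?x0 \<le> \<epsilon>" using \<epsilon> by (simp add: f_def real_le_lsqrt)
  obtain v xs where vS: "v \<in> Pi J C" and xsS: "\<And>k. xs k \<in> Pi J C" and xs0: "xs 0 = ?x0"
    and rad: "\<And>k. \<rho> v (xs k) \<le> \<epsilon> / \<delta>"
    and min: "\<And>u. u \<in> Pi J C \<Longrightarrow> summable (\<lambda>k. \<delta> * (1/2)^k * \<rho> u (xs k)) \<Longrightarrow>
       f v + (\<Sum>k. \<delta> * (1/2)^k * \<rho> v (xs k)) \<le> f u + (\<Sum>k. \<delta> * (1/2)^k * \<rho> u (xs k))"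
  proof (rule borwein_preiss[of J C f \<rho> ?x0 \<epsilon> \<delta>])
    fix s' u assume cv: "(\<forall>n. s' n \<in> Pi J C) \<and> u \<in> Pi J C \<and> (\<forall>j\<in>J. (\<lambda>n. s' n j) \<longlonglongrightarrow> u j)"
    then have s': "\<And>n. s' n \<in> Pi J C" and u: "u \<in> Pi J C"
      and lim: "\<And>j. j \<in> J \<Longrightarrow> (\<lambda>n. s' n j) \<longlonglongrightarrow> u j" by blast+
    have "(\<lambda>n. N (s' n (Some i) - a i - s' n None)) \<longlonglongrightarrow> N (u (Some i) - a i - u None)" if "i \<in> I" for i
      by (rule N_tendsto) (intro tendsto_intros lim jN jS that wY s' u)+
    then show "(\<lambda>n. f (s' n)) \<longlonglongrightarrow> f u"
      unfolding f_def Q_def by (intro tendsto_intros)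
    fix w' assume w': "w' \<in> Pi J C"
    have "(\<lambda>n. N (s' n j - w' j)) \<longlonglongrightarrow> N (u j - w' j)" if "j \<in> J" for j
      by (rule N_tendsto) (intro tendsto_intros lim that dY s' u w')+
    then show "(\<lambda>n. \<rho> (s' n) w') \<longlonglongrightarrow> \<rho> u w'"
      unfolding \<rho>_def by (intro tendsto_intros)
  next
    fix u u' j assume u: "u \<in> Pi J C" "u' \<in> Pi J C" "j \<in> J"
    have "(norm (u j - u' j))\<^sup>2 \<le> (N (u j - u' j))\<^sup>2"
      using norm_le_N[OF dY[OF u]] by (intro power_mono) auto
    also have "\<dots> \<le> \<rho> u u'" unfolding \<rho>_def using J u(3) by (intro member_le_sum) auto
    finally show "(norm (u j - u' j))\<^sup>2 \<le> \<rho> u u'" .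
  next
    show "0 \<le> f u" for u using Q0 by (simp add: f_def)
    show "\<rho> u u = 0" for u by (simp add: \<rho>_def N_zero)
    show "0 \<le> \<rho> u u'" for u u' unfolding \<rho>_def by (intro sum_nonneg) simp
    show "closed (C j)" if "j \<in> J" for j using that by (rule C_closed)
    show "?x0 \<in> Pi J C" "f ?x0 \<le> \<epsilon>" "\<epsilon> > 0" "\<delta> > 0" by fact+
  qed (rule that)
  define d where "d k j = v j - xs k j" for k j
  have dkY: "d k j \<in> Y" if "j \<in> J" for k j unfolding d_def using vS xsS that by (rule dY)
  have Nd: "N (d k j) \<le> l" if j: "j \<in> J" for k j
  proof -
    have "(N (d k j))\<^sup>2 \<le> \<rho> v (xs k)"
      unfolding \<rho>_def d_def using J j by (intro member_le_sum) auto
    then have "(N (d k j))\<^sup>2 \<le> l\<^sup>2" using rad[of k] \<epsilon>\<delta> by simp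
    then show ?thesis using pos(2) by (rule power2_le_imp_le[OF _ less_imp_le])
  qed
  \<comment> \<open>The centre with index 0 is the starting family, so this distance is one to
    \<open>xbar\<close>.\<close>
  have near: "norm (v j - xbar) \<le> l" if "j \<in> J" for j
    using norm_le_N[OF dkY[OF that, of 0]] Nd[OF that, of 0] by (simp add: d_def xs0)
  define w where "w i = v (Some i) - a i - v None" for i
  have wYi: "w i \<in> Y" if "i \<in> I" for i unfolding w_def using vS that by (rule wY)
  define F where "F = f v"
  have Qv: "Q v = (\<Sum>i\<in>I. (N (w i))\<^sup>2)" by (simp add: Q_def w_def)
  \<comment> \<open>At a zero of \<open>Q\<close> all the \<open>v (Some i) - a i\<close> equal
    \<open>v None\<close>, a common point of the translates within the ball.\<close>
  have Qpos: "Q v > 0"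
  proof (rule ccontr)
    assume "\<not> Q v > 0"
    then have "Q v = 0" using Q0[of v] by simp
    then have "\<forall>i\<in>I. N (w i) = 0" unfolding Qv using I by (simp add: sum_nonneg_eq_0_iff)
    then have "v None + a i = v (Some i)" if "i \<in> I" for i
      using N_eq_0[OF wYi[OF that]] that by (simp add: w_def algebra_simps)
    moreover have "v None \<in> cball xbar l" using near[OF jN] by (simp add: dist_norm norm_minus_commute)
    ultimately show False using empty[of "v None"] vS jS by (force simp: Pi_iff C_def)
  qed
  then have F: "F > 0" "F\<^sup>2 = Q v" by (auto simp: F_def f_def)
  define p where "p i h = N (w i) / F * g (w i) h" for i h
  define c where "c k = \<delta> * (1/2)^k" for k :: nat
  have c0: "c k \<ge> 0" for k using \<delta> by (simp add: c_def)
  have csum: "c sums (2 * \<delta>)"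
    unfolding c_def using sums_mult[OF geometric_sums[of "1/2::real"], of \<delta>] by (simp add: mult.commute)
  define L where "L j k h = 2 * N (d k j) * g (d k j) h" for j k h
  define t where "t j h = (\<Sum>k. c k * L j k h)" for j h
  have L_lin: "bounded_linear_on Y (L j k)" if "j \<in> J" for j k
    unfolding L_def by (rule bounded_linear_on_cmult[OF g_linear[OF dkY[OF that]]])
  have L_bound: "\<bar>L j k h\<bar> \<le> (4 * l) * norm h" if "j \<in> J" "h \<in> Y" for j k h
  proof -
    have "2 * N (d k j) * \<bar>g (d k j) h\<bar> \<le> (2 * l) * (2 * norm h)"
      using Nd[OF that(1)] g_bound[OF dkY[OF that(1)] that(2)] N_nonneg[OF dkY[OF that(1)]] pos
      by (intro mult_mono) auto
    then show ?thesis using N_nonneg[OF dkY[OF that(1)]] by (simp add: L_def abs_mult)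
  qed
  \<comment> \<open>Total weight of the penalties times the gradient bound for one squared
    norm.\<close>
  have s_eq: "2 * \<delta> * (4 * l) = s"
    using pos by (simp add: \<delta>_def \<epsilon>_def s_def power2_eq_square field_simps)
  have t_lin: "bounded_linear_on Y (t j)" and t_bound: "\<And>h. h \<in> Y \<Longrightarrow> \<bar>t j h\<bar> \<le> s * norm h"
    and t_sum: "\<And>h. h \<in> Y \<Longrightarrow> summable (\<lambda>k. c k * L j k h)" if "j \<in> J" for j
    unfolding t_def
    using bounded_linear_on_series[of Y "L j" "4 * l" c "2 * \<delta>", OF L_lin[OF that] L_bound[OF that] c0 csum] pos s_eq
    by auto
  define \<psi> where "\<psi> j k h = (N (d k j + h))\<^sup>2 - (N (d k j))\<^sup>2" for j k h
  have \<rho>_upd: "\<rho> (v(j := v j + h)) (xs k) = \<rho> v (xs k) + \<psi> j k h" if "j \<in> J" for j k h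
  proof -
    have "\<rho> (v(j := v j + h)) (xs k) = (N (d k j + h))\<^sup>2 + (\<Sum>i\<in>J - {j}. (N (v i - xs k i))\<^sup>2)"
      unfolding \<rho>_def using J that by (subst sum.remove[of _ j]) (auto simp: d_def algebra_simps intro!: sum.cong)
    moreover have "\<rho> v (xs k) = (N (d k j))\<^sup>2 + (\<Sum>i\<in>J - {j}. (N (v i - xs k i))\<^sup>2)"
      unfolding \<rho>_def using J that by (subst sum.remove[of _ j]) (auto simp: d_def)
    ultimately show ?thesis by (simp add: \<psi>_def)
  qed
  have sum_\<rho>: "summable (\<lambda>k. c k * \<rho> v (xs k))"
  proof (rule summable_comparison_test'[OF summable_mult2[OF sums_summable[OF csum], of "l\<^sup>2"]])
    fix k
    have "0 \<le> \<rho> v (xs k)" unfolding \<rho>_def by (intro sum_nonneg) auto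
    then show "norm (c k * \<rho> v (xs k)) \<le> c k * l\<^sup>2"
      using rad[of k] \<epsilon>\<delta> c0[of k] by (simp add: abs_mult mult_left_mono)
  qed
  have sum_\<psi>: "summable (\<lambda>k. c k * \<psi> j k h)" if j: "j \<in> J" and h: "h \<in> Y" for j h
  proof (rule summable_comparison_test'[OF summable_mult2[OF sums_summable[OF csum], of "(l + 2 * norm h)\<^sup>2 + l\<^sup>2"]])
    fix k
    have nn: "0 \<le> N (d k j + h)" by (rule N_nonneg[OF subspace_add[OF subspace_Y dkY[OF j] h]])
    have "N (d k j + h) \<le> l + 2 * norm h"
      using N_triangle[OF dkY[OF j] h, of k] Nd[OF j, of k] N_le[OF h] by linarith
    then have "(N (d k j + h))\<^sup>2 \<le> (l + 2 * norm h)\<^sup>2" using nn by (rule power_mono)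
    moreover have "(N (d k j))\<^sup>2 \<le> l\<^sup>2" by (rule power_mono[OF Nd[OF j] N_nonneg[OF dkY[OF j]]])
    ultimately have "\<bar>\<psi> j k h\<bar> \<le> (l + 2 * norm h)\<^sup>2 + l\<^sup>2"
      unfolding \<psi>_def using zero_le_power2[of "N (d k j + h)"] zero_le_power2[of "N (d k j)"] by linarith
    then show "norm (c k * \<psi> j k h) \<le> c k * ((l + 2 * norm h)\<^sup>2 + l\<^sup>2)"
      using c0[of k] by (simp add: abs_mult mult_left_mono)
  qed
  have up_t: "upper_gradient Y (\<lambda>h. \<Sum>k. c k * \<psi> j k h) (t j)" if j: "j \<in> J" for j
    unfolding t_def
  proof (rule upper_gradient_series[where A = "4 * l" and B = "4 * l + 4"])
    show "upper_gradient Y (\<psi> j k) (L j k)" for k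
      unfolding \<psi>_def L_def by (rule N_square_up[OF dkY[OF j]])
    show "\<psi> j k h \<le> (4 * l + 4) * norm h" if "h \<in> Y" "norm h \<le> 1" for k h
      unfolding \<psi>_def using that dkY[OF j] Nd[OF j] by (intro N_square_increment)
  qed (use j c0 csum L_bound sum_\<psi> t_sum pos in \<open>auto intro: sums_summable\<close>)
  \<comment> \<open>Only one coordinate is varied at a time, and the root is replaced by its tangent
    at \<open>Q v\<close>, whose slope is finite because \<open>F\<close> is positive.\<close>
  have stationary: "0 \<le> 1 / (2 * F) * (Q (v(j := v j + h)) - Q v) + (\<Sum>k. c k * \<psi> j k h)"
    if j: "j \<in> J" and h: "h \<in> Y" and in_C: "v j + h \<in> C j" for j h
  proof -
    define u where "u = v(j := v j + h)"
    have u: "u \<in> Pi J C" using vS in_C by (auto simp: u_def Pi_iff)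
    have split: "(\<lambda>k. c k * \<rho> u (xs k)) = (\<lambda>k. c k * \<rho> v (xs k) + c k * \<psi> j k h)"
      by (simp only: u_def \<rho>_upd[OF j] distrib_left)
    have "summable (\<lambda>k. c k * \<rho> u (xs k))"
      unfolding split by (rule summable_add[OF sum_\<rho> sum_\<psi>[OF j h]])
    then have "f v + (\<Sum>k. c k * \<rho> v (xs k)) \<le> f u + (\<Sum>k. c k * \<rho> u (xs k))"
      using min[OF u] unfolding c_def by blast
    also have "(\<Sum>k. c k * \<rho> u (xs k)) = (\<Sum>k. c k * \<rho> v (xs k)) + (\<Sum>k. c k * \<psi> j k h)"
      unfolding split by (rule suminf_add[symmetric, OF sum_\<rho> sum_\<psi>[OF j h]])
    finally have "0 \<le> f u - f v + (\<Sum>k. c k * \<psi> j k h)" by simp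
    moreover have "f u - f v \<le> 1 / (2 * F) * (Q u - Q v)"
      unfolding f_def F_def using Qpos Q0 by (rule sqrt_increment)
    ultimately show ?thesis unfolding u_def by linarith
  qed
  have p_lin: "bounded_linear_on Y (p i)" if "i \<in> I" for i
    unfolding p_def by (rule bounded_linear_on_cmult[OF g_linear[OF wYi[OF that]]])
  have up_w: "upper_gradient Y (\<lambda>h. (N (w i + h))\<^sup>2 - (N (w i))\<^sup>2) (\<lambda>h. 2 * F * p i h)" if "i \<in> I" for i
    using N_square_up[OF wYi[OF that]] F(1) by (simp add: p_def mult.assoc)
  have nrm: "normal_on Y (\<Omega> i) (v (Some i)) (\<lambda>h. - 1 * (p i h + t (Some i) h))" if i: "i \<in> I" for i
  proof (rule upper_gradient_normal[OF upper_gradient_add])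
    have "Q (v(Some i := v (Some i) + h)) - Q v = (N (w i + h))\<^sup>2 - (N (w i))\<^sup>2" for h
    proof -
      have "Q (v(Some i := v (Some i) + h)) = (N (w i + h))\<^sup>2 + (\<Sum>i'\<in>I - {i}. (N (w i'))\<^sup>2)"
        unfolding Q_def using I i by (subst sum.remove[of _ i]) (auto simp: w_def algebra_simps intro!: sum.cong)
      moreover have "Q v = (N (w i))\<^sup>2 + (\<Sum>i'\<in>I - {i}. (N (w i'))\<^sup>2)"
        unfolding Qv using I i by (subst sum.remove[of _ i]) auto
      ultimately show ?thesis by simp
    qed
    then show "upper_gradient Y (\<lambda>h. 1 / (2 * F) * (Q (v(Some i := v (Some i) + h)) - Q v)) (p i)"
      using upper_gradient_cmult[OF up_w[OF i], of "1 / (2 * F)"] F(1) by simp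
    show "upper_gradient Y (\<lambda>h. \<Sum>k. c k * \<psi> (Some i) k h) (t (Some i))" by (rule up_t[OF jS[OF i]])
    show "v (Some i) \<in> Y" by (rule CY[OF vS jS[OF i]])
    fix h assume "h \<in> Y" "v (Some i) + h \<in> \<Omega> i"
    then show "0 \<le> 1 / (2 * F) * (Q (v(Some i := v (Some i) + h)) - Q v) + (\<Sum>k. c k * \<psi> (Some i) k h)"
      using CY[OF vS jS[OF i]] by (intro stationary jS i) (auto simp: C_def intro: subspace_add subspace_Y)
  qed (rule subspace_Y)
  have bal: "(\<Sum>i\<in>I. p i h) = t None h" if h: "h \<in> Y" for h
  proof -
    have "(\<Sum>i\<in>I. p i (- h)) + t None h = 0"
    proof (rule upper_gradient_minimum[OF subspace_Y _ upper_gradient_add])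
      have neg: "p i (- h) = - 1 * p i h" if "i \<in> I" "h \<in> Y" for i h
        using bounded_linear_on_scale[OF p_lin[OF that(1)] that(2), of "-1"] by simp
      show "bounded_linear_on Y (\<lambda>h. (\<Sum>i\<in>I. p i (- h)) + t None h)"
      proof -
        have "bounded_linear_on Y (\<lambda>h. (\<Sum>i\<in>I. - 1 * p i h) + t None h)"
          by (rule bounded_linear_on_plus[OF bounded_linear_on_sum[OF I(1) bounded_linear_on_cmult[OF p_lin]] t_lin[OF jN]])
        then show ?thesis
          by (rule bounded_linear_on_cong[OF subspace_Y]) (use neg in simp)
      qed
      \<comment> \<open>Moving z by \<open>h\<close> moves every \<open>w i\<close> by
        \<open>- h\<close>, so the gradient in z is minus the sum of the \<open>p i\<close>. As z is
        free in all of \<open>Y\<close>, stationarity is an equation.\<close>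
      have "Q (v(None := v None + h)) - Q v = (\<Sum>i\<in>I. (N (w i + - h))\<^sup>2 - (N (w i))\<^sup>2)" for h
        by (simp add: Q_def w_def sum_subtractf algebra_simps)
      moreover have "upper_gradient Y (\<lambda>h. \<Sum>i\<in>I. (N (w i + - h))\<^sup>2 - (N (w i))\<^sup>2) (\<lambda>h. \<Sum>i\<in>I. 2 * F * p i (- h))"
        by (intro upper_gradient_uminus[OF subspace_Y upper_gradient_sum] I up_w)
      ultimately have "upper_gradient Y (\<lambda>h. 1 / (2 * F) * (Q (v(None := v None + h)) - Q v))
          (\<lambda>h. 1 / (2 * F) * (\<Sum>i\<in>I. 2 * F * p i (- h)))"
        using F(1) by (intro upper_gradient_cmult) auto
      then show "upper_gradient Y (\<lambda>h. 1 / (2 * F) * (Q (v(None := v None + h)) - Q v)) (\<lambda>h. \<Sum>i\<in>I. p i (- h))"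
        using F(1) by (simp add: sum_distrib_left[symmetric])
      show "upper_gradient Y (\<lambda>h. \<Sum>k. c k * \<psi> None k h) (t None)" by (rule up_t[OF jN])
      fix h assume "h \<in> Y"
      then show "0 \<le> 1 / (2 * F) * (Q (v(None := v None + h)) - Q v) + (\<Sum>k. c k * \<psi> None k h)"
        using CY[OF vS jN] by (intro stationary jN) (auto simp: C_def intro: subspace_add subspace_Y)
    qed (rule h)
    moreover have "p i (- h) = - p i h" if "i \<in> I" for i
      using bounded_linear_on_scale[OF p_lin[OF that] h, of "-1"] by simp
    ultimately show ?thesis by (simp add: sum_negf)
  qed
  show ?thesis
  proof (rule that[of "\<lambda>i. v (Some i)" p "\<lambda>i. t (Some i)" "t None" F w])
    show "(\<Sum>i\<in>I. p i (w i)) = F"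
    proof -
      \<comment> \<open>By \<open>g_self\<close>, the gradient of \<open>f\<close> paired with the
        family \<open>w\<close> returns the value of \<open>f\<close>; this is the lower bound for
        its size that later permits normalization.\<close>
      have "(\<Sum>i\<in>I. p i (w i)) = (\<Sum>i\<in>I. (N (w i))\<^sup>2) / F"
        unfolding sum_divide_distrib by (intro sum.cong) (auto simp: p_def g_self wYi power2_eq_square)
      also have "\<dots> = F\<^sup>2 / F" by (simp only: F(2) Qv)
      also have "\<dots> = F" using F(1) by (simp add: power2_eq_square)
      finally show ?thesis .
    qed
    show "(\<Sum>i\<in>I. (norm (w i))\<^sup>2) \<le> F\<^sup>2"
      unfolding F(2) Qv using norm_le_N wYi by (intro sum_mono power_mono) auto
    show "v (Some i) \<in> \<Omega> i \<inter> Y" if "i \<in> I" for i using vS jS[OF that] by (force simp: Pi_iff C_def)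
  qed (use near jS jN p_lin t_lin t_bound nrm bal F(1) wYi in auto)
qed

section \<open>Separable reduction\<close>

text \<open>Each stage adds the values of \<Phi> on all lists over the previous one. A finite list
  lies in some stage already, so the union of the stages is closed under \<Phi>.\<close>

lemma countable_list_closure:
  fixes \<Phi> :: "'a list \<Rightarrow> 'a set"
  assumes \<Phi>: "\<And>ds. countable (\<Phi> ds)" and D0: "countable D0"
  obtains D where "countable D" "D0 \<subseteq> D" "\<And>ds. ds \<in> lists D \<Longrightarrow> \<Phi> ds \<subseteq> D"
proof -
  define D where "D = rec_nat D0 (\<lambda>_ D. D \<union> (\<Union>ds\<in>lists D. \<Phi> ds))"
  have D_0: "D 0 = D0" and D_Suc: "D (Suc n) = D n \<union> (\<Union>ds\<in>lists (D n). \<Phi> ds)" for n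
    by (auto simp: D_def)
  have cD: "countable (D n)" for n
    by (induction n) (auto simp: D_0 D_Suc D0 \<Phi>)
  have mono: "D m \<subseteq> D n" if "m \<le> n" for m n
    using that by (rule lift_Suc_mono_le[rotated]) (auto simp: D_Suc)
  have stage: "\<exists>n. ds \<in> lists (D n)" if "ds \<in> lists (\<Union>n. D n)" for ds
    using that
  proof (induction ds)
    case (Cons a ds)
    then obtain m n where "ds \<in> lists (D m)" "a \<in> D n" by auto
    then have "a # ds \<in> lists (D (max m n))"
      using mono[of m "max m n"] mono[of n "max m n"] by (auto simp: in_lists_conv_set)
    then show ?case by blast
  qed auto
  show ?thesis
  proof (rule that[of "\<Union>n. D n"])
    show "countable (\<Union>n. D n)" using cD by auto
    show "D0 \<subseteq> (\<Union>n. D n)" using D_0 by blast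
    fix ds assume "ds \<in> lists (\<Union>n. D n)"
    then obtain n where "ds \<in> lists (D n)" using stage by blast
    then have "\<Phi> ds \<subseteq> D (Suc n)" by (auto simp: D_Suc)
    then show "\<Phi> ds \<subseteq> (\<Union>n. D n)" by blast
  qed
qed

text \<open>Rounding makes the set of tables countable, so that realizing all of them keeps the closure process
  countable. Triples suffice: with the vector 0 in the list they also cover norms and distances.\<close>

definition norm_table :: "nat \<Rightarrow> 'a::real_normed_vector list \<Rightarrow> int list" where
  "norm_table N ws = map (\<lambda>(a, b, c). \<lfloor>real N * norm (ws ! a + ws ! b - ws ! c)\<rfloor>)
     (List.product [0..<length ws] (List.product [0..<length ws] [0..<length ws]))"

lemma norm_table_eqD:
  assumes eq: "norm_table N ws = norm_table N ws'" and len: "length ws = length ws'" and N: "N > 0"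
    and abc: "a < length ws" "b < length ws" "c < length ws"
  shows "norm (ws ! a + ws ! b - ws ! c) \<le> norm (ws' ! a + ws' ! b - ws' ! c) + 1 / real N"
proof -
  have "\<lfloor>real N * norm (ws ! a + ws ! b - ws ! c)\<rfloor> = \<lfloor>real N * norm (ws' ! a + ws' ! b - ws' ! c)\<rfloor>"
    using eq abc unfolding norm_table_def len[symmetric] by auto
  then have "real N * norm (ws ! a + ws ! b - ws ! c) \<le> real N * norm (ws' ! a + ws' ! b - ws' ! c) + 1"
    by linarith
  then show ?thesis using N by (simp add: field_simps)
qed

text \<open>The moves \<open>T\<close> need be additive only up to \<open>e\<close> on
  \<open>G\<close>, and scalars do not occur: homogeneity comes back in the limit from boundedness.
  Membership in \<Omega> i, by contrast, is preserved exactly, since normality is tested only on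
  points of the set.\<close>

definition finitely_approximable :: "'i set \<Rightarrow> ('i \<Rightarrow> 'a::real_normed_vector set) \<Rightarrow> 'a set \<Rightarrow> bool" where
  "finitely_approximable I \<Omega> Y \<longleftrightarrow> (\<forall>G e. finite G \<longrightarrow> 0 < e \<longrightarrow> (\<exists>T.
     (\<forall>u\<in>G. T u \<in> Y \<and> norm (T u) \<le> norm u + e) \<and>
     (\<forall>u\<in>G \<inter> Y. norm (T u - u) \<le> e) \<and>
     (\<forall>u\<in>G. \<forall>v\<in>G. u + v \<in> G \<longrightarrow> norm (T u + T v - T (u + v)) \<le> e) \<and>
     (\<forall>u\<in>G. \<forall>v\<in>G. norm (T u - T v) \<le> norm (u - v) + e) \<and>
     (\<forall>i\<in>I. \<forall>u\<in>G \<inter> \<Omega> i. T u \<in> \<Omega> i)))"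

lemma subspace_closure_countable:
  fixes D :: "'a::real_normed_vector set"
  assumes zero: "0 \<in> D" and add: "\<And>x y. x \<in> D \<Longrightarrow> y \<in> D \<Longrightarrow> x + y \<in> D"
    and rat: "\<And>q x. x \<in> D \<Longrightarrow> (of_rat q :: real) *\<^sub>R x \<in> D"
  shows "subspace (closure D)"
  unfolding subspace_def
proof (intro conjI allI ballI)
  show "0 \<in> closure D" using zero closure_subset by blast
  fix x y assume "x \<in> closure D" "y \<in> closure D"
  then obtain s t where "\<And>n. s n \<in> D" "s \<longlonglongrightarrow> x" "\<And>n. t n \<in> D" "t \<longlonglongrightarrow> y"
    unfolding closure_sequential by blast
  then show "x + y \<in> closure D"
    unfolding closure_sequential using add by (intro exI[of _ "\<lambda>n. s n + t n"]) (auto intro: tendsto_add)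
next
  fix c :: real and x assume "x \<in> closure D"
  then obtain s where s: "\<And>n. s n \<in> D" "s \<longlonglongrightarrow> x"
    unfolding closure_sequential by blast
  have "\<exists>q. \<bar>of_rat q - c\<bar> < 1 / real (Suc n)" for n
  proof -
    obtain q where "c < of_rat q" "of_rat q < c + 1 / real (Suc n)"
      using of_rat_dense[of c "c + 1 / real (Suc n)"] by auto
    then show ?thesis by (intro exI[of _ q]) linarith
  qed
  then obtain q where q: "\<And>n. \<bar>of_rat (q n) - c\<bar> < 1 / real (Suc n)" by metis
  have "(\<lambda>n. of_rat (q n) - c) \<longlonglongrightarrow> 0"
    using q by (intro Lim_null_comparison[OF _ lim_inverse_n'[THEN LIMSEQ_Suc]]) (auto simp: less_imp_le)
  then have "(\<lambda>n. of_rat (q n)) \<longlonglongrightarrow> c" by (rule LIM_zero_cancel)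
  then have "(\<lambda>n. of_rat (q n) *\<^sub>R s n) \<longlonglongrightarrow> c *\<^sub>R x" using s(2) by (rule tendsto_scaleR)
  then show "c *\<^sub>R x \<in> closure D"
    unfolding closure_sequential using rat[OF s(1)] by (intro exI[of _ "\<lambda>n. of_rat (q n) *\<^sub>R s n"]) auto
qed

text \<open>A Loewenheim-Skolem argument: whenever vectors with given rounded norms relative to a
  list over \<open>D\<close> and a given membership pattern exist anywhere in the space, such
  vectors exist in \<open>D\<close>. There are only countably many lists, accuracies, tables and
  patterns.\<close>

lemma separable_finitely_approximable:
  fixes \<Omega> :: "'i \<Rightarrow> 'a::real_normed_vector set"
  assumes D0: "countable D0" and I: "finite I"
  obtains Y where "subspace Y" "closed Y" "D0 \<subseteq> Y" "separable_space (top_of_set Y)"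
    "finitely_approximable I \<Omega> Y"
proof -
  \<comment> \<open>Equal patterns also force equal lengths, which lets positions in the two lists
    be matched.\<close>
  define pat where "pat = map (\<lambda>v. {i\<in>I. v \<in> \<Omega> i})"
  \<comment> \<open>A table and pattern that no list realizes yield arbitrary vectors, which do no
    harm in \<open>D\<close>.\<close>
  define sel where "sel ds N k ps = (SOME vs. norm_table N (ds @ vs) = k \<and> pat vs = ps)" for ds N k ps
  define \<Phi> where "\<Phi> ds = range (\<lambda>q. of_rat q *\<^sub>R sum_list ds) \<union>
    (\<Union>N. \<Union>k. \<Union>ps\<in>lists (Pow I). set (sel ds N k ps))" for ds
  have "countable (lists (Pow I))" using I by (simp add: countable_finite)
  then have "countable (\<Phi> ds)" for ds
    unfolding \<Phi>_def
    by (intro countable_Un countable_image countable_UN) (simp_all add: countable_finite)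
  then obtain D where D: "countable D" "D0 \<subseteq> D" "\<And>ds. ds \<in> lists D \<Longrightarrow> \<Phi> ds \<subseteq> D"
    using countable_list_closure[OF _ D0, of \<Phi>] by metis
  have rat: "of_rat q *\<^sub>R sum_list ds \<in> D" if "ds \<in> lists D" for q ds
    using D(3)[OF that] unfolding \<Phi>_def by blast
  have zero: "0 \<in> D" using rat[of "[]"] by simp
  have add: "x + y \<in> D" if "x \<in> D" "y \<in> D" for x y using rat[of "[x, y]" 1] that by simp
  have sel: "\<exists>vs. vs \<in> lists D \<and> norm_table N (ds @ vs) = norm_table N (ds @ us) \<and> pat vs = pat us"
    if "ds \<in> lists D" for ds us N
  proof -
    define vs where "vs = sel ds N (norm_table N (ds @ us)) (pat us)"
    have "norm_table N (ds @ vs) = norm_table N (ds @ us) \<and> pat vs = pat us"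
      unfolding vs_def sel_def by (rule someI[of _ us]) simp
    moreover have "pat us \<in> lists (Pow I)" by (auto simp: pat_def)
    then have "set vs \<subseteq> D" using D(3)[OF that] unfolding \<Phi>_def vs_def by blast
    ultimately show ?thesis by (auto simp: in_lists_conv_set)
  qed
  define Y where "Y = closure D"
  have DY: "D \<subseteq> Y" by (simp add: Y_def closure_subset)
  have approx: "finitely_approximable I \<Omega> Y"
    unfolding finitely_approximable_def
  proof (intro allI impI)
    fix G :: "'a set" and e :: real assume G: "finite G" and e: "0 < e"
    obtain us where us: "set us = G" using finite_list[OF G] by blast
    \<comment> \<open>For \<open>u\<close> in \<open>Y\<close>, the distance from \<open>T u\<close>
      to \<open>u\<close> is estimated through \<open>d u\<close>: twice the distance from
      \<open>u\<close> to \<open>d u\<close>, and once the rounding error.\<close>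
    obtain N where N: "N > 0" "3 / real N < e"
    proof -
      obtain N :: nat where "3 / e < real N" using reals_Archimedean2 by blast
      moreover from this have "N > 0" using e by (auto intro: gr0I)
      ultimately show ?thesis using that[of N] e by (auto simp: field_simps)
    qed
    have "\<exists>d\<in>D. u \<in> Y \<longrightarrow> norm (u - d) < 1 / real N" for u
    proof (cases "u \<in> Y")
      case True
      then show ?thesis
        unfolding Y_def closure_approachable using N(1)
        by (auto simp: dist_norm norm_minus_commute dest: spec[of _ "1 / real N"])
    qed (use zero in auto)
    then obtain d where d: "\<And>u. d u \<in> D" "\<And>u. u \<in> Y \<Longrightarrow> norm (u - d u) < 1 / real N" by metis
    \<comment> \<open>The table fixes the distances from the new vectors to the \<open>d u\<close>,
      which ties \<open>T u\<close> to \<open>u\<close> when \<open>u\<close> lies in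
      \<open>Y\<close>.\<close>
    define ds where "ds = 0 # map d us"
    have ds: "ds \<in> lists D" using d zero by (auto simp: ds_def)
    obtain vs where vs: "vs \<in> lists D" "norm_table N (ds @ vs) = norm_table N (ds @ us)" "pat vs = pat us"
      using sel[OF ds] by blast
    have len: "length vs = length us" using arg_cong[OF vs(3), of length] by (simp add: pat_def)
    have "\<exists>j<length us. us ! j = u" if "u \<in> G" for u
      using that us by (auto simp: in_set_conv_nth)
    then obtain idx where idx: "\<And>u. u \<in> G \<Longrightarrow> idx u < length us \<and> us ! idx u = u" by metis
    define T where "T u = vs ! idx u" for u
    \<comment> \<open>In the joint list the vector 0 and \<open>length us\<close> approximants come
      first.\<close>
    define pos where "pos u = Suc (length us) + idx u" for u
    define dpos where "dpos u = Suc (idx u)" for u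
    have nth: "(ds @ vs) ! pos u = T u" "(ds @ us) ! pos u = u" "(ds @ vs) ! dpos u = d u"
      "(ds @ us) ! dpos u = d u" "pos u < length (ds @ vs)" "dpos u < length (ds @ vs)" if "u \<in> G" for u
      using idx[OF that] len by (auto simp: pos_def dpos_def ds_def T_def nth_append)
    have nth0: "(ds @ vs) ! 0 = 0" "(ds @ us) ! 0 = 0" "0 < length (ds @ vs)" by (auto simp: ds_def)
    have cmp: "norm ((ds @ vs) ! a + (ds @ vs) ! b - (ds @ vs) ! c)
        \<le> norm ((ds @ us) ! a + (ds @ us) ! b - (ds @ us) ! c) + 1 / real N"
      if "a < length (ds @ vs)" "b < length (ds @ vs)" "c < length (ds @ vs)" for a b c
      using that len by (intro norm_table_eqD vs N) auto
    have N1: "1 / real N \<le> e"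
      using N(2) divide_right_mono[of 1 3 "real N"] by simp
    show "\<exists>T. (\<forall>u\<in>G. T u \<in> Y \<and> norm (T u) \<le> norm u + e) \<and>
     (\<forall>u\<in>G \<inter> Y. norm (T u - u) \<le> e) \<and>
     (\<forall>u\<in>G. \<forall>v\<in>G. u + v \<in> G \<longrightarrow> norm (T u + T v - T (u + v)) \<le> e) \<and>
     (\<forall>u\<in>G. \<forall>v\<in>G. norm (T u - T v) \<le> norm (u - v) + e) \<and>
     (\<forall>i\<in>I. \<forall>u\<in>G \<inter> \<Omega> i. T u \<in> \<Omega> i)"
    proof (intro exI[of _ T] conjI ballI impI)
      fix u assume u: "u \<in> G"
      have "T u \<in> D" using vs(1) idx[OF u] len by (auto simp: T_def in_lists_conv_set)
      then show "T u \<in> Y" using DY by blast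
      show "norm (T u) \<le> norm u + e"
        using cmp[OF nth(5)[OF u] nth0(3) nth0(3)] nth[OF u] nth0 N1 by simp
    next
      fix u assume "u \<in> G \<inter> Y"
      then have u: "u \<in> G" "u \<in> Y" by auto
      have "norm (T u - d u) \<le> norm (u - d u) + 1 / real N"
        using cmp[OF nth(5)[OF u(1)] nth0(3) nth(6)[OF u(1)]] nth[OF u(1)] nth0 by simp
      moreover have "norm (T u - u) \<le> norm (T u - d u) + norm (u - d u)"
        using norm_triangle_ineq4[of "T u - d u" "u - d u"] by simp
      ultimately show "norm (T u - u) \<le> e" using d(2)[OF u(2)] N(2) by (simp add: field_simps)
    next
      fix u v assume u: "u \<in> G" and v: "v \<in> G" and uv: "u + v \<in> G"
      show "norm (T u + T v - T (u + v)) \<le> e"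
        using cmp[OF nth(5)[OF u] nth(5)[OF v] nth(5)[OF uv]] nth[OF u] nth[OF v] nth[OF uv] N1 by simp
    next
      fix u v assume u: "u \<in> G" and v: "v \<in> G"
      show "norm (T u - T v) \<le> norm (u - v) + e"
        using cmp[OF nth(5)[OF u] nth0(3) nth(5)[OF v]] nth[OF u] nth[OF v] nth0 N1 by simp
    next
      fix i u assume i: "i \<in> I" and "u \<in> G \<inter> \<Omega> i"
      then have u: "u \<in> G" "u \<in> \<Omega> i" by auto
      have "pat vs ! idx u = pat us ! idx u" using vs(3) by simp
      then have "{i\<in>I. T u \<in> \<Omega> i} = {i\<in>I. u \<in> \<Omega> i}"
        using idx[OF u(1)] len by (simp add: pat_def T_def)
      then show "T u \<in> \<Omega> i" using u i by blast
    qed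
  qed
  have "separable_space (top_of_set Y)"
    unfolding separable_space_def
  proof (intro exI[of _ D] conjI)
    show "countable D" by fact
    show "D \<subseteq> topspace (top_of_set Y)" using DY by simp
    show "top_of_set Y closure_of D = topspace (top_of_set Y)"
      using DY by (simp add: closure_of_subtopology Y_def Int_absorb1)
  qed
  moreover have "subspace Y"
    unfolding Y_def using rat[of "[_]"] by (intro subspace_closure_countable zero add) auto
  ultimately show ?thesis
    using that[of Y] D(2) DY approx by (auto simp: Y_def)
qed

text \<open>The defect \<open>h t = f (t x) - t f x\<close> is additive in \<open>t\<close> and
  vanishes at the integers, so it has period 1 and is bounded; a bounded additive function is
  zero.\<close>

lemma additive_bounded_imp_linear:
  fixes f :: "'a::real_normed_vector \<Rightarrow> real"
  assumes add: "\<And>x y. f (x + y) = f x + f y" and bound: "\<And>x. \<bar>f x\<bar> \<le> K * norm x"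
  shows "linear f"
proof (rule linearI)
  show "f (x + y) = f x + f y" for x y by (rule add)
  fix c :: real and x
  define h where "h t = f (t *\<^sub>R x) - t * f x" for t
  have h_add: "h (s + t) = h s + h t" for s t
    by (simp add: h_def add algebra_simps)
  have h0: "h 0 = 0" using h_add[of 0 0] by simp
  have h_nat: "h (real n * t) = real n * h t" for n t
    by (induction n) (auto simp: h0 h_add algebra_simps)
  have h_neg: "h (- t) = - h t" for t using h_add[of t "- t"] h0 by simp
  have h_int: "h (of_int k) = 0" for k
  proof -
    have "h (real n) = 0" for n using h_nat[of n 1] by (simp add: h_def)
    then show ?thesis using h_neg by (cases k rule: int_cases2) auto
  qed
  have h_bound: "\<bar>h t\<bar> \<le> 2 * \<bar>K * norm x\<bar>" for t
  proof -
    have "h t = h (frac t)"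
      using h_add[of "frac t" "of_int \<lfloor>t\<rfloor>"] h_int by (simp add: frac_def)
    moreover have "\<bar>f (frac t *\<^sub>R x)\<bar> \<le> frac t * (K * norm x)"
      using bound[of "frac t *\<^sub>R x"] by (simp add: algebra_simps)
    moreover have "\<bar>frac t * f x\<bar> \<le> frac t * (K * norm x)"
      using mult_left_mono[OF bound[of x], of "frac t"] by (simp add: abs_mult)
    moreover have "frac t * (K * norm x) \<le> 1 * \<bar>K * norm x\<bar>"
      using frac_lt_1[of t] frac_ge_0[of t] mult_mono[of "frac t" 1 "\<bar>K * norm x\<bar>" "\<bar>K * norm x\<bar>"]
        mult_left_mono[OF abs_ge_self[of "K * norm x"], of "frac t"] by linarith
    ultimately show ?thesis by (simp add: h_def)
  qed
  have "h c = 0"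
  proof (rule ccontr)
    assume "h c \<noteq> 0"
    then obtain n :: nat where "2 * \<bar>K * norm x\<bar> / \<bar>h c\<bar> < real n" using reals_Archimedean2 by blast
    then have "2 * \<bar>K * norm x\<bar> < real n * \<bar>h c\<bar>" using \<open>h c \<noteq> 0\<close> by (simp add: field_simps)
    also have "\<dots> = \<bar>h (real n * c)\<bar>" by (simp add: h_nat abs_mult)
    finally show False using h_bound[of "real n * c"] by simp
  qed
  then show "f (c *\<^sub>R x) = c *\<^sub>R f x" by (simp add: h_def)
qed

text \<open>\<open>E g\<close> is the limit of \<open>g \<circ> T p\<close> along a filter on which these limits exist for all \<open>g\<close> at once; this
  is what makes \<open>E\<close> linear in \<open>g\<close>.\<close>

lemma functional_extension_operator:
  fixes \<Omega> :: "'i \<Rightarrow> 'a::real_normed_vector set"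
  assumes Y: "subspace Y" and approx: "finitely_approximable I \<Omega> Y"
  obtains E :: "('a \<Rightarrow> real) \<Rightarrow> 'a \<Rightarrow> real"
  where "\<And>g. bounded_linear_on Y g \<Longrightarrow> linear (E g)"
    and "\<And>g K u. bounded_linear_on Y g \<Longrightarrow> \<forall>y\<in>Y. \<bar>g y\<bar> \<le> K * norm y \<Longrightarrow> 0 \<le> K \<Longrightarrow> \<bar>E g u\<bar> \<le> K * norm u"
    and "\<And>g y. bounded_linear_on Y g \<Longrightarrow> y \<in> Y \<Longrightarrow> E g y = g y"
    and "\<And>f g u. bounded_linear_on Y f \<Longrightarrow> bounded_linear_on Y g \<Longrightarrow> E (\<lambda>y. f y + g y) u = E f u + E g u"
    and "\<And>g c u. bounded_linear_on Y g \<Longrightarrow> E (\<lambda>y. c * g y) u = c * E g u"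
    and "\<And>g i x. bounded_linear_on Y g \<Longrightarrow> i \<in> I \<Longrightarrow> x \<in> Y \<Longrightarrow> normal_on Y (\<Omega> i) x g \<Longrightarrow> normal_on UNIV (\<Omega> i) x (E g)"
proof -
  let ?e = "\<lambda>n. 1 / real (Suc n)"
  define good where "good = (\<lambda>(G, n) T.
     (\<forall>u\<in>G. T u \<in> Y \<and> norm (T u) \<le> norm u + ?e n) \<and>
     (\<forall>u\<in>G \<inter> Y. norm (T u - u) \<le> ?e n) \<and>
     (\<forall>u\<in>G. \<forall>v\<in>G. u + v \<in> G \<longrightarrow> norm (T u + T v - T (u + v)) \<le> ?e n) \<and>
     (\<forall>u\<in>G. \<forall>v\<in>G. norm (T u - T v) \<le> norm (u - v) + ?e n) \<and>
     (\<forall>i\<in>I. \<forall>u\<in>G \<inter> \<Omega> i. T u \<in> \<Omega> i))"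
  have "\<exists>T. finite (fst p) \<longrightarrow> good p T" for p
  proof (cases p)
    case (Pair G n)
    have "finite G \<Longrightarrow> \<exists>T. good (G, n) T"
      using approx unfolding finitely_approximable_def good_def prod.case by simp
    then show ?thesis using Pair by auto
  qed
  then obtain T0 where T0: "\<And>p. finite (fst p) \<Longrightarrow> good p (T0 p)" by metis
  \<comment> \<open>The value 0 where \<open>T0\<close> says nothing keeps \<open>T p u\<close> in
    \<open>Y\<close> and bounded for every \<open>p\<close>, not just eventually, as the compactness
    argument requires.\<close>
  define T where "T p u = (if finite (fst p) \<and> u \<in> fst p then T0 p u else 0)" for p u
  have goodT: "good (G, n) (T (G, n))" if "finite G" for G n
    using T0[of "(G, n)"] that unfolding good_def prod.case T_def by auto
  have TY: "T p u \<in> Y" and Tnorm1: "norm (T p u) \<le> norm u + 1" for p u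
  proof -
    have "T p u \<in> Y \<and> norm (T p u) \<le> norm u + 1"
    proof (cases "finite (fst p) \<and> u \<in> fst p")
      case True
      obtain G n where p: "p = (G, n)" by (cases p)
      have "T p u \<in> Y" "norm (T p u) \<le> norm u + ?e n"
        using goodT[of G n] True by (auto simp: p good_def)
      moreover have "?e n \<le> 1" by simp
      ultimately show ?thesis by linarith
    next
      case False then show ?thesis using subspace_0[OF Y] by (auto simp: T_def)
    qed
    then show "T p u \<in> Y" "norm (T p u) \<le> norm u + 1" by auto
  qed
  have "\<exists>K. bounded_linear_on Y g \<longrightarrow> K \<ge> 0 \<and> (\<forall>y\<in>Y. \<bar>g y\<bar> \<le> K * norm y)" for g :: "'a \<Rightarrow> real"
    unfolding bounded_linear_on_def by blast
  then obtain KK where KK: "\<And>g. bounded_linear_on Y g \<Longrightarrow> KK g \<ge> 0 \<and> (\<forall>y\<in>Y. \<bar>g y\<bar> \<le> KK g * norm y)"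
    by metis
  define \<phi> where "\<phi> p = (\<lambda>(g, u). if bounded_linear_on Y g then g (T p u) else 0)" for p
  define B where "B = (\<lambda>(g, u :: 'a). if bounded_linear_on Y g then KK g * (norm u + 1) else 0)"
  have "\<bar>\<phi> p gu\<bar> \<le> B gu" for p gu
  proof (cases gu)
    case (Pair g u)
    have "\<bar>g (T p u)\<bar> \<le> KK g * (norm u + 1)" if "bounded_linear_on Y g"
    proof -
      have "\<bar>g (T p u)\<bar> \<le> KK g * norm (T p u)" using KK[OF that] TY by blast
      also have "\<dots> \<le> KK g * (norm u + 1)" using KK[OF that] Tnorm1 by (intro mult_left_mono) auto
      finally show ?thesis .
    qed
    then show ?thesis by (simp add: Pair \<phi>_def B_def)
  qed
  moreover have "finite_sets_at_top \<times>\<^sub>F sequentially \<noteq> bot"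
    by (simp add: prod_filter_eq_bot)
  ultimately obtain F z where F: "F \<le> finite_sets_at_top \<times>\<^sub>F sequentially" "F \<noteq> bot"
    and z: "\<And>gu. ((\<lambda>p. \<phi> p gu) \<longlongrightarrow> z gu) F"
    using bounded_family_convergent_subfilter[of "finite_sets_at_top \<times>\<^sub>F sequentially" \<phi> B] by metis
  define E where "E g u = z (g, u)" for g u
  have lim: "((\<lambda>p. g (T p u)) \<longlongrightarrow> E g u) F" if "bounded_linear_on Y g" for g u
    using z[of "(g, u)"] that by (simp add: \<phi>_def E_def)
  define \<eta> where "\<eta> p = ?e (snd p)" for p :: "'a set \<times> nat"
  have \<eta>: "(\<eta> \<longlongrightarrow> 0) F"
  proof -
    have "filterlim snd sequentially F"
      using F(1) filterlim_snd filterlim_mono by blast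
    then show ?thesis
      unfolding \<eta>_def using filterlim_compose[OF lim_inverse_n'[THEN LIMSEQ_Suc]] by blast
  qed
  have ev: "\<forall>\<^sub>F p in F. good p (T p) \<and> S \<subseteq> fst p" if "finite S" for S
  proof -
    have "\<forall>\<^sub>F G in finite_sets_at_top. finite G \<and> S \<subseteq> G"
      using that by (auto simp: eventually_finite_subsets_at_top)
    then have "\<forall>\<^sub>F p in finite_sets_at_top \<times>\<^sub>F sequentially. finite (fst p) \<and> S \<subseteq> fst p"
      by (intro eventually_prodI[where P = "\<lambda>G. finite G \<and> S \<subseteq> G" and Q = "\<lambda>_. True",
            simplified case_prod_unfold, THEN eventually_mono]) auto
    then have "\<forall>\<^sub>F p in F. finite (fst p) \<and> S \<subseteq> fst p" using F(1) by (rule filter_leD[rotated])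
    then show ?thesis
      by eventually_elim (use goodT in \<open>auto simp: split_paired_all\<close>)
  qed
  have goodD: "norm (T p u) \<le> norm u + \<eta> p" "u \<in> Y \<Longrightarrow> norm (T p u - u) \<le> \<eta> p"
    "v \<in> fst p \<Longrightarrow> u + v \<in> fst p \<Longrightarrow> norm (T p u + T p v - T p (u + v)) \<le> \<eta> p"
    "v \<in> fst p \<Longrightarrow> norm (T p u - T p v) \<le> norm (u - v) + \<eta> p"
    "i \<in> I \<Longrightarrow> u \<in> \<Omega> i \<Longrightarrow> T p u \<in> \<Omega> i"
    if "good p (T p)" "u \<in> fst p" for p u v i
    using that unfolding good_def \<eta>_def by (auto simp: case_prod_unfold)
  have bound: "\<bar>E g u\<bar> \<le> K * norm u"
    if g: "bounded_linear_on Y g" "\<forall>y\<in>Y. \<bar>g y\<bar> \<le> K * norm y" "0 \<le> K" for g K u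
  proof (rule tendsto_le[OF F(2) _ tendsto_rabs[OF lim[OF g(1)]]])
    have "((\<lambda>p. K * (norm u + \<eta> p)) \<longlongrightarrow> K * (norm u + 0)) F" by (intro tendsto_intros \<eta>)
    then show "((\<lambda>p. K * (norm u + \<eta> p)) \<longlongrightarrow> K * norm u) F" by simp
    show "\<forall>\<^sub>F p in F. \<bar>g (T p u)\<bar> \<le> K * (norm u + \<eta> p)"
      using ev[of "{u}"]
    proof (rule eventually_mono)
      fix p assume "good p (T p) \<and> {u} \<subseteq> fst p"
      then have "K * norm (T p u) \<le> K * (norm u + \<eta> p)" using goodD(1) g(3) by (intro mult_left_mono) auto
      then show "\<bar>g (T p u)\<bar> \<le> K * (norm u + \<eta> p)" using bspec[OF g(2) TY[of p u]] by linarith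
    qed simp
  qed
  have ext: "E g y = g y" if g: "bounded_linear_on Y g" and y: "y \<in> Y" for g y
  proof -
    have "((\<lambda>p. g (T p y) - g y) \<longlongrightarrow> 0) F"
    proof (rule Lim_null_comparison)
      have "((\<lambda>p. KK g * \<eta> p) \<longlongrightarrow> KK g * 0) F" by (intro tendsto_intros \<eta>)
      then show "((\<lambda>p. KK g * \<eta> p) \<longlongrightarrow> 0) F" by simp
      show "\<forall>\<^sub>F p in F. norm (g (T p y) - g y) \<le> KK g * \<eta> p"
        using ev[of "{y}"]
      proof (rule eventually_mono)
        fix p assume "good p (T p) \<and> {y} \<subseteq> fst p"
        then have "norm (T p y - y) \<le> \<eta> p" using goodD(2) y by auto
        then have "KK g * norm (T p y - y) \<le> KK g * \<eta> p" using KK[OF g] by (intro mult_left_mono) auto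
        moreover have "\<bar>g (T p y - y)\<bar> \<le> KK g * norm (T p y - y)"
          using KK[OF g] subspace_diff[OF Y TY y] by blast
        ultimately show "norm (g (T p y) - g y) \<le> KK g * \<eta> p"
          using bounded_linear_on_diff[OF Y g TY y] by simp
      qed simp
    qed
    then have "((\<lambda>p. g (T p y)) \<longlongrightarrow> g y) F" by (rule LIM_zero_cancel)
    then show ?thesis using tendsto_unique[OF F(2) lim[OF g]] by blast
  qed
  have add: "E g (u + v) = E g u + E g v" if g: "bounded_linear_on Y g" for g u v
  proof -
    have "((\<lambda>p. (g (T p u) + g (T p v)) - g (T p (u + v))) \<longlongrightarrow> 0) F"
    proof (rule Lim_null_comparison)
      have "((\<lambda>p. KK g * \<eta> p) \<longlongrightarrow> KK g * 0) F" by (intro tendsto_intros \<eta>)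
      then show "((\<lambda>p. KK g * \<eta> p) \<longlongrightarrow> 0) F" by simp
      show "\<forall>\<^sub>F p in F. norm ((g (T p u) + g (T p v)) - g (T p (u + v))) \<le> KK g * \<eta> p"
        using ev[of "{u, v, u + v}"]
      proof (rule eventually_mono)
        fix p assume "good p (T p) \<and> {u, v, u + v} \<subseteq> fst p"
        then have "norm (T p u + T p v - T p (u + v)) \<le> \<eta> p" using goodD(3) by auto
        then have "KK g * norm (T p u + T p v - T p (u + v)) \<le> KK g * \<eta> p"
          using KK[OF g] by (intro mult_left_mono) auto
        moreover have s: "T p u + T p v \<in> Y" by (intro subspace_add Y TY)
        have "\<bar>g (T p u + T p v - T p (u + v))\<bar> \<le> KK g * norm (T p u + T p v - T p (u + v))"
          using KK[OF g] subspace_diff[OF Y s TY] by blast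
        ultimately show "norm ((g (T p u) + g (T p v)) - g (T p (u + v))) \<le> KK g * \<eta> p"
          using bounded_linear_on_diff[OF Y g s TY] bounded_linear_on_add[OF g TY TY] by simp
      qed simp
    qed
    moreover have "((\<lambda>p. (g (T p u) + g (T p v)) - g (T p (u + v))) \<longlongrightarrow> (E g u + E g v) - E g (u + v)) F"
      by (intro tendsto_intros lim g)
    ultimately show ?thesis using tendsto_unique[OF F(2)] by fastforce
  qed
  have normal: "normal_on UNIV (\<Omega> i) x (E g)"
    if g: "bounded_linear_on Y g" and i: "i \<in> I" and x: "x \<in> Y" and nrm: "normal_on Y (\<Omega> i) x g" for g i x
    unfolding normal_on_def
  proof (intro allI impI)
    fix e :: real assume e: "e > 0"
    then obtain \<delta> where \<delta>: "\<delta> > 0"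
      "\<And>u. u \<in> \<Omega> i \<inter> Y \<Longrightarrow> norm (u - x) < \<delta> \<Longrightarrow> g (u - x) \<le> e * norm (u - x)"
      using nrm unfolding normal_on_def by blast
    have "E g (u - x) \<le> e * norm (u - x)" if u: "u \<in> \<Omega> i" "norm (u - x) < \<delta>" for u
    proof -
      have "E g ((u - x) + x) = E g (u - x) + E g x" by (rule add[OF g])
      then have eq: "E g (u - x) = E g u - g x" using ext[OF g x] by simp
      \<comment> \<open>\<open>T p u\<close> is a point of \<Omega> i \<inter> Y whose distance to
        \<open>x\<close> exceeds that of \<open>u\<close> by at most \<open>2 * \<eta> p\<close>:
        one \<eta> for comparing \<open>T p u\<close> with \<open>T p x\<close>, one for moving
        \<open>x\<close>. So normality in \<open>Y\<close> applies to it, and the surplus vanishes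
        in the limit.\<close>
      have "E g u - g x \<le> e * (norm (u - x) + 2 * 0)"
      proof (rule tendsto_le[OF F(2)])
        show "((\<lambda>p. g (T p u) - g x) \<longlongrightarrow> E g u - g x) F" by (intro tendsto_intros lim g)
        show "((\<lambda>p. e * (norm (u - x) + 2 * \<eta> p)) \<longlongrightarrow> e * (norm (u - x) + 2 * 0)) F"
          by (intro tendsto_intros \<eta>)
        have "\<forall>\<^sub>F p in F. \<eta> p < (\<delta> - norm (u - x)) / 2"
          using u(2) by (intro order_tendstoD(2)[OF \<eta>]) simp
        with ev[of "{u, x}", simplified]
        show "\<forall>\<^sub>F p in F. g (T p u) - g x \<le> e * (norm (u - x) + 2 * \<eta> p)"
        proof eventually_elim
          case (elim p)
          have "norm (T p u - T p x) \<le> norm (u - x) + \<eta> p" "norm (T p x - x) \<le> \<eta> p"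
            using goodD(4)[of p u x] goodD(2)[of p x] elim x by auto
          then have n: "norm (T p u - x) \<le> norm (u - x) + 2 * \<eta> p"
            using norm_triangle_ineq[of "T p u - T p x" "T p x - x"] by simp
          have "T p u \<in> \<Omega> i \<inter> Y" using goodD(5)[of p u i] elim i u(1) TY by auto
          moreover have "norm (T p u - x) < \<delta>" using n elim by (simp add: field_simps)
          ultimately have "g (T p u - x) \<le> e * norm (T p u - x)" by (rule \<delta>(2))
          also have "\<dots> \<le> e * (norm (u - x) + 2 * \<eta> p)" using n e by (intro mult_left_mono) auto
          finally show ?case using bounded_linear_on_diff[OF Y g TY x] by simp
        qed
      qed
      then show ?thesis using eq by simp
    qed
    then show "\<exists>\<delta>>0. \<forall>u\<in>\<Omega> i \<inter> UNIV. norm (u - x) < \<delta> \<longrightarrow> E g (u - x) \<le> e * norm (u - x)"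
      using \<delta>(1) by auto
  qed
  show ?thesis
  proof (rule that[of E])
    fix g assume g: "bounded_linear_on Y g"
    have "\<bar>E g u\<bar> \<le> KK g * norm u" for u
      using KK[OF g] by (intro bound[OF g]) auto
    then show "linear (E g)" by (rule additive_bounded_imp_linear[OF add[OF g]])
  next
    fix f g u assume fg: "bounded_linear_on Y f" "bounded_linear_on Y g"
    show "E (\<lambda>y. f y + g y) u = E f u + E g u"
      by (rule tendsto_unique[OF F(2) lim[OF bounded_linear_on_plus[OF fg]]]) (intro tendsto_intros lim fg)
  next
    fix g c u assume g: "bounded_linear_on Y g"
    show "E (\<lambda>y. c * g y) u = c * E g u"
      by (rule tendsto_unique[OF F(2) lim[OF bounded_linear_on_cmult[OF g]]]) (intro tendsto_intros lim g)
  qed (use bound ext normal in auto)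
qed

section \<open>The rated extremal principle\<close>

text \<open>The defect of the balance is spread evenly over the indices, which makes the sum exactly
  0. Testing against \<open>w\<close> keeps the Euclidean norm \<kappa> of the family away from 0,
  so dividing by it at most doubles the errors.\<close>

lemma extremal_normals:
  fixes \<Omega> :: "'i \<Rightarrow> 'a::banach set" and a :: "'i \<Rightarrow> 'a"
  assumes asp: "asplund TYPE('a)" and I: "finite I" "I \<noteq> {}"
    and cl: "\<And>i. i \<in> I \<Longrightarrow> closed (\<Omega> i)" and xbar: "\<And>i. i \<in> I \<Longrightarrow> xbar \<in> \<Omega> i"
    and a: "\<And>i. i \<in> I \<Longrightarrow> norm (a i) \<le> r" and pos: "r > 0" "l > 0"
    and empty: "\<And>z. z \<in> cball xbar l \<Longrightarrow> \<exists>i\<in>I. z + a i \<notin> \<Omega> i"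
  defines "s \<equiv> 16 * sqrt (card I) * r / l"
  assumes s: "s \<le> 1 / 2"
  obtains x :: "'i \<Rightarrow> 'a" and x' :: "'i \<Rightarrow> 'a \<Rightarrow>\<^sub>L real"
  where "\<And>i. i \<in> I \<Longrightarrow> x i \<in> \<Omega> i \<inter> cball xbar l"
    and "\<And>i. i \<in> I \<Longrightarrow> x' i \<in> frechet_normal_cone (\<Omega> i) (x i) + (\<lambda>v. (4 * s) *\<^sub>R v) ` cball 0 1"
    and "(\<Sum>i\<in>I. x' i) = 0" "(\<Sum>i\<in>I. (norm (x' i))\<^sup>2) = 1"
proof -
  have "countable (insert xbar (a ` I))" using I by (simp add: countable_finite)
  then obtain Y where Y: "subspace Y" "closed Y" "insert xbar (a ` I) \<subseteq> Y" "separable_space (top_of_set Y)"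
    and approx: "finitely_approximable I \<Omega> Y"
    using separable_finitely_approximable[OF _ I(1), of "insert xbar (a ` I)" \<Omega>] by metis
  have "separable_space (Metric_space.mtopology (subspace_dual Y) (subspace_dual_dist Y))"
    using asp Y(1,4) unfolding asplund_def by blast
  then obtain N g where "smooth_norm_on Y N g" by (rule separable_dual_smooth_norm[OF Y(1)])
  then interpret smooth_norm_on Y N g .
  obtain x w p t tz F where
    x: "\<And>i. i \<in> I \<Longrightarrow> x i \<in> \<Omega> i \<inter> Y" "\<And>i. i \<in> I \<Longrightarrow> norm (x i - xbar) \<le> l"
    and p: "\<And>i. i \<in> I \<Longrightarrow> bounded_linear_on Y (p i)" and t: "\<And>i. i \<in> I \<Longrightarrow> bounded_linear_on Y (t i)"
    and tz: "bounded_linear_on Y tz"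
    and tb: "\<And>i h. i \<in> I \<Longrightarrow> h \<in> Y \<Longrightarrow> \<bar>t i h\<bar> \<le> s * norm h" and tzb: "\<And>h. h \<in> Y \<Longrightarrow> \<bar>tz h\<bar> \<le> s * norm h"
    and nrm: "\<And>i. i \<in> I \<Longrightarrow> normal_on Y (\<Omega> i) (x i) (\<lambda>h. - 1 * (p i h + t i h))"
    and bal: "\<And>h. h \<in> Y \<Longrightarrow> (\<Sum>i\<in>I. p i h) = tz h"
    and F: "F > 0" and w: "\<And>i. i \<in> I \<Longrightarrow> w i \<in> Y" and pw: "(\<Sum>i\<in>I. p i (w i)) = F"
    and w2: "(\<Sum>i\<in>I. (norm (w i))\<^sup>2) \<le> F\<^sup>2"
  proof (rule extremal_functionals[of I \<Omega> xbar a r l, folded s_def])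
    show "xbar \<in> Y" using Y by blast
    show "a i \<in> Y" if "i \<in> I" for i using Y that by blast
    show "closed (\<Omega> i)" "xbar \<in> \<Omega> i" "norm (a i) \<le> r" if "i \<in> I" for i using that by (fact cl xbar a)+
    show "finite I" "I \<noteq> {}" "closed Y" "r > 0" "l > 0" by fact+
    show "\<exists>i\<in>I. z + a i \<notin> \<Omega> i" if "z \<in> cball xbar l" for z using that by (rule empty)
  qed (rule that)
  obtain E where
    E_lin: "\<And>g. bounded_linear_on Y g \<Longrightarrow> linear (E g)"
    and E_bound: "\<And>g K u. bounded_linear_on Y g \<Longrightarrow> \<forall>y\<in>Y. \<bar>g y\<bar> \<le> K * norm y \<Longrightarrow> 0 \<le> K \<Longrightarrow> \<bar>E g u\<bar> \<le> K * norm u"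
    and E_ext: "\<And>g y. bounded_linear_on Y g \<Longrightarrow> y \<in> Y \<Longrightarrow> E g y = g y"
    and E_add: "\<And>f g u. bounded_linear_on Y f \<Longrightarrow> bounded_linear_on Y g \<Longrightarrow> E (\<lambda>y. f y + g y) u = E f u + E g u"
    and E_mult: "\<And>g c u. bounded_linear_on Y g \<Longrightarrow> E (\<lambda>y. c * g y) u = c * E g u"
    and E_normal: "\<And>g i x. bounded_linear_on Y g \<Longrightarrow> i \<in> I \<Longrightarrow> x \<in> Y \<Longrightarrow> normal_on Y (\<Omega> i) x g \<Longrightarrow> normal_on UNIV (\<Omega> i) x (E g)"
    by (rule functional_extension_operator[OF Y(1) approx]) (rule that)
  have E_bl: "bounded_linear (E g)" if g: "bounded_linear_on Y g" for g
  proof -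
    obtain K where "K \<ge> 0" "\<And>y. y \<in> Y \<Longrightarrow> \<bar>g y\<bar> \<le> K * norm y"
      using g unfolding bounded_linear_on_def by auto
    then have "\<bar>E g u\<bar> \<le> norm u * K" for u using E_bound[OF g, of K u] by (simp add: mult.commute)
    then show ?thesis
      using E_lin[OF g] by (intro bounded_linear_intro) (auto simp: linear_add linear_scale)
  qed
  have E_sum: "E (\<lambda>y. \<Sum>i\<in>A. p i y) u = (\<Sum>i\<in>A. E (p i) u)" if "finite A" "A \<subseteq> I" for A u
    using that
  proof (induction A)
    case empty
    have "bounded_linear_on Y (\<lambda>y. 0)" by (auto simp: bounded_linear_on_def)
    from E_bound[OF this, of 0 u] show ?case by simp
  next
    case (insert i A)
    then have "bounded_linear_on Y (\<lambda>y. \<Sum>i\<in>A. p i y)" using p by (intro bounded_linear_on_sum) auto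
    then show ?case using insert E_add[OF p, of i "\<lambda>y. \<Sum>i\<in>A. p i y" u] by simp
  qed
  have E_bal: "(\<Sum>i\<in>I. E (p i) u) = E tz u" for u
  proof -
    have ps: "bounded_linear_on Y (\<lambda>y. \<Sum>i\<in>I. p i y)" using I p by (intro bounded_linear_on_sum) auto
    note m = bounded_linear_on_cmult[OF tz, of "-1"]
    \<comment> \<open>The difference vanishes on \<open>Y\<close> but may be arbitrary elsewhere;
      the norm bound with constant 0 kills its extension.\<close>
    have "\<bar>E (\<lambda>y. (\<Sum>i\<in>I. p i y) + - 1 * tz y) u\<bar> \<le> 0 * norm u"
      using bal by (intro E_bound bounded_linear_on_plus[OF ps m]) auto
    then show ?thesis
      using E_add[OF ps m, of u] E_mult[OF tz, of "-1" u] E_sum[OF I(1), of u] by simp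
  qed
  define m where "m = real (card I)"
  have m: "m \<ge> 1" using I by (simp add: m_def Suc_le_eq card_gt_0_iff)
  have spos: "s > 0" using pos m by (simp add: s_def m_def)
  define P T Z where "P i = Blinfun (E (p i))" and "T i = Blinfun (E (t i))" and "Z = Blinfun (E tz)" for i
  have P: "blinfun_apply (P i) = E (p i)" and T: "blinfun_apply (T i) = E (t i)" if "i \<in> I" for i
    using that by (auto simp: P_def T_def bounded_linear_Blinfun_apply E_bl p t)
  have Z: "blinfun_apply Z = E tz" by (simp add: Z_def bounded_linear_Blinfun_apply E_bl tz)
  have nT: "norm (T i) \<le> s" if "i \<in> I" for i
    using E_bound[OF t, OF that, of s] tb[OF that] spos by (intro norm_blinfun_bound) (auto simp: T that)
  have nZ: "norm Z \<le> s"
    using E_bound[OF tz, of s] tzb spos by (intro norm_blinfun_bound) (auto simp: Z)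
  \<comment> \<open>Since the \<open>P i\<close> sum to \<open>Z\<close>, subtracting them from
    equal shares of \<open>Z\<close> leaves total 0.\<close>
  define X where "X i = (1 / m) *\<^sub>R Z - P i" for i
  have "(\<Sum>i\<in>I. P i) = Z"
    by (rule blinfun_eqI) (simp add: blinfun.sum_left P Z E_bal)
  then have X_sum: "(\<Sum>i\<in>I. X i) = 0"
    using m by (simp add: X_def sum_subtractf m_def sum_constant_scaleR del: sum_constant)
  define \<kappa> where "\<kappa> = L2_set (\<lambda>i. norm (X i)) I"
  \<comment> \<open>Cauchy-Schwarz against \<open>w\<close>: the \<open>P i\<close> contribute
    \<open>F\<close>, the shares of \<open>Z\<close> at most \<open>s * F\<close>, and the Euclidean
    norm of \<open>w\<close> is at most \<open>F\<close>. So \<kappa> is at least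
    \<open>1 - s\<close>.\<close>
  have \<kappa>: "\<kappa> \<ge> 1 / 2"
  proof -
    have wF: "norm (w i) \<le> F" if i: "i \<in> I" for i
    proof -
      have "(norm (w i))\<^sup>2 \<le> (\<Sum>i\<in>I. (norm (w i))\<^sup>2)" using I i by (intro member_le_sum) auto
      then have "(norm (w i))\<^sup>2 \<le> F\<^sup>2" using w2 by simp
      then show ?thesis using F by (rule power2_le_imp_le[OF _ less_imp_le])
    qed
    have "(\<Sum>i\<in>I. Z (w i)) \<le> (\<Sum>i\<in>I. s * F)"
    proof (rule sum_mono)
      fix i assume i: "i \<in> I"
      have "Z (w i) \<le> norm Z * norm (w i)" using norm_blinfun[of Z "w i"] by simp
      also have "\<dots> \<le> s * F" using nZ wF[OF i] spos by (intro mult_mono) auto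
      finally show "Z (w i) \<le> s * F" .
    qed
    then have Zw: "(1 / m) * (\<Sum>i\<in>I. Z (w i)) \<le> s * F" using m by (simp add: m_def field_simps)
    have "(\<Sum>i\<in>I. P i (w i)) = F" using pw by (simp add: P E_ext[OF p w])
    then have "(\<Sum>i\<in>I. X i (w i)) = (1 / m) * (\<Sum>i\<in>I. Z (w i)) - F"
      by (simp add: X_def blinfun.diff_left blinfun.scaleR_left sum_subtractf sum_distrib_left)
    then have "(1 - s) * F \<le> - (\<Sum>i\<in>I. X i (w i))" using Zw by (simp add: algebra_simps)
    also have "\<dots> \<le> (\<Sum>i\<in>I. \<bar>norm (X i)\<bar> * \<bar>norm (w i)\<bar>)"
      unfolding sum_negf[symmetric]
    proof (rule sum_mono)
      fix i
      show "- blinfun_apply (X i) (w i) \<le> \<bar>norm (X i)\<bar> * \<bar>norm (w i)\<bar>"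
        using norm_blinfun[of "X i" "w i"] by simp
    qed
    also have "\<dots> \<le> \<kappa> * L2_set (\<lambda>i. norm (w i)) I" unfolding \<kappa>_def by (rule L2_set_mult_ineq)
    also have "\<dots> \<le> \<kappa> * F"
      using w2 F by (intro mult_left_mono) (auto simp: L2_set_def \<kappa>_def real_le_lsqrt intro!: sum_nonneg)
    finally have "1 - s \<le> \<kappa>" using F by simp
    then show ?thesis using s by simp
  qed
  define x' where "x' i = (1 / \<kappa>) *\<^sub>R X i" for i
  show ?thesis
  proof (rule that[of x x'])
    fix i assume i: "i \<in> I"
    show "x i \<in> \<Omega> i \<inter> cball xbar l" using x[OF i] by (simp add: dist_norm norm_minus_commute)
    define n where "n = (1 / \<kappa>) *\<^sub>R (- (P i + T i))"
    \<comment> \<open>The sum of \<open>T i\<close> and a share of \<open>Z\<close> has norm at most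
      \<open>2 * s\<close>; dividing by \<kappa>, at least 1/2, gives the radius
      \<open>4 * s\<close>.\<close>
    define v where "v = (1 / (4 * s * \<kappa>)) *\<^sub>R (T i + (1 / m) *\<^sub>R Z)"
    have pt: "bounded_linear_on Y (\<lambda>h. p i h + t i h)" by (rule bounded_linear_on_plus[OF p[OF i] t[OF i]])
    have "normal_on UNIV (\<Omega> i) (x i) (E (\<lambda>h. - 1 * (p i h + t i h)))"
      using x[OF i] by (intro E_normal bounded_linear_on_cmult[OF pt] i nrm) auto
    then have "normal_on UNIV (\<Omega> i) (x i) (\<lambda>h. (1 / \<kappa>) * E (\<lambda>h. - 1 * (p i h + t i h)) h)"
      using \<kappa> by (intro normal_on_scale) auto
    also have "(\<lambda>h. (1 / \<kappa>) * E (\<lambda>h. - 1 * (p i h + t i h)) h) = blinfun_apply n"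
      unfolding E_mult[OF pt] E_add[OF p[OF i] t[OF i]]
      by (simp add: n_def P[OF i] T[OF i] blinfun.add_left blinfun.minus_left blinfun.scaleR_left blinfun.diff_left fun_eq_iff)
    finally have "n \<in> frechet_normal_cone (\<Omega> i) (x i)"
      using x[OF i] by (intro normal_on_imp_frechet_normal) auto
    moreover have "norm v \<le> 1"
    proof -
      have "norm (T i + (1 / m) *\<^sub>R Z) \<le> norm (T i) + (1 / m) * norm Z"
        using norm_triangle_ineq[of "T i" "(1 / m) *\<^sub>R Z"] m by simp
      also have "\<dots> \<le> s + 1 * s"
        using nT[OF i] nZ m spos by (intro add_mono mult_mono) auto
      finally have le: "norm (T i + (1 / m) *\<^sub>R Z) \<le> 2 * s" by simp
      have "norm v = norm (T i + (1 / m) *\<^sub>R Z) / (4 * s * \<kappa>)" using spos \<kappa> by (simp add: v_def)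
      also have "\<dots> \<le> 2 * s / (4 * s * \<kappa>)" using le spos \<kappa> by (intro divide_right_mono) auto
      also have "\<dots> \<le> 1" using spos \<kappa> by (simp add: field_simps)
      finally show ?thesis .
    qed
    moreover have "x' i = n + (4 * s) *\<^sub>R v"
      using spos \<kappa> by (simp add: x'_def n_def v_def X_def scaleR_add_right scaleR_diff_right)
    ultimately show "x' i \<in> frechet_normal_cone (\<Omega> i) (x i) + (\<lambda>v. (4 * s) *\<^sub>R v) ` cball 0 1"
      by (auto intro!: set_plus_intro)
  next
    show "(\<Sum>i\<in>I. x' i) = 0" unfolding x'_def scaleR_sum_right[symmetric] X_sum by simp
    have "(\<Sum>i\<in>I. (norm (x' i))\<^sup>2) = (\<Sum>i\<in>I. (norm (X i))\<^sup>2) / \<kappa>\<^sup>2"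
      using \<kappa> by (simp add: x'_def power_divide sum_divide_distrib)
    also have "(\<Sum>i\<in>I. (norm (X i))\<^sup>2) = \<kappa>\<^sup>2"
      unfolding \<kappa>_def L2_set_def by (simp add: sum_nonneg)
    finally show "(\<Sum>i\<in>I. (norm (x' i))\<^sup>2) = 1" using \<kappa> by simp
  qed
qed

theorem theorem4p6:
  fixes T :: "'i set" and \<Omega> :: "'i \<Rightarrow> 'a::banach set" and xbar :: 'a
  assumes "asplund TYPE('a)"
    and "\<And>i. i \<in> T \<Longrightarrow> closed (\<Omega> i)"
    and "xbar \<in> (\<Inter>i\<in>T. \<Omega> i)"
    and "\<exists>R. rate_function R \<and> rated_extremal_point R T \<Omega> xbar"
  shows "\<forall>\<epsilon>>0. \<exists>(r::real) (I :: 'i set) (x :: 'i \<Rightarrow> 'a) (x' :: 'i \<Rightarrow> 'a \<Rightarrow>\<^sub>L real).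
    0 < r \<and> r < \<epsilon> \<and> finite I \<and> I \<subseteq> T \<and> real (card I) * r < \<epsilon> \<and>
    (\<forall>i\<in>I. x i \<in> \<Omega> i \<inter> cball xbar \<epsilon>) \<and>
    (\<forall>i\<in>I. x' i \<in> frechet_normal_cone (\<Omega> i) (x i) + (\<lambda>v. r *\<^sub>R v) ` cball 0 1) \<and>
    (\<Sum>i\<in>I. x' i) = 0 \<and> (\<Sum>i\<in>I. (norm (x' i))\<^sup>2) = 1"
proof (intro allI impI)
  fix \<epsilon> :: real assume \<epsilon>: "\<epsilon> > 0"
  obtain R where R: "rate_function R" "rated_extremal_point R T \<Omega> xbar" using assms(4) by blast
  obtain a r I where bdd: "\<And>k. bdd_above ((\<lambda>i. norm (a i k)) ` T)"
    and r_def: "\<And>k. r k = (SUP i\<in>T. norm (a i k))" and r0: "r \<longlonglongrightarrow> 0"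
    and I: "\<And>k. finite (I k)" "\<And>k. I k \<subseteq> T"
    and small: "(\<lambda>k. real (card (I k)) powr (3/2)) \<in> o(\<lambda>k. R (r k))"
    and disj: "\<forall>\<^sub>F k in sequentially. (\<Inter>i\<in>I k. (\<lambda>w. w - a i k) ` \<Omega> i) \<inter> cball xbar (r k * R (r k)) = {}"
    using R(2) unfolding rated_extremal_point_def by blast
  obtain M where M: "\<And>r. r \<ge> 0 \<Longrightarrow> r * R r \<le> M" and R0: "\<And>r. r \<ge> 0 \<Longrightarrow> R r \<ge> 0"
    using R(1) unfolding rate_function_def by blast
  have ar: "norm (a i k) \<le> r k" if "i \<in> T" for i k
    unfolding r_def using bdd that by (intro cSUP_upper)
  have r_nonneg: "r k \<ge> 0" for k
  \<comment> \<open>For empty \<open>T\<close> the supremum is an unspecified real, but the same one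
    for all \<open>k\<close>; convergence to 0 makes it 0.\<close>
  proof (cases "T = {}")
    case True
    then have "r = (\<lambda>_. r k)" by (auto simp: r_def)
    then have "(\<lambda>_. r k) \<longlonglongrightarrow> 0" using r0 by metis
    then show ?thesis by (simp add: LIMSEQ_const_iff)
  next
    case False
    then show ?thesis using ar[of _ k] norm_ge_zero by (meson ex_in_conv order_trans)
  qed
  \<comment> \<open>The radius \<open>r k * R (r k)\<close> is bounded but need not tend to 0, hence it is cut off at \<open>\<epsilon>\<close> below;
    the second bound in \<open>c\<close> handles the case where the cut-off is active.\<close>
  define \<eta> where "\<eta> = min \<epsilon> 2"
  define c where "c = min (\<eta> / 128) (\<eta> * \<epsilon> / (128 * (\<bar>M\<bar> + 1)))"
  have \<eta>: "\<eta> > 0" using \<epsilon> by (simp add: \<eta>_def)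
  have c: "c > 0" using \<eta> \<epsilon> by (simp add: c_def)
  from disj landau_o.smallD[OF small c]
  have "\<forall>\<^sub>F k in sequentially. (\<Inter>i\<in>I k. (\<lambda>w. w - a i k) ` \<Omega> i) \<inter> cball xbar (r k * R (r k)) = {} \<and>
      norm (real (card (I k)) powr (3/2)) \<le> c * norm (R (r k))"
    by eventually_elim simp
  then obtain k where k: "(\<Inter>i\<in>I k. (\<lambda>w. w - a i k) ` \<Omega> i) \<inter> cball xbar (r k * R (r k)) = {}"
    "norm (real (card (I k)) powr (3/2)) \<le> c * norm (R (r k))"
    by (auto simp: eventually_sequentially)
  define \<rho> where "\<rho> = r k"
  define K where "K = R \<rho>"
  define m where "m = real (card (I k))"
  have \<rho>0: "\<rho> \<ge> 0" and K0: "K \<ge> 0" using r_nonneg R0 by (auto simp: \<rho>_def K_def)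
  have KM: "\<rho> * K \<le> M" using M[OF \<rho>0] by (simp add: K_def)
  have mK: "m powr (3/2) \<le> c * K" using k(2) K0 by (simp add: m_def K_def \<rho>_def)
  have empty: "\<exists>i\<in>I k. z + a i k \<notin> \<Omega> i" if "z \<in> cball xbar (\<rho> * K)" for z
  proof (rule ccontr)
    assume "\<not> ?thesis"
    then have "z \<in> (\<lambda>w. w - a i k) ` \<Omega> i" if "i \<in> I k" for i
      using that by (intro image_eqI[of _ _ "z + a i k"]) auto
    then have "z \<in> (\<Inter>i\<in>I k. (\<lambda>w. w - a i k) ` \<Omega> i)" by blast
    then show False using k(1) that unfolding \<rho>_def K_def by blast
  qed
  have xc: "xbar \<in> cball xbar (\<rho> * K)" using \<rho>0 K0 by simp
  have Ine: "I k \<noteq> {}" using empty[OF xc] by blast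
  have xO: "xbar \<in> \<Omega> i" if "i \<in> I k" for i using assms(3) I(2) that by blast
  \<comment> \<open>If \<rho> were 0, all translations in question would be 0 and
    \<open>xbar\<close> would be a common point.\<close>
  have \<rho>: "\<rho> > 0"
  proof (rule ccontr)
    assume "\<not> \<rho> > 0"
    then have "a i k = 0" if "i \<in> I k" for i using ar[of i k] that I(2) \<rho>0 by (auto simp: \<rho>_def)
    then show False using empty[OF xc] xO by auto
  qed
  have m1: "m \<ge> 1" using Ine I(1) by (simp add: m_def Suc_le_eq card_gt_0_iff)
  then have mm: "m powr (3/2) = m * sqrt m"
    using powr_add[of m 1 "1/2"] by (simp add: powr_half_sqrt)
  \<comment> \<open>As \<open>m\<close> is at least 1, the rate bound forces \<open>K\<close> to be
    positive; this gives a radius \<open>l\<close> above 0.\<close>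
  have "m * sqrt m \<ge> 1" using m1 mult_mono[of 1 m 1 "sqrt m"] by simp
  then have "c * K > 0" using mK mm by linarith
  then have K: "K > 0" using c by (simp add: zero_less_mult_iff)
  define l where "l = min (\<rho> * K) \<epsilon>"
  have l: "l > 0" using \<rho> K \<epsilon> by (simp add: l_def)
  define s where "s = 16 * sqrt (card (I k)) * \<rho> / l"
  have spos: "s > 0" using l \<rho> m1 by (simp add: s_def m_def)
  have ms: "m * (4 * s) < \<eta>"
  proof -
    have "m * (4 * s) = 64 * (m * sqrt m) * \<rho> / l" by (simp add: s_def m_def)
    also have "\<dots> \<le> 64 * (c * K) * \<rho> / l"
      using mK mm \<rho> l by (intro divide_right_mono mult_right_mono) auto
    also have "\<dots> < \<eta>"
    proof (cases "\<rho> * K \<le> \<epsilon>")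
      case True
      then have "64 * (c * K) * \<rho> / l = 64 * c" using \<rho> K by (simp add: l_def)
      moreover have "c \<le> \<eta> / 128" unfolding c_def by (rule min.cobounded1)
      ultimately show ?thesis using \<eta> by linarith
    next
      case False
      have "c \<le> \<eta> * \<epsilon> / (128 * (\<bar>M\<bar> + 1))" unfolding c_def by (rule min.cobounded2)
      then have "c * (\<bar>M\<bar> + 1) \<le> \<eta> * \<epsilon> / 128" by (simp add: field_simps)
      moreover have "c * (\<rho> * K) \<le> c * (\<bar>M\<bar> + 1)" using KM c by (intro mult_left_mono) auto
      ultimately have "64 * (c * K) * \<rho> \<le> \<eta> * \<epsilon> / 2" by (simp add: algebra_simps)
      then have "64 * (c * K) * \<rho> / \<epsilon> \<le> \<eta> / 2" using \<epsilon> by (simp add: field_simps)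
      then show ?thesis using False \<eta> by (simp add: l_def)
    qed
    finally show ?thesis .
  qed
  \<comment> \<open>The bound 2 built into \<eta> serves here: \<open>4 * s\<close> below 2 gives
    the hypothesis \<open>s \<le> 1 / 2\<close> of \<open>extremal_normals\<close>.\<close>
  have "1 * (4 * s) \<le> m * (4 * s)" using m1 spos by (intro mult_right_mono) auto
  then have s4: "4 * s < \<epsilon>" "s \<le> 1 / 2" using ms by (auto simp: \<eta>_def)
  obtain x :: "'i \<Rightarrow> 'a" and x' :: "'i \<Rightarrow> 'a \<Rightarrow>\<^sub>L real" where
    x: "\<And>i. i \<in> I k \<Longrightarrow> x i \<in> \<Omega> i \<inter> cball xbar l"
    and x': "\<And>i. i \<in> I k \<Longrightarrow> x' i \<in> frechet_normal_cone (\<Omega> i) (x i) + (\<lambda>v. (4 * s) *\<^sub>R v) ` cball 0 1"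
      "(\<Sum>i\<in>I k. x' i) = 0" "(\<Sum>i\<in>I k. (norm (x' i))\<^sup>2) = 1"
  proof (rule extremal_normals[of "I k" \<Omega> xbar "\<lambda>i. a i k" \<rho> l, folded s_def])
    show "closed (\<Omega> i)" if "i \<in> I k" for i using assms(2) I(2) that by blast
    show "norm (a i k) \<le> \<rho>" if "i \<in> I k" for i using ar I(2) that by (auto simp: \<rho>_def)
    show "\<exists>i\<in>I k. z + a i k \<notin> \<Omega> i" if "z \<in> cball xbar l" for z
      using empty that by (auto simp: l_def)
    show "xbar \<in> \<Omega> i" if "i \<in> I k" for i using that by (rule xO)
    show "asplund TYPE('a)" "finite (I k)" "I k \<noteq> {}" "\<rho> > 0" "l > 0" "s \<le> 1 / 2"
      by (fact assms(1) I(1) Ine \<rho> l s4(2))+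
  qed (rule that)
  show "\<exists>(r::real) (I :: 'i set) (x :: 'i \<Rightarrow> 'a) (x' :: 'i \<Rightarrow> 'a \<Rightarrow>\<^sub>L real).
    0 < r \<and> r < \<epsilon> \<and> finite I \<and> I \<subseteq> T \<and> real (card I) * r < \<epsilon> \<and>
    (\<forall>i\<in>I. x i \<in> \<Omega> i \<inter> cball xbar \<epsilon>) \<and>
    (\<forall>i\<in>I. x' i \<in> frechet_normal_cone (\<Omega> i) (x i) + (\<lambda>v. r *\<^sub>R v) ` cball 0 1) \<and>
    (\<Sum>i\<in>I. x' i) = 0 \<and> (\<Sum>i\<in>I. (norm (x' i))\<^sup>2) = 1"
    using spos s4(1) I[of k] ms x x'
    by (intro exI[of _ "4 * s"] exI[of _ "I k"] exI[of _ x] exI[of _ x'])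
      (auto simp: \<eta>_def m_def l_def)
qed

end
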